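(* Consider the stochastic periodic event-triggered control (PETC) setting, the measure $\mathbb{P}^{y_0}_{\mathrm{Y}_N}$ on paths in $Q=\mathbb{R}^n\times\{0,\dots,\overline{k}\}$, a reward function $R:Q\to[0,R_{\max}]$, and an interval Markov chain $\mathrm{S}_{\mathrm{imc}}=(Q_{\mathrm{imc}},\check P,\hat P)$ abstracting the sampling behaviour, all as defined in the context. Define $\underline{R},\overline{R}:Q_{\mathrm{imc}}\to[0,R_{\max}]$ by $$\underline{R}(q)=\begin{cases}\min_{(x,s)\in q}R(x,s), & q\neq q_{\mathrm{abs}},\\ \min_{(x,s)\in\mathbb{R}^n\times\{1,\dots,\overline{k}\}}R(x,s), & q=q_{\mathrm{abs}},\end{cases}\qquad \overline{R}(q)=\begin{cases}\max_{(x,s)\in q}R(x,s), & q\neq q_{\mathrm{abs}},\\ \max_{(x,s)\in\mathbb{R}^n\times\{1,\dots,\overline{k}\}}R(x,s), & q=q_{\mathrm{abs}}.\end{cases}$$ For $\star\in\{\mathrm{cum},\mathrm{avg},\mathrm{mul}\}$ let $g_{\star,N}$ be the path reward built from $R$ (on paths $\omega$ in $Q$), and let $\underline{g}_{\star,N}$, $\overline{g}_{\star,N}$ be the path rewards built from $\underline{R}$, $\overline{R}$ respectively (on paths $\tilde\omega$ in $Q_{\mathrm{imc}}$). Then for each $\star\in\{\mathrm{cum},\mathrm{avg},\mathrm{mul}\}$, every $N\in\mathbb{N}$, every initial condition $y_0=(x_0,s_0)\in X\times\{0,\dots,\overline{k}\}$, and every $q_0\in Q_{\mathrm{imc}}$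 with $y_0\in q_0$, $$\inf_{\pi\in\Pi}\mathrm{E}^{q_0}_{\pi}[\underline{g}_{\star,N}(\tilde\omega)]\;\le\;\mathrm{E}_{\mathbb{P}^{y_0}_{\mathrm{Y}_N}}[g_{\star,N}(\omega)]\;\le\;\sup_{\pi\in\Pi}\mathrm{E}^{q_0}_{\pi}[\overline{g}_{\star,N}(\tilde\omega)].$$
   Context: **PETC system.** $A\in\mathbb{R}^{n\times n}$, $B$, $K$, $B_w$ are real matrices of compatible dimensions with $(A,B_w)$ controllable, $W$ is a standard multidimensional Wiener process on a probability space with measure $\mathbb{P}$, $\epsilon>0$, and $\overline{k}\in\mathbb{N}$, $\overline{k}\ge1$. For $x\in\mathbb{R}^n$, $\zeta(t;x)$ denotes the solution of $d\zeta(t)=A\zeta(t)\,dt+BKx\,dt+B_w\,dW(t)$, $\zeta(0)=x$ (the input is held constant at the last sampled state $x$). The intersampling time is $$\tau(x)=\min\big\{\overline{k},\ \min\{k\in\mathbb{N}:\ |\zeta(k;x)-x|_\infty-\epsilon>0\}\big\}.$$ **Sampling behaviour.** $\mathbb{N}$ includes $0$. $Q=\mathbb{R}^n\times\{0,\dots,\overline{k}\}$ and $\mathrm{Y}_N=Q^{N+1}$ is the set of paths $\omega=(\omega(0),\dots,\omega(N))$. For $y_0\in Q$, $\mathbb{P}^{y_0}_{\mathrm{Y}_N}$ is the probability measure on $\mathrm{Y}_N$ of the time-homogeneous Markov chain started at $\omega(0)=y_0$ with transition kernel, for Borel $X'\subseteq\mathbb{R}^n$ and $s'\in\{0,\dots,\overline{k}\}$,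 $$\mathbb{P}^{y_0}_{\mathrm{Y}_N}\big(\omega(i+1)\in X'\times\{s'\}\mid\omega(i)=(x,s)\big)=\mathbb{P}\big(\zeta(s';x)\in X',\ \tau(x)=s'\big).$$ **Path rewards.** For a reward function $R$ with values in $[0,R_{\max}]$ on a state set and a path $\omega$ of length $N+1$ in that set: $g_{\mathrm{cum},N}(\omega)=\sum_{i=0}^N\gamma^iR(\omega(i))$ with a fixed $\gamma\in[0,1]$; $g_{\mathrm{avg},N}(\omega)=\frac1{N+1}\sum_{i=0}^NR(\omega(i))$; $g_{\mathrm{mul},N}(\omega)=\prod_{i=0}^NR(\omega(i))$. The function $R:Q\to[0,R_{\max}]$ is Borel measurable and the minima and maxima defining $\underline R,\overline R$ are assumed to exist. **Interval Markov chains (IMCs).** An IMC is a tuple $(Q',\check P,\hat P)$ with $Q'$ a finite set and $\check P,\hat P:Q'\times Q'\to[0,1]$ satisfying $\check P\le\hat P$ and $\sum_{q'}\check P(q,q')\le1\le\sum_{q'}\hat P(q,q')$ for all $q$. A probability distribution $p$ on $Q'$ is feasible for $q$ if $\check P(q,q')\le p(q')\le\hat P(q,q')$ for all $q'$. An adversary $\pi$ is a function assigning to every finite path of the IMC (finite sequence of states) a distribution feasible for the path's last state; $\Pi$ is the set of all adversaries. Under $\pi$ and initial state $q_0$, the path $\tilde\omega$ has $\tilde\omega(0)=q_0$ and, for each $i\ge1$, $\tilde\omega(i)$ is sampled from $\pi(\tilde\omega(0),\dots,\tilde\omega(i-1))$; $\mathrm{E}^{q_0}_\pi$ is the corresponding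 expectation. **The abstracting IMC.** $X\subset\mathbb{R}^n$ is compact, with $X=\bigcup_{i=1}^m\mathcal{R}_i$, where the $\mathcal{R}_i$ are nonempty compact sets that are non-overlapping (pairwise intersections have Lebesgue measure zero). Write $\overline X=\mathbb{R}^n\setminus X$ and $Q_{\mathcal R}=\{\mathcal{R}_1,\dots,\mathcal{R}_m\}$. Then $Q_{\mathrm{imc}}=(Q_{\mathcal R}\times\{0,\dots,\overline{k}\})\cup\{q_{\mathrm{abs}}\}$; a state $(\mathcal{R},s)$ is identified with the set $\mathcal{R}\times\{s\}\subseteq Q$, and $q_{\mathrm{abs}}$ with the set $\overline X\times\{0,\dots,\overline{k}\}$. The functions $\check P,\hat P$ make $(Q_{\mathrm{imc}},\check P,\hat P)$ an IMC and satisfy, for all $(\mathcal{R},k),(\mathcal{S},s)\in Q_{\mathcal R}\times\{0,\dots,\overline{k}\}$, $$\check P((\mathcal{R},k),(\mathcal{S},s))\le\min_{x\in\mathcal{R}}\mathbb{P}(\zeta(s;x)\in\mathcal{S},\tau(x)=s),\qquad \hat P((\mathcal{R},k),(\mathcal{S},s))\ge\max_{x\in\mathcal{R}}\mathbb{P}(\zeta(s;x)\in\mathcal{S},\tau(x)=s),$$ $$\check P((\mathcal{R},k),q_{\mathrm{abs}})\le\sum_{s=0}^{\overline{k}}\min_{x\in\mathcal{R}}\mathbb{P}(\zeta(s;x)\in\overline X,\tau(x)=s),\qquad \hat P((\mathcal{R},k),q_{\mathrm{abs}})\ge\sum_{s=0}^{\overline{k}}\max_{x\in\mathcal{R}}\mathbb{P}(\zeta(s;x)\in\overline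 X,\tau(x)=s),$$ and $\check P(q_{\mathrm{abs}},q')=\hat P(q_{\mathrm{abs}},q')=1$ if $q'=q_{\mathrm{abs}}$ and $0$ otherwise. *)

theory Defs
  imports "HOL-Probability.Probability"
begin

text \<open>Every state can be steered to every other state in finite time by a continuous input.\<close>

definition controllable :: "real^'n^'n \<Rightarrow> real^'d^'n \<Rightarrow> bool" where
  "controllable A Bw \<longleftrightarrow> (\<forall>a b. \<exists>T>0. \<exists>u z.
      continuous_on {0..T} u \<and> z 0 = a \<and> z T = b \<and>
      (\<forall>t\<in>{0..T}. (z has_vector_derivative (A *v z t + Bw *v u t)) (at t within {0..T})))"

definition wiener_process :: "'w measure \<Rightarrow> (real \<Rightarrow> 'w \<Rightarrow> real^'d) \<Rightarrow> bool" where
  "wiener_process M W \<longleftrightarrow>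
     prob_space M \<and>
     (\<forall>t\<ge>0. W t \<in> borel_measurable M) \<and>
     (AE \<omega> in M. W 0 \<omega> = 0) \<and>
     (AE \<omega> in M. continuous_on {0..} (\<lambda>t. W t \<omega>)) \<and>
     (\<forall>t :: nat \<Rightarrow> real. t 0 \<ge> 0 \<longrightarrow> strict_mono t \<longrightarrow> (\<forall>k.
        prob_space.indep_vars M (\<lambda>_. borel) (\<lambda>i \<omega>. W (t (Suc i)) \<omega> - W (t i) \<omega>) {..<k})) \<and>
     (\<forall>s t. 0 \<le> s \<longrightarrow> s < t \<longrightarrow>
        prob_space.indep_vars M (\<lambda>_. borel) (\<lambda>j \<omega>. (W t \<omega> - W s \<omega>) $ j) UNIV \<and>
        (\<forall>j. distributed M lborel (\<lambda>\<omega>. (W t \<omega> - W s \<omega>) $ j)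
               (normal_density 0 (sqrt (t - s)))))"

text \<open>
  \<open>\<zeta> t x\<close> solves \<open>d\<zeta> = A \<zeta> dt + B K x dt + Bw dW\<close>, \<open>\<zeta> 0 = x\<close>, with the input held at \<open>K x\<close>.
  As \<open>Bw\<close> is constant, the stochastic integral of \<open>Bw\<close> over \<open>[0, t]\<close> is \<open>Bw (W t - W 0)\<close>, so the
  integral form of the equation can be read path by path. Adaptedness (up to null sets) to the
  filtration of \<open>W\<close> is then automatic.
\<close>

definition solves_sde ::
  "'w measure \<Rightarrow> (real \<Rightarrow> 'w \<Rightarrow> real^'d) \<Rightarrow> real^'n^'n \<Rightarrow> real^'p^'n \<Rightarrow> real^'n^'p \<Rightarrow> real^'d^'n \<Rightarrow>
   (real \<Rightarrow> real^'n \<Rightarrow> 'w \<Rightarrow> real^'n) \<Rightarrow> bool" where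
  "solves_sde M W A B K Bw \<zeta> \<longleftrightarrow> (\<forall>x.
     (\<forall>t\<ge>0. \<zeta> t x \<in> borel_measurable M) \<and>
     (AE \<omega> in M. continuous_on {0..} (\<lambda>t. \<zeta> t x \<omega>) \<and>
        (\<forall>t\<ge>0. \<zeta> t x \<omega> =
           x + integral {0..t} (\<lambda>r. A *v \<zeta> r x \<omega> + B *v (K *v x)) + Bw *v (W t \<omega> - W 0 \<omega>))))"

text \<open>The inner minimum over an empty set is read as infinity.\<close>

definition intersampling_time ::
  "(real \<Rightarrow> real^'n \<Rightarrow> 'w \<Rightarrow> real^'n) \<Rightarrow> real \<Rightarrow> nat \<Rightarrow> real^'n \<Rightarrow> 'w \<Rightarrow> nat" where
  "intersampling_time \<zeta> \<epsilon> kbar x \<omega> =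
     (if \<exists>k. infnorm (\<zeta> (real k) x \<omega> - x) - \<epsilon> > 0
      then min kbar (LEAST k. infnorm (\<zeta> (real k) x \<omega> - x) - \<epsilon> > 0)
      else kbar)"

definition trans_prob ::
  "'w measure \<Rightarrow> (real \<Rightarrow> real^'n \<Rightarrow> 'w \<Rightarrow> real^'n) \<Rightarrow> real \<Rightarrow> nat \<Rightarrow>
   real^'n \<Rightarrow> (real^'n) set \<Rightarrow> nat \<Rightarrow> real" where
  "trans_prob M \<zeta> \<epsilon> kbar x S s =
     measure M {\<omega> \<in> space M. \<zeta> (real s) x \<omega> \<in> S \<and> intersampling_time \<zeta> \<epsilon> kbar x \<omega> = s}"

definition sample_space :: "nat \<Rightarrow> ((real^'n) \<times> nat) measure" where
  "sample_space kbar = borel \<Otimes>\<^sub>M count_space {0..kbar}"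

text \<open>
  The transition kernel is the joint law of the next sampled state and the intersampling time;
  lemma \<open>measure_sample_kernel\<close> below gives its values on the sets \<open>X' \<times> {s'}\<close>.
\<close>

definition sample_kernel ::
  "'w measure \<Rightarrow> (real \<Rightarrow> real^'n \<Rightarrow> 'w \<Rightarrow> real^'n) \<Rightarrow> real \<Rightarrow> nat \<Rightarrow>
   (real^'n) \<times> nat \<Rightarrow> ((real^'n) \<times> nat) measure" where
  "sample_kernel M \<zeta> \<epsilon> kbar y = distr M (sample_space kbar)
     (\<lambda>\<omega>. let s' = intersampling_time \<zeta> \<epsilon> kbar (fst y) \<omega> in (\<zeta> (real s') (fst y) \<omega>, s'))"

text \<open>Law of \<open>(\<omega> 0, \<dots>, \<omega> N)\<close> for the time-homogeneous Markov chain with kernel \<open>\<kappa>\<close> on \<open>S\<close> started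
  at \<open>y0\<close>.\<close>

primrec markov_path_law ::
  "'s measure \<Rightarrow> ('s \<Rightarrow> 's measure) \<Rightarrow> 's \<Rightarrow> nat \<Rightarrow> (nat \<Rightarrow> 's) measure" where
  "markov_path_law S \<kappa> y0 0 = return (PiM {..0} (\<lambda>_. S)) (\<lambda>i\<in>{..0}. y0)"
| "markov_path_law S \<kappa> y0 (Suc N) =
     markov_path_law S \<kappa> y0 N \<bind>
       (\<lambda>\<omega>. distr (\<kappa> (\<omega> N)) (PiM {..Suc N} (\<lambda>_. S)) (fun_upd \<omega> (Suc N)))"

datatype criterion = Cum | Avg | Mul

fun path_reward ::
  "criterion \<Rightarrow> real \<Rightarrow> nat \<Rightarrow> ('s \<Rightarrow> real) \<Rightarrow> (nat \<Rightarrow> 's) \<Rightarrow> real" where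
  "path_reward Cum \<gamma> N r \<omega> = (\<Sum>i\<le>N. \<gamma> ^ i * r (\<omega> i))"
| "path_reward Avg \<gamma> N r \<omega> = 1 / (real N + 1) * (\<Sum>i\<le>N. r (\<omega> i))"
| "path_reward Mul \<gamma> N r \<omega> = (\<Prod>i\<le>N. r (\<omega> i))"

definition is_imc :: "'s set \<Rightarrow> ('s \<Rightarrow> 's \<Rightarrow> real) \<Rightarrow> ('s \<Rightarrow> 's \<Rightarrow> real) \<Rightarrow> bool" where
  "is_imc Q Plo Phi \<longleftrightarrow> finite Q \<and>
     (\<forall>q\<in>Q. \<forall>q'\<in>Q. 0 \<le> Plo q q' \<and> Plo q q' \<le> Phi q q' \<and> Phi q q' \<le> 1) \<and>
     (\<forall>q\<in>Q. (\<Sum>q'\<in>Q. Plo q q') \<le> 1 \<and> 1 \<le> (\<Sum>q'\<in>Q. Phi q q'))"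

definition feasible ::
  "'s set \<Rightarrow> ('s \<Rightarrow> 's \<Rightarrow> real) \<Rightarrow> ('s \<Rightarrow> 's \<Rightarrow> real) \<Rightarrow> 's \<Rightarrow> 's pmf \<Rightarrow> bool" where
  "feasible Q Plo Phi q p \<longleftrightarrow>
     set_pmf p \<subseteq> Q \<and> (\<forall>q'\<in>Q. Plo q q' \<le> pmf p q' \<and> pmf p q' \<le> Phi q q')"

definition adversaries ::
  "'s set \<Rightarrow> ('s \<Rightarrow> 's \<Rightarrow> real) \<Rightarrow> ('s \<Rightarrow> 's \<Rightarrow> real) \<Rightarrow> ('s list \<Rightarrow> 's pmf) set" where
  "adversaries Q Plo Phi =
     {\<pi>. \<forall>w. w \<noteq> [] \<longrightarrow> set w \<subseteq> Q \<longrightarrow> feasible Q Plo Phi (last w) (\<pi> w)}"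

primrec imc_path_law :: "('s list \<Rightarrow> 's pmf) \<Rightarrow> 's \<Rightarrow> nat \<Rightarrow> 's list pmf" where
  "imc_path_law \<pi> q0 0 = return_pmf [q0]"
| "imc_path_law \<pi> q0 (Suc N) =
     bind_pmf (imc_path_law \<pi> q0 N) (\<lambda>w. map_pmf (\<lambda>q. w @ [q]) (\<pi> w))"

definition imc_expectation ::
  "('s list \<Rightarrow> 's pmf) \<Rightarrow> 's \<Rightarrow> nat \<Rightarrow> ((nat \<Rightarrow> 's) \<Rightarrow> real) \<Rightarrow> real" where
  "imc_expectation \<pi> q0 N g = measure_pmf.expectation (imc_path_law \<pi> q0 N) (\<lambda>w. g (nth w))"

datatype 'x imc_state = Cell "'x set" nat | Absorb

definition imc_states :: "'x set set \<Rightarrow> nat \<Rightarrow> 'x imc_state set" where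
  "imc_states cells kbar = {Cell S s | S s. S \<in> cells \<and> s \<in> {0..kbar}} \<union> {Absorb}"

fun denotation :: "'x set \<Rightarrow> nat \<Rightarrow> 'x imc_state \<Rightarrow> ('x \<times> nat) set" where
  "denotation X kbar (Cell S s) = S \<times> {s}"
| "denotation X kbar Absorb = (- X) \<times> {0..kbar}"

text \<open>
  Here and in the rewards below, \<open>INF\<close> and \<open>SUP\<close> render minimum and maximum: they range over
  nonempty bounded sets of reals, so they agree with minimum and maximum whenever these exist. For
  the rewards, existence is expressed by \<open>attains_min_max\<close>.
\<close>

definition abstracts ::
  "'w measure \<Rightarrow> (real \<Rightarrow> real^'n \<Rightarrow> 'w \<Rightarrow> real^'n) \<Rightarrow> real \<Rightarrow> nat \<Rightarrow>
   (real^'n) set \<Rightarrow> (real^'n) set set \<Rightarrow>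
   ((real^'n) imc_state \<Rightarrow> (real^'n) imc_state \<Rightarrow> real) \<Rightarrow>
   ((real^'n) imc_state \<Rightarrow> (real^'n) imc_state \<Rightarrow> real) \<Rightarrow> bool" where
  "abstracts M \<zeta> \<epsilon> kbar X cells Plo Phi \<longleftrightarrow>
     (\<forall>C\<in>cells. \<forall>k\<in>{0..kbar}. \<forall>S\<in>cells. \<forall>s\<in>{0..kbar}.
        Plo (Cell C k) (Cell S s) \<le> (INF x\<in>C. trans_prob M \<zeta> \<epsilon> kbar x S s) \<and>
        Phi (Cell C k) (Cell S s) \<ge> (SUP x\<in>C. trans_prob M \<zeta> \<epsilon> kbar x S s)) \<and>
     (\<forall>C\<in>cells. \<forall>k\<in>{0..kbar}.
        Plo (Cell C k) Absorb \<le> (\<Sum>s=0..kbar. INF x\<in>C. trans_prob M \<zeta> \<epsilon> kbar x (- X) s) \<and>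
        Phi (Cell C k) Absorb \<ge> (\<Sum>s=0..kbar. SUP x\<in>C. trans_prob M \<zeta> \<epsilon> kbar x (- X) s)) \<and>
     (\<forall>q\<in>imc_states cells kbar.
        Plo Absorb q = (if q = Absorb then 1 else 0) \<and>
        Phi Absorb q = (if q = Absorb then 1 else 0))"

text \<open>
  Set over which \<open>R\<close> is minimised and maximised to give the reward of an abstract state. For the
  absorbing state it is not its denotation.
\<close>

fun reward_domain :: "nat \<Rightarrow> 'x imc_state \<Rightarrow> ('x \<times> nat) set" where
  "reward_domain kbar (Cell S s) = S \<times> {s}"
| "reward_domain kbar Absorb = UNIV \<times> {1..kbar}"

definition attains_min_max :: "('y \<Rightarrow> real) \<Rightarrow> 'y set \<Rightarrow> bool" where
  "attains_min_max R D \<longleftrightarrow>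
     (\<exists>y\<in>D. \<forall>z\<in>D. R y \<le> R z) \<and> (\<exists>y\<in>D. \<forall>z\<in>D. R z \<le> R y)"

definition lower_reward :: "nat \<Rightarrow> ('x \<times> nat \<Rightarrow> real) \<Rightarrow> 'x imc_state \<Rightarrow> real" where
  "lower_reward kbar R q = (INF y\<in>reward_domain kbar q. R y)"

definition upper_reward :: "nat \<Rightarrow> ('x \<times> nat \<Rightarrow> real) \<Rightarrow> 'x imc_state \<Rightarrow> real" where
  "upper_reward kbar R q = (SUP y\<in>reward_domain kbar q. R y)"

lemma intersampling_time_le: "intersampling_time \<zeta> \<epsilon> kbar x \<omega> \<le> kbar"
  by (simp add: intersampling_time_def)

lemma measurable_intersampling_time:
  fixes \<zeta> :: "real \<Rightarrow> real^'n \<Rightarrow> 'w \<Rightarrow> real^'n"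
  assumes "\<And>t. t \<ge> 0 \<Longrightarrow> \<zeta> t x \<in> borel_measurable M"
  shows "intersampling_time \<zeta> \<epsilon> kbar x \<in> measurable M (count_space UNIV)"
proof -
  have [measurable]: "\<zeta> (real k) x \<in> borel_measurable M" for k
    using assms by simp
  have [measurable]: "(infnorm :: real^'n \<Rightarrow> real) \<in> borel_measurable borel"
    by (intro borel_measurable_continuous_onI continuous_on_infnorm continuous_on_id)
  show ?thesis
    unfolding intersampling_time_def by measurable
qed

lemma measurable_sample:
  fixes \<zeta> :: "real \<Rightarrow> real^'n \<Rightarrow> 'w \<Rightarrow> real^'n"
  assumes "\<And>t. t \<ge> 0 \<Longrightarrow> \<zeta> t x \<in> borel_measurable M"
  shows "(\<lambda>\<omega>. let s' = intersampling_time \<zeta> \<epsilon> kbar x \<omega> in (\<zeta> (real s') x \<omega>, s'))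
           \<in> measurable M (sample_space kbar)"
proof -
  have tau: "intersampling_time \<zeta> \<epsilon> kbar x \<in> measurable M (count_space UNIV)"
    by (rule measurable_intersampling_time) (rule assms)
  have "(\<lambda>\<omega>. \<zeta> (real (intersampling_time \<zeta> \<epsilon> kbar x \<omega>)) x \<omega>) \<in> borel_measurable M"
    by (rule measurable_compose_countable[OF _ tau]) (simp add: assms)
  moreover have "intersampling_time \<zeta> \<epsilon> kbar x \<in> measurable M (count_space {0..kbar})"
    using tau by (auto simp: measurable_count_space_eq2_countable intersampling_time_le)
  ultimately show ?thesis
    unfolding sample_space_def Let_def by (rule measurable_Pair)
qed

lemma measure_sample_kernel:
  fixes \<zeta> :: "real \<Rightarrow> real^'n \<Rightarrow> 'w \<Rightarrow> real^'n"
  assumes "\<And>t. t \<ge> 0 \<Longrightarrow> \<zeta> t x \<in> borel_measurable M"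
    and "X' \<in> sets borel" and "s' \<le> kbar"
  shows "measure (sample_kernel M \<zeta> \<epsilon> kbar (x, s)) (X' \<times> {s'}) = trans_prob M \<zeta> \<epsilon> kbar x X' s'"
proof -
  have "X' \<times> {s'} \<in> sets (sample_space kbar :: ((real^'n) \<times> nat) measure)"
    unfolding sample_space_def using assms(2,3) by (intro pair_measureI) auto
  then show ?thesis
    unfolding sample_kernel_def trans_prob_def
    by (subst measure_distr[OF measurable_sample])
       (auto simp: assms Let_def intro!: arg_cong[where f = "measure M"])
qed

end

(* The expected path reward satisfies a backward recursion in the remaining number of steps, both
   for the sampled chain and for the IMC under an adversary that optimises each step. So it is
   enough to compare one step: from a point of a cell, the masses that the transition kernel puts on
   the cells and on the complement of X form a feasible distribution of the IMC, and the rewards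
   of the abstract states bound the rewards on the cells. Once the IMC is absorbed, its reward bounds
   R at every later state, because the intersampling time is at least 1 almost surely.

   These masses sum to 1 only if the overlaps of the cells carry no mass. An overlap is a Lebesgue
   null set, so the law of the state must be absolutely continuous, and this is where controllability
   enters. Pairing the state at time t with a solution of the adjoint equation shows that its
   characteristic function at u has modulus exp (- u G u / 2), with G the controllability Gramian.
   Integrating this against a Gaussian bounds the probability of a ball of radius r by a
   multiple of r^n, and a null set is covered by small cubes. *)

theory Submission
  imports Defs
begin

section \<open>Small balls and null sets\<close>

text \<open>Controllability is given as steering between states in some time, not as a rank
  condition, so positivity of the Gramian comes from observability of the adjoint system. The noise
  enters only through increments of \<open>W\<close>; the pairing with the adjoint solution is
  therefore a path by path limit of Riemann sums, and dominated convergence carries it over to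
  characteristic functions. Absolute continuity fails at time 0, where the state is a point mass
  that may lie in an overlap; the lower bound 1 on the intersampling time removes this case too. A
  second obstacle is measurability of the transition kernel, as nothing is assumed on how \<zeta>
  depends on the initial state; additive noise allows \<zeta> to be replaced by an almost surely
  equal version that is jointly measurable. The relation between points and abstract states that
  survives a step is membership in \<open>reward_domain\<close>, not in \<open>denotation\<close>:
  the chain can return to \<open>X\<close> while the IMC stays absorbed. Nonnegative rewards matter
  because the multiplicative criterion multiplies a stage reward with the expected
  remainder.\<close>

lemma emeasure_Union_le_nn_integral:
  "emeasure M (\<Union>D) \<le> (\<integral>\<^sup>+K. emeasure M K \<partial>count_space D)"
  if "countable D" "D \<subseteq> sets M"
proof -
  have U: "\<Union>D \<in> sets M"
    using that by (rule sets.countable_Union)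
  have "emeasure M (\<Union>D) = (\<integral>\<^sup>+x. indicator (\<Union>D) x \<partial>M)"
    using U by simp
  also have "\<dots> \<le> (\<integral>\<^sup>+x. (\<integral>\<^sup>+K. indicator K x \<partial>count_space D) \<partial>M)"
  proof (rule nn_integral_mono)
    fix x assume "x \<in> space M"
    show "indicator (\<Union>D) x \<le> (\<integral>\<^sup>+K. indicator K x \<partial>count_space D)"
    proof (cases "x \<in> \<Union>D")
      case True
      then obtain L where L: "L \<in> D" "x \<in> L" by auto
      then have "indicator L x \<le> (\<integral>\<^sup>+K. indicator K x \<partial>count_space D)"
        by (intro nn_integral_ge_point) auto
      with L show ?thesis by (simp add: indicator_def)
    qed simp
  qed
  also have "\<dots> = (\<integral>\<^sup>+K. (\<integral>\<^sup>+x. indicator K x \<partial>M) \<partial>count_space D)"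
    using that by (subst nn_integral_count_space_nn_integral) (auto intro!: nn_integral_cong)
  also have "\<dots> = (\<integral>\<^sup>+K. emeasure M K \<partial>count_space D)"
    using that by (intro nn_integral_cong) auto
  finally show ?thesis .
qed

text \<open>A product of centred Gaussians adds their precisions, here 1 and \<open>c\<close>; what
  remains is a normal density of variance 1 / (1 + c) times the ratio of the normalising
  constants.\<close>

lemma std_normal_integral_exp_quadratic:
  assumes "c \<ge> 0"
  shows "(\<integral>x. exp (- (c * x\<^sup>2 / 2)) \<partial>std_normal_distribution) = 1 / sqrt (1 + c)" (is ?eq)
    and "integrable std_normal_distribution (\<lambda>x. exp (- (c * x\<^sup>2 / 2)))" (is ?int)
proof -
  have pos: "1 + c > 0" using assms by simp
  have eq: "std_normal_density x * exp (- (c * x\<^sup>2 / 2))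
      = normal_density 0 (1 / sqrt (1 + c)) x * (1 / sqrt (1 + c))" for x
    using pos unfolding normal_density_def
    by (simp add: real_sqrt_mult real_sqrt_divide field_simps flip: exp_add)
  have "(\<integral>x. exp (- (c * x\<^sup>2 / 2)) \<partial>std_normal_distribution)
      = (\<integral>x. std_normal_density x * exp (- (c * x\<^sup>2 / 2)) \<partial>lborel)"
    by (subst integral_density) auto
  also have "\<dots> = 1 / sqrt (1 + c)"
    unfolding eq using pos by simp
  finally show ?eq .
  show ?int
    by (subst integrable_density) (use pos in \<open>auto simp: eq\<close>)
qed

lemma borel_measurable_vec_nth:
  fixes f :: "'a \<Rightarrow> real^'n"
  assumes "f \<in> borel_measurable M"
  shows "(\<lambda>x. f x $ j) \<in> borel_measurable M"
  by (rule borel_measurable_continuous_on[OF _ assms]) (intro continuous_intros)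

text \<open>Functions rather than vectors serve as points, so that the product measure splits
  integrals of products over coordinates.\<close>

definition std_normal_vec :: "('n::finite \<Rightarrow> real) measure" where
  "std_normal_vec = PiM UNIV (\<lambda>_. std_normal_distribution)"

interpretation sn: real_distribution std_normal_distribution
  by (rule real_dist_normal_dist)

interpretation snp: product_prob_space "\<lambda>_::'n::finite. std_normal_distribution" UNIV
  by unfold_locales

lemma prob_space_std_normal_vec: "prob_space std_normal_vec"
  unfolding std_normal_vec_def by (rule snp.prob_space_axioms)

lemma sets_std_normal_vec [measurable_cong]: "sets std_normal_vec = sets (PiM UNIV (\<lambda>_. borel))"
  unfolding std_normal_vec_def by (intro sets_PiM_cong) auto

lemma std_normal_vec_iexp:
  fixes u :: "'n::finite \<Rightarrow> real"
  shows "(CLINT g|std_normal_vec. iexp (\<Sum>j\<in>UNIV. u j * g j)) = exp (- (\<Sum>j\<in>UNIV. (u j)\<^sup>2) / 2)"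
proof -
  have "(CLINT g|std_normal_vec. iexp (\<Sum>j\<in>UNIV. u j * g j))
     = (CLINT g|std_normal_vec. (\<Prod>j\<in>UNIV. iexp (u j * g j)))"
    by (simp add: sum_distrib_left exp_sum)
  also have "\<dots> = (\<Prod>j\<in>UNIV. CLINT x|std_normal_distribution. iexp (u j * x))"
    unfolding std_normal_vec_def by (rule snp.product_integral_prod) (auto intro!: sn.integrable_iexp)
  also have "\<dots> = (\<Prod>j\<in>UNIV. complex_of_real (exp (- ((u j)\<^sup>2) / 2)))"
    using char_std_normal_distribution by (simp add: char_def fun_eq_iff)
  also have "\<dots> = exp (- (\<Sum>j\<in>UNIV. (u j)\<^sup>2) / 2)"
    by (simp add: sum_divide_distrib sum_negf flip: exp_sum of_real_prod)
  finally show ?thesis .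
qed

text \<open>One factor per coordinate; this is the source of the exponent \<open>CARD('n)\<close> in
  the small ball bound.\<close>

lemma std_normal_vec_exp_quadratic:
  assumes "c \<ge> 0"
  shows "(\<integral>g. exp (- (c * (\<Sum>j\<in>UNIV. (g j)\<^sup>2) / 2)) \<partial>(std_normal_vec :: ('n::finite \<Rightarrow> real) measure)) = (1 / sqrt (1 + c)) ^ CARD('n)"
    and "integrable std_normal_vec (\<lambda>g::'n \<Rightarrow> real. exp (- (c * (\<Sum>j\<in>UNIV. (g j)\<^sup>2) / 2)))"
proof -
  have eq: "exp (- (c * (\<Sum>j\<in>UNIV. (g j)\<^sup>2) / 2)) = (\<Prod>j\<in>UNIV. exp (- (c * (g j)\<^sup>2 / 2)))" for g :: "'n \<Rightarrow> real"
    by (simp add: sum_divide_distrib sum_distrib_left sum_negf flip: exp_sum)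
  show "(\<integral>g. exp (- (c * (\<Sum>j\<in>UNIV. (g j)\<^sup>2) / 2)) \<partial>(std_normal_vec :: ('n \<Rightarrow> real) measure)) = (1 / sqrt (1 + c)) ^ CARD('n)"
    unfolding eq std_normal_vec_def
    by (subst snp.product_integral_prod) (use assms in \<open>auto simp: std_normal_integral_exp_quadratic\<close>)
  show "integrable std_normal_vec (\<lambda>g::'n \<Rightarrow> real. exp (- (c * (\<Sum>j\<in>UNIV. (g j)\<^sup>2) / 2)))"
    unfolding eq std_normal_vec_def
    by (rule snp.product_integrable_prod) (use assms in \<open>auto simp: std_normal_integral_exp_quadratic\<close>)
qed

context prob_space begin

text \<open>The Gaussian \<open>exp (- |z|\<^sup>2 / (2 \<sigma>\<^sup>2))\<close> is itself a characteristic function, so by Fubini its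
  expectation is a Gaussian average of the characteristic function of \<open>Z\<close>.\<close>

lemma small_ball_prob_le:
  fixes Z :: "'a \<Rightarrow> real^'n"
  assumes Z[measurable]: "Z \<in> borel_measurable M"
    and char: "\<And>u. cmod (CLINT \<omega>|M. iexp (u \<bullet> Z \<omega>)) \<le> exp (- (\<theta> * (norm u)\<^sup>2 / 2))"
    and \<theta>: "\<theta> > 0" and \<sigma>: "\<sigma> > 0"
  shows "prob {\<omega>\<in>space M. dist (Z \<omega>) a \<le> \<sigma>} \<le> exp (1/2) * (\<sigma> / sqrt \<theta>) ^ CARD('n)"
proof -
  interpret V: prob_space "std_normal_vec :: ('n \<Rightarrow> real) measure" by (rule prob_space_std_normal_vec)
  interpret P: pair_prob_space M "std_normal_vec :: ('n \<Rightarrow> real) measure" ..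
  \<comment> \<open>One integrand for both orders of integration: over \<open>g\<close> it gives the
    Gaussian weight of \<open>Z \<omega> - a\<close>, over \<omega> it gives the characteristic
    function of \<open>Z\<close> at \<open>g / \<sigma>\<close> up to a factor of modulus 1.\<close>
  define f where "f \<omega> g = iexp (\<Sum>j\<in>UNIV. ((Z \<omega> - a) $ j / \<sigma>) * g j)" for \<omega> and g :: "'n \<Rightarrow> real"
  have inner: "(CLINT g|std_normal_vec. f \<omega> g) = exp (- (norm (Z \<omega> - a))\<^sup>2 / (2 * \<sigma>\<^sup>2))" for \<omega>
    unfolding f_def std_normal_vec_iexp
    by (simp add: power_divide norm_vec_def L2_set_def sum_nonneg real_sqrt_pow2 flip: sum_divide_distrib)
  have m[measurable]: "case_prod f \<in> borel_measurable (M \<Otimes>\<^sub>M std_normal_vec)"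
  proof -
    have [measurable]: "(\<lambda>x. (Z (fst x) - a) $ j) \<in> borel_measurable (M \<Otimes>\<^sub>M std_normal_vec)" for j
      by (rule borel_measurable_vec_nth) measurable
    have [measurable]: "(\<lambda>x. snd x j) \<in> borel_measurable (M \<Otimes>\<^sub>M (std_normal_vec :: ('n \<Rightarrow> real) measure))" for j
      by (rule measurable_compose[OF measurable_snd]) (simp add: std_normal_vec_def)
    show ?thesis
      unfolding f_def by measurable
  qed
  have int: "integrable (M \<Otimes>\<^sub>M std_normal_vec) (case_prod f)"
    by (rule P.integrable_const_bound[where B = 1]) (auto simp: f_def)
  \<comment> \<open>On the ball of radius \<sigma> the Gaussian weight is at least exp (-1/2); this
    gives a Markov type bound and the constant exp (1/2).\<close>
  have "exp (-1/2) * prob {\<omega>\<in>space M. dist (Z \<omega>) a \<le> \<sigma>}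
      = (\<integral>\<omega>. exp (-1/2) * indicator {\<omega>\<in>space M. dist (Z \<omega>) a \<le> \<sigma>} \<omega> \<partial>M)"
    by simp
  also have "\<dots> \<le> (\<integral>\<omega>. exp (- (norm (Z \<omega> - a))\<^sup>2 / (2 * \<sigma>\<^sup>2)) \<partial>M)"
  proof (rule integral_mono)
    show "integrable M (\<lambda>\<omega>. exp (- (norm (Z \<omega> - a))\<^sup>2 / (2 * \<sigma>\<^sup>2)))"
      by (rule integrable_const_bound[where B = 1]) auto
    fix \<omega>
    have "(norm (Z \<omega> - a))\<^sup>2 \<le> \<sigma>\<^sup>2" if "dist (Z \<omega>) a \<le> \<sigma>"
      using that by (intro power_mono) (auto simp: dist_norm)
    then show "exp (-1/2) * indicator {\<omega>\<in>space M. dist (Z \<omega>) a \<le> \<sigma>} \<omega> \<le> exp (- (norm (Z \<omega> - a))\<^sup>2 / (2 * \<sigma>\<^sup>2))"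
      using \<sigma> by (auto simp: indicator_def field_simps)
    show "integrable M (\<lambda>\<omega>. exp (-1/2) * indicator {\<omega>\<in>space M. dist (Z \<omega>) a \<le> \<sigma>} \<omega> :: real)"
      by (rule integrable_const_bound[where B = 1]) (auto simp: indicator_def)
  qed
  also have "\<dots> = cmod (CLINT \<omega>|M. CLINT g|std_normal_vec. f \<omega> g)"
    by (simp add: inner)
  also have "(CLINT \<omega>|M. CLINT g|std_normal_vec. f \<omega> g) = (CLINT g|std_normal_vec. CLINT \<omega>|M. f \<omega> g)"
    by (rule P.Fubini_integral[OF int, symmetric])
  also have "cmod \<dots> \<le> (\<integral>g. cmod (CLINT \<omega>|M. f \<omega> g) \<partial>std_normal_vec)"
    by (rule integral_norm_bound)
  also have "\<dots> \<le> (\<integral>g. exp (- (\<theta> / \<sigma>\<^sup>2 * (\<Sum>j\<in>UNIV. (g j)\<^sup>2) / 2)) \<partial>(std_normal_vec :: ('n \<Rightarrow> real) measure))"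
  proof (rule integral_mono)
    show "integrable std_normal_vec (\<lambda>g. cmod (CLINT \<omega>|M. f \<omega> g))"
    proof (rule V.integrable_const_bound[where B = 1])
      show "AE g in std_normal_vec. norm (cmod (CLINT \<omega>|M. f \<omega> g)) \<le> 1"
      proof (rule AE_I2)
        fix g :: "'n \<Rightarrow> real"
        have "cmod (CLINT \<omega>|M. f \<omega> g) \<le> (\<integral>\<omega>. cmod (f \<omega> g) \<partial>M)" by (rule integral_norm_bound)
        then show "norm (cmod (CLINT \<omega>|M. f \<omega> g)) \<le> 1" by (simp add: f_def prob_space)
      qed
    qed simp
    show "integrable std_normal_vec (\<lambda>g::'n \<Rightarrow> real. exp (- (\<theta> / \<sigma>\<^sup>2 * (\<Sum>j\<in>UNIV. (g j)\<^sup>2) / 2)))"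
      using \<theta> by (intro std_normal_vec_exp_quadratic) simp
    fix g :: "'n \<Rightarrow> real"
    define u :: "real^'n" where "u = (\<chi> j. g j / \<sigma>)"
    have nu: "(norm u)\<^sup>2 = (\<Sum>j\<in>UNIV. (g j)\<^sup>2) / \<sigma>\<^sup>2"
      by (simp add: u_def norm_vec_def L2_set_def sum_nonneg power_divide flip: sum_divide_distrib)
    have "f \<omega> g = iexp (u \<bullet> Z \<omega>) * iexp (- (u \<bullet> a))" for \<omega>
      unfolding f_def by (simp add: u_def inner_vec_def sum_subtractf diff_divide_distrib algebra_simps
            flip: exp_add)
    then have "cmod (CLINT \<omega>|M. f \<omega> g) = cmod (CLINT \<omega>|M. iexp (u \<bullet> Z \<omega>))"
      by (simp add: norm_mult)
    also have "\<dots> \<le> exp (- (\<theta> * (norm u)\<^sup>2 / 2))" by (rule char)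
    finally show "cmod (CLINT \<omega>|M. f \<omega> g) \<le> exp (- (\<theta> / \<sigma>\<^sup>2 * (\<Sum>j\<in>UNIV. (g j)\<^sup>2) / 2))"
      by (simp add: nu)
  qed
  also have "\<dots> = (1 / sqrt (1 + \<theta> / \<sigma>\<^sup>2)) ^ CARD('n)"
    using \<theta> by (intro std_normal_vec_exp_quadratic) simp
  also have "\<dots> \<le> (\<sigma> / sqrt \<theta>) ^ CARD('n)"
  proof (rule power_mono)
    have "1 / sqrt (1 + \<theta> / \<sigma>\<^sup>2) \<le> 1 / sqrt (\<theta> / \<sigma>\<^sup>2)"
      using \<theta> \<sigma> by (intro divide_left_mono) (auto intro!: mult_pos_pos add_pos_pos)
    also have "\<dots> = \<sigma> / sqrt \<theta>" using \<sigma> by (simp add: real_sqrt_divide)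
    finally show "1 / sqrt (1 + \<theta> / \<sigma>\<^sup>2) \<le> \<sigma> / sqrt \<theta>" .
  qed (use \<theta> in simp)
  finally have "exp (1/2) * (exp (-1/2) * prob {\<omega>\<in>space M. dist (Z \<omega>) a \<le> \<sigma>}) \<le> exp (1/2) * (\<sigma> / sqrt \<theta>) ^ CARD('n)"
    by (intro mult_left_mono) auto
  then show ?thesis by (simp add: mult.assoc[symmetric] flip: exp_add)
qed

text \<open>The small ball bound compares mass with a power of the radius, which is a volume up to a
  constant only for sets whose sides all have the same length. Hence the covering must consist of
  cubes, and boundedness of \<open>N\<close> provides a cube to subdivide.\<close>

lemma prob_null_set_eq_0:
  fixes Z :: "'a \<Rightarrow> real^'n"
  assumes Z[measurable]: "Z \<in> borel_measurable M"
    and char: "\<And>u. cmod (CLINT \<omega>|M. iexp (u \<bullet> Z \<omega>)) \<le> exp (- (\<theta> * (norm u)\<^sup>2 / 2))"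
    and \<theta>: "\<theta> > 0"
    and N: "N \<in> null_sets lborel" "bounded N"
  shows "prob {\<omega>\<in>space M. Z \<omega> \<in> N} = 0"
proof -
  let ?n = "CARD('n)"
  \<comment> \<open>The covering boxes have sides that are dyadic fractions of those of the
    enclosing box, so a cube is chosen as enclosing box.\<close>
  obtain r where r: "N \<subseteq> cbox (- r *\<^sub>R One) (r *\<^sub>R One)" "r > 0"
  proof -
    obtain b where b: "\<And>x. x \<in> N \<Longrightarrow> norm x \<le> b" using N(2) by (auto simp: bounded_iff)
    have "\<bar>x \<bullet> i\<bar> \<le> max b 1" if "x \<in> N" "i \<in> Basis" for x i
      using Basis_le_norm[OF that(2), of x] b[OF that(1)] by simp
    then have "N \<subseteq> cbox (- max b 1 *\<^sub>R One) (max b 1 *\<^sub>R One)"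
      unfolding subset_iff mem_box by (simp add: inner_sum_left_Basis abs_le_iff minus_le_iff)
    then show thesis
      by (rule that) simp
  qed
  have [measurable]: "N \<in> sets borel" using N by auto
  have Nl: "N \<in> lmeasurable" "measure lebesgue N = 0"
    using N by (auto simp: null_sets_completionI fmeasurableI_null_sets measure_eq_0_null_sets)
  \<comment> \<open>A cube of side \<delta> lies in the ball of radius \<open>?n * \<delta>\<close>
    about its lower corner, as the Euclidean norm is at most the l1 norm; \<open>C\<close> is the
    resulting bound on the ratio of mass to volume.\<close>
  define C where "C = exp (1/2) * (real ?n / sqrt \<theta>) ^ ?n"
  have C: "C > 0" using \<theta> by (simp add: C_def)
  have "prob {\<omega>\<in>space M. Z \<omega> \<in> N} \<le> 0 + e" if e: "e > 0" for e
  proof -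
    obtain D where D: "countable D"
        "\<And>K. K \<in> D \<Longrightarrow> K \<subseteq> cbox (- r *\<^sub>R One) (r *\<^sub>R One) \<and> K \<noteq> {} \<and> (\<exists>c d. K = cbox c d)"
        "pairwise (\<lambda>A B. interior A \<inter> interior B = {}) D"
        "\<And>u v. cbox u v \<in> D \<Longrightarrow> \<exists>n. \<forall>i \<in> Basis. v \<bullet> i - u \<bullet> i = ((r *\<^sub>R One) \<bullet> i - (- r *\<^sub>R One::real^'n) \<bullet> i)/2^n"
        "N \<subseteq> \<Union>D" "\<Union>D \<in> lmeasurable" "measure lebesgue (\<Union>D) \<le> measure lebesgue N + e / C"
      using measurable_outer_intervals_bounded[OF Nl(1) r(1), of "e / C"] e C
      by (metis divide_pos_pos)
    have cube: "\<exists>u v \<delta>. K = cbox u v \<and> \<delta> > 0 \<and> v = u + \<delta> *\<^sub>R One" if K: "K \<in> D" for K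
    proof -
      obtain u v where uv: "K = cbox u v" using D(2)[OF K] by blast
      obtain n where n: "\<forall>i \<in> Basis. v \<bullet> i - u \<bullet> i = 2 * r / 2 ^ n"
        using D(4)[of u v] K uv by (auto simp: inner_sum_left_Basis)
      have "v = u + (2 * r / 2^n) *\<^sub>R One"
        by (rule euclidean_eqI) (use n in \<open>simp add: inner_simps inner_sum_left_Basis algebra_simps\<close>)
      then show ?thesis using uv r(2) by (intro exI[of _ u] exI[of _ v] exI[of _ "2*r/2^n"]) auto
    qed
    let ?\<nu> = "distr M borel Z"
    have bound: "emeasure ?\<nu> K \<le> ennreal C * emeasure lborel (interior K)" if K: "K \<in> D" for K
    proof -
      obtain u v \<delta> where uv: "K = cbox u v" "\<delta> > 0" "v = u + \<delta> *\<^sub>R One" using cube[OF K] by blast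
      have sub: "K \<subseteq> cball u (real ?n * \<delta>)"
      proof
        fix z assume z: "z \<in> K"
        have "dist u z \<le> (\<Sum>i\<in>Basis. \<bar>(z - u) \<bullet> i\<bar>)"
          using norm_le_l1[of "z - u"] by (simp add: dist_norm norm_minus_commute)
        also have "\<dots> \<le> (\<Sum>i\<in>(Basis::(real^'n) set). \<delta>)"
        proof (rule sum_mono)
          fix i :: "real^'n" assume i: "i \<in> Basis"
          have "u \<bullet> i \<le> z \<bullet> i \<and> z \<bullet> i \<le> v \<bullet> i" using z i by (simp add: uv(1) mem_box)
          moreover have "v \<bullet> i = u \<bullet> i + \<delta>" using i by (simp add: uv(3) inner_simps inner_sum_left_Basis)
          ultimately show "\<bar>(z - u) \<bullet> i\<bar> \<le> \<delta>" by (simp add: inner_simps)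
        qed
        also have "\<dots> = real ?n * \<delta>" by simp
        finally show "z \<in> cball u (real ?n * \<delta>)" by simp
      qed
      have "emeasure ?\<nu> K \<le> emeasure ?\<nu> (cball u (real ?n * \<delta>))"
        by (rule emeasure_mono[OF sub]) simp
      also have "\<dots> = prob {\<omega>\<in>space M. dist (Z \<omega>) u \<le> real ?n * \<delta>}"
        by (subst emeasure_distr) (auto simp: emeasure_eq_measure dist_commute intro!: arg_cong[where f=prob])
      also have "\<dots> \<le> ennreal (exp (1/2) * (real ?n * \<delta> / sqrt \<theta>) ^ ?n)"
        using uv(2) by (intro ennreal_leI small_ball_prob_le[OF Z char \<theta>]) auto
      also have "\<dots> = ennreal (C * \<delta> ^ ?n)"
        by (simp add: C_def power_mult_distrib power_divide mult_ac)
      also have "\<dots> = ennreal C * ennreal (\<delta> ^ ?n)"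
        using C uv(2) by (simp add: ennreal_mult)
      also have "ennreal (\<delta> ^ ?n) = emeasure lborel (box u v)"
        using uv(2) by (subst emeasure_lborel_box) (auto simp: uv(3) inner_simps inner_sum_left_Basis)
      finally show ?thesis by (simp add: uv(1))
    qed
    have "\<Union>(interior ` D) \<in> sets borel" by (intro borel_open) auto
    then have opn: "\<Union>(interior ` D) \<in> sets lborel" by simp
    have Dm: "D \<subseteq> sets borel"
    proof
      fix K assume "K \<in> D"
      then obtain u v where "K = cbox u v" using D(2) by meson
      then show "K \<in> sets borel" by simp
    qed
    \<comment> \<open>Neighbouring cubes share faces. Their interiors are disjoint and have the same
      volumes, so the volumes are summed there.\<close>
    have "(\<integral>\<^sup>+K. emeasure lborel (interior K) \<partial>count_space D) = emeasure lborel (\<Union>(interior ` D))"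
      using D(1,3) by (intro emeasure_UN_countable[symmetric]) (auto simp: disjoint_family_on_def pairwise_def)
    also have "\<dots> = emeasure lebesgue (\<Union>(interior ` D))"
      using opn by (simp add: emeasure_completion sets_completionI_sets)
    also have "\<dots> \<le> emeasure lebesgue (\<Union>D)"
      using D(6) interior_subset by (intro emeasure_mono) (auto simp: fmeasurable_def)
    also have "\<dots> = ennreal (measure lebesgue (\<Union>D))"
      using D(6) by (simp add: emeasure_eq_measure2)
    also have "\<dots> \<le> ennreal (e / C)"
      using D(7) Nl(2) by (intro ennreal_leI) auto
    finally have vol: "(\<integral>\<^sup>+K. emeasure lborel (interior K) \<partial>count_space D) \<le> ennreal (e / C)" .
    have "emeasure ?\<nu> N \<le> emeasure ?\<nu> (\<Union>D)"
      using D(1,5) Dm by (intro emeasure_mono) (auto intro: sets.countable_Union)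
    also have "\<dots> \<le> (\<integral>\<^sup>+K. emeasure ?\<nu> K \<partial>count_space D)"
      using Dm by (intro emeasure_Union_le_nn_integral[OF D(1)]) auto
    also have "\<dots> \<le> (\<integral>\<^sup>+K. ennreal C * emeasure lborel (interior K) \<partial>count_space D)"
      by (intro nn_integral_mono) (auto intro: bound)
    also have "\<dots> = ennreal C * (\<integral>\<^sup>+K. emeasure lborel (interior K) \<partial>count_space D)"
      by (intro nn_integral_cmult) auto
    also have "\<dots> \<le> ennreal C * ennreal (e / C)"
      by (intro mult_left_mono vol) auto
    also have "\<dots> = ennreal e"
      using C e by (simp flip: ennreal_mult)
    finally have "emeasure ?\<nu> N \<le> ennreal e" .
    moreover have "emeasure ?\<nu> N = prob {\<omega>\<in>space M. Z \<omega> \<in> N}"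
      by (subst emeasure_distr) (auto simp: emeasure_eq_measure intro!: arg_cong[where f=prob])
    ultimately show ?thesis
      using e by simp
  qed
  then have "prob {\<omega>\<in>space M. Z \<omega> \<in> N} \<le> 0" by (rule field_le_epsilon)
  then show ?thesis by (simp add: measure_le_0_iff)
qed

end

section \<open>Linear flows and the controllability Gramian\<close>

text \<open>As a simplification rule it would turn \<open>transpose A *v x\<close> into a row vector
  product, away from the form in which the adjoint flow is stated.\<close>

declare transpose_matrix_vector [simp del]

text \<open>This is exp (s A) u, written as one real power series in \<open>s\<close> per coordinate
  so that termwise differentiation applies.\<close>

definition lin_flow :: "real^'n^'n \<Rightarrow> real \<Rightarrow> real^'n \<Rightarrow> real^'n" where
  "lin_flow A s u = (\<chi> i. \<Sum>k. ((*v) A ^^ k) u $ i * s ^ k / fact k)"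

lemma summable_lin_flow: "summable (\<lambda>k. ((*v) A ^^ k) u $ i * s ^ k / fact k)"
  for A :: "real^'n^'n"
proof -
  obtain L where L: "L > 0" "\<And>x. norm (A *v x) \<le> norm x * L"
    using bounded_linear.pos_bounded[OF matrix_vector_mul_bounded_linear[of A]] by blast
  have b: "norm (((*v) A ^^ k) u) \<le> norm u * L ^ k" for k
  proof (induction k)
    case (Suc k)
    have "norm (((*v) A ^^ Suc k) u) \<le> norm (((*v) A ^^ k) u) * L" using L(2) by simp
    also have "\<dots> \<le> norm u * L ^ k * L" using Suc L(1) by (intro mult_right_mono) auto
    finally show ?case by (simp add: mult_ac)
  qed simp
  show ?thesis
  proof (rule summable_comparison_test)
    show "\<exists>N. \<forall>k\<ge>N. norm (((*v) A ^^ k) u $ i * s ^ k / fact k) \<le> norm u * ((L * \<bar>s\<bar>) ^ k /\<^sub>R fact k)"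
    proof (intro exI allI impI)
      fix k
      have "\<bar>((*v) A ^^ k) u $ i\<bar> \<le> norm u * L ^ k"
        using component_le_norm_cart[of "((*v) A ^^ k) u" i] b[of k] by simp
      then have "\<bar>((*v) A ^^ k) u $ i\<bar> * \<bar>s\<bar> ^ k / fact k \<le> norm u * L ^ k * \<bar>s\<bar> ^ k / fact k"
        by (intro divide_right_mono mult_right_mono) auto
      then show "norm (((*v) A ^^ k) u $ i * s ^ k / fact k) \<le> norm u * ((L * \<bar>s\<bar>) ^ k /\<^sub>R fact k)"
        by (simp add: abs_mult power_abs power_mult_distrib field_simps)
    qed
    show "summable (\<lambda>k. norm u * ((L * \<bar>s\<bar>) ^ k /\<^sub>R fact k))"
      by (intro summable_mult summable_exp_generic)
  qed
qed

lemma lin_flow_0 [simp]: "lin_flow A 0 u = u"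
  proof -
  have "(\<Sum>k. ((*v) A ^^ k) u $ i * 0 ^ k / fact k) = u $ i" for i
    using powser_zero[of "\<lambda>k. ((*v) A ^^ k) u $ i / fact k"] by simp
  then show ?thesis by (simp add: lin_flow_def vec_eq_iff)
qed

lemma lin_flow_matrix:
  "lin_flow A s (A *v u) = A *v lin_flow A s u"
proof -
  have "((*v) A ^^ k) (A *v u) $ i = (\<Sum>j\<in>UNIV. A $ i $ j * ((*v) A ^^ k) u $ j)" for i k
    by (subst funpow_swap1[symmetric]) (simp add: matrix_vector_mult_def[of A "((*v) A ^^ k) u"])
  then have "lin_flow A s (A *v u) $ i = (\<Sum>k. \<Sum>j\<in>UNIV. A $ i $ j * (((*v) A ^^ k) u $ j * s ^ k / fact k))" for i
    by (simp add: lin_flow_def sum_distrib_left sum_divide_distrib mult_ac)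
  also have "\<dots> i = (A *v lin_flow A s u) $ i" for i
    unfolding matrix_vector_mult_def[of A "lin_flow A s u"]
    by (subst suminf_sum) (simp_all only: lin_flow_def vec_lambda_beta suminf_mult[OF summable_lin_flow] summable_mult[OF summable_lin_flow])
  finally show ?thesis by (simp add: vec_eq_iff)
qed

lemma linear_lin_flow: "linear (lin_flow A s)"
proof (rule linearI)
  have *: "((*v) A ^^ k) (x + y) = ((*v) A ^^ k) x + ((*v) A ^^ k) y" for k x y
    by (induction k) (auto simp: matrix_vector_right_distrib)
  show "lin_flow A s (x + y) = lin_flow A s x + lin_flow A s y" for x y
    by (simp add: lin_flow_def vec_eq_iff * add_divide_distrib distrib_right suminf_add[OF summable_lin_flow summable_lin_flow])
  have *: "((*v) A ^^ k) (c *\<^sub>R x) = c *\<^sub>R ((*v) A ^^ k) x" for k x c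
    by (induction k) (auto simp: matrix_vector_mult_scaleR)
  show "lin_flow A s (c *\<^sub>R x) = c *\<^sub>R lin_flow A s x" for c x
  proof -
    have "(\<Sum>k. c * ((*v) A ^^ k) x $ i * s ^ k / fact k) = c * (\<Sum>k. ((*v) A ^^ k) x $ i * s ^ k / fact k)" for i
      by (subst suminf_mult[OF summable_lin_flow, symmetric]) (simp add: mult.assoc)
    then show ?thesis by (simp add: lin_flow_def vec_eq_iff *)
  qed
qed

lemma has_vector_derivative_lin_flow:
  "((\<lambda>s. lin_flow A s u) has_vector_derivative A *v lin_flow A s u) (at s within S)"
proof -
  have "((\<lambda>s. lin_flow A s u $ i) has_vector_derivative lin_flow A s (A *v u) $ i) (at s)" for i
  proof -
    define c where "c k = ((*v) A ^^ k) u $ i / fact k" for k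
    have "((\<lambda>s. \<Sum>k. c k * s ^ k) has_field_derivative (\<Sum>k. diffs c k * s ^ k)) (at s)"
      by (rule termdiffs_strong_converges_everywhere) (use summable_lin_flow in \<open>simp add: c_def\<close>)
    \<comment> \<open>The factor k + 1 from differentiation cancels against the factorial, so the
      differentiated series is the flow of \<open>A *v u\<close>.\<close>
    moreover have "diffs c k = ((*v) A ^^ k) (A *v u) $ i / fact k" for k
      by (simp add: diffs_def c_def funpow_swap1 divide_simps del: of_nat_Suc)
    ultimately show ?thesis
      by (simp add: lin_flow_def c_def has_real_derivative_iff_has_vector_derivative)
  qed
  then have "((\<lambda>s. lin_flow A s u) has_vector_derivative lin_flow A s (A *v u)) (at s)"
    unfolding has_vector_derivative_def has_derivative_componentwise_within[of "\<lambda>s. lin_flow A s u"] Basis_vec_def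
    by (auto simp: cart_eq_inner_axis)
  then show ?thesis
    by (metis has_vector_derivative_at_within lin_flow_matrix)
qed

lemma continuous_on_lin_flow:
  "continuous_on S f \<Longrightarrow> continuous_on S (\<lambda>x. lin_flow A (f x) u)"
  by (rule continuous_on_compose2[of UNIV "\<lambda>s. lin_flow A s u"])
     (auto intro!: continuous_on_vector_derivative has_vector_derivative_lin_flow)

lemma continuous_on_matrix_vector_mult:
  fixes C :: "real^'n^'m"
  shows "continuous_on S f \<Longrightarrow> continuous_on S (\<lambda>x. C *v f x)"
  by (rule bounded_linear.continuous_on[OF matrix_vector_mul_bounded_linear])

text \<open>Linearity in \<open>u\<close> reduces this to continuity in time for the finitely many
  basis vectors. Joint continuity makes the Gramian form continuous on the unit sphere.\<close>

lemma continuous_on_lin_flow_joint: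
  fixes A :: "real^'n^'n"
  assumes "continuous_on S f" "continuous_on S g"
  shows "continuous_on S (\<lambda>x. lin_flow A (f x) (g x))"
proof -
  have eq: "lin_flow A s u = (\<Sum>i\<in>UNIV. u $ i *\<^sub>R lin_flow A s (axis i 1))" for s u
  proof -
    have "lin_flow A s (\<Sum>i\<in>UNIV. u $ i *\<^sub>R axis i 1) = (\<Sum>i\<in>UNIV. u $ i *\<^sub>R lin_flow A s (axis i 1))"
      by (simp add: linear_sum[OF linear_lin_flow] linear_cmul[OF linear_lin_flow])
    then show ?thesis using basis_expansion[of u] by (simp add: scalar_mult_eq_scaleR)
  qed
  have "continuous_on S (\<lambda>x. \<Sum>i\<in>UNIV. g x $ i *\<^sub>R lin_flow A (f x) (axis i 1))"
    by (intro continuous_on_sum continuous_on_scaleR continuous_on_component continuous_on_lin_flow assms)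
  then show ?thesis
    unfolding eq[symmetric] .
qed

text \<open>An analyticity argument: differentiating inside the interval and letting
  \<open>s\<close> tend to 0 gives C A^k u = 0 for every k, and these are the coefficients of the
  series at arbitrary \<open>s\<close>. It is needed because a steering control may take longer than
  \<open>t\<close>.\<close>

lemma lin_flow_eq_0_on_interval:
  fixes A :: "real^'n^'n" and C :: "real^'n^'m"
  assumes "t > 0" and zero: "\<And>s. s \<in> {0..t} \<Longrightarrow> C *v lin_flow A s u = 0"
  shows "C *v lin_flow A s u = 0"
proof -
  define w where "w k = ((*v) A ^^ k) u" for k
  have w0: "\<forall>s\<in>{0<..<t}. C *v lin_flow A s (w k) = 0" for k
  proof (induction k)
    case (Suc k)
    show ?case
    proof
      fix s assume s: "s \<in> {0<..<t}"
      have "((\<lambda>s. C *v lin_flow A s (w k)) has_vector_derivative C *v (A *v lin_flow A s (w k))) (at s)"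
        by (rule bounded_linear.has_vector_derivative[OF matrix_vector_mul_bounded_linear has_vector_derivative_lin_flow])
      moreover have "((\<lambda>s. C *v lin_flow A s (w k)) has_vector_derivative 0) (at s)"
        by (rule has_vector_derivative_transform_within_open[of "\<lambda>_. 0" _ _ "{0<..<t}"])
           (use s Suc in auto)
      ultimately have "C *v (A *v lin_flow A s (w k)) = 0"
        by (rule vector_derivative_unique_at)
      then show "C *v lin_flow A s (w (Suc k)) = 0"
        by (simp add: w_def lin_flow_matrix)
    qed
  qed (use zero in \<open>auto simp: w_def\<close>)
  have w: "C *v w k = 0" for k
  proof -
    \<comment> \<open>The derivatives are known to vanish on the open interval only; continuity
      extends this to the end point 0.\<close>
    have "C *v lin_flow A 0 (w k) = 0"
      by (rule continuous_constant_on_closure[of "{0<..<t}" "\<lambda>s. C *v lin_flow A s (w k)"])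
         (use w0 \<open>t > 0\<close> in \<open>auto intro!: continuous_on_matrix_vector_mult continuous_on_lin_flow continuous_on_id\<close>)
    then show ?thesis by simp
  qed
  have "(C *v lin_flow A s u) $ i = 0" for i
  proof -
    have "(C *v lin_flow A s u) $ i = (\<Sum>k. \<Sum>j\<in>UNIV. C $ i $ j * (w k $ j * s ^ k / fact k))"
      unfolding matrix_vector_mult_def[of C "lin_flow A s u"] w_def
      by (subst suminf_sum) (simp_all only: lin_flow_def vec_lambda_beta suminf_mult[OF summable_lin_flow] summable_mult[OF summable_lin_flow])
    also have "\<dots> = (\<Sum>k. (C *v w k) $ i * s ^ k / fact k)"
      by (simp add: matrix_vector_mult_def sum_distrib_left sum_divide_distrib mult_ac)
    finally show ?thesis by (simp add: w)
  qed
  then show ?thesis by (simp add: vec_eq_iff)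
qed

lemma inner_transpose: "(transpose A *v x) \<bullet> y = x \<bullet> (A *v y)" for A :: "real^'n^'m"
  by (simp add: dot_lmul_matrix flip: vector_transpose_matrix)

text \<open>Along a control steering \<open>0\<close> to \<open>u\<close>, the pairing of the trajectory with the adjoint solution
  stays constant, and it ends at \<open>u \<bullet> u\<close>.\<close>

lemma controllable_observable:
  assumes ctrl: "controllable A Bw" and "t > 0"
    and zero: "\<And>s. s \<in> {0..t} \<Longrightarrow> transpose Bw *v lin_flow (transpose A) s u = 0"
  shows "u = 0"
proof -
  have zero: "transpose Bw *v lin_flow (transpose A) s u = 0" for s
    by (rule lin_flow_eq_0_on_interval[OF \<open>t > 0\<close> zero])
  obtain T v z where "T > 0" and z: "z 0 = 0" "z T = u" 
     "\<forall>s\<in>{0..T}. (z has_vector_derivative (A *v z s + Bw *v v s)) (at s within {0..T})"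
    using ctrl unfolding controllable_def by meson
  define p where "p s = lin_flow (transpose A) (T - s) u" for s
  have "((\<lambda>s. p s \<bullet> z s) has_vector_derivative 0) (at s within {0..T})" if "s \<in> {0..T}" for s
  proof -
    have p': "(p has_vector_derivative (- 1) *\<^sub>R (transpose A *v p s)) (at s within {0..T})"
      unfolding p_def
      by (rule vector_diff_chain_within[of "\<lambda>s. T - s" "-1" _ _ "\<lambda>s. lin_flow (transpose A) s u", unfolded o_def])
         (auto intro!: derivative_eq_intros has_vector_derivative_lin_flow[THEN has_vector_derivative_eq_rhs])
    have "((\<lambda>s. p s \<bullet> z s) has_vector_derivative
        p s \<bullet> (A *v z s + Bw *v v s) + ((- 1) *\<^sub>R (transpose A *v p s)) \<bullet> z s) (at s within {0..T})"
      by (rule bounded_bilinear.has_vector_derivative[OF bounded_bilinear_inner p']) (use z that in auto)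
    moreover have "p s \<bullet> (Bw *v v s) = 0"
      using zero[of "T - s"] by (simp add: p_def flip: inner_transpose)
    ultimately show ?thesis by (simp add: inner_transpose inner_add_right)
  qed
  then obtain c where c: "\<And>s. s \<in> {0..T} \<Longrightarrow> p s \<bullet> z s = c"
    using has_vector_derivative_zero_constant[of "{0..T}" "\<lambda>s. p s \<bullet> z s"] by auto
  have "u \<bullet> u = c" using c[of T] \<open>T > 0\<close> z by (simp add: p_def)
  also have "c = 0" using c[of 0] \<open>T > 0\<close> z by simp
  finally show ?thesis by simp
qed

text \<open>The integral is the quadratic form of the Gramian. It is continuous on the compact unit
  sphere and so attains a minimum there; by observability the minimum is not 0, and homogeneity of
  degree 2 carries the bound over to all \<open>u\<close>.\<close>

lemma controllable_gramian_pos: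
  assumes ctrl: "controllable A Bw" and "t > 0"
  obtains \<theta> where "\<theta> > 0"
    "\<And>u. \<theta> * (norm u)\<^sup>2 \<le> integral {0..t} (\<lambda>s. (norm (transpose Bw *v lin_flow (transpose A) s u))\<^sup>2)"
proof -
  define Q where "Q u = integral {0..t} (\<lambda>s. (norm (transpose Bw *v lin_flow (transpose A) s u))\<^sup>2)" for u
  have cont: "continuous_on S (\<lambda>x. (norm (transpose Bw *v lin_flow (transpose A) (f x) (g x)))\<^sup>2)"
    if "continuous_on S f" "continuous_on S g" for S and f :: "'x::topological_space \<Rightarrow> real" and g
    by (intro continuous_on_power continuous_on_norm continuous_on_matrix_vector_mult continuous_on_lin_flow_joint that)
  have contQ: "continuous_on (sphere 0 1) Q"
    unfolding Q_def using integral_continuous_on_param[of "sphere 0 1" 0 t "\<lambda>u s. (norm (transpose Bw *v lin_flow (transpose A) s u))\<^sup>2"]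
    by (simp add: case_prod_beta cont[OF continuous_on_snd[OF continuous_on_id] continuous_on_fst[OF continuous_on_id]])
  have int: "(\<lambda>s. (norm (transpose Bw *v lin_flow (transpose A) s u))\<^sup>2) integrable_on {0..t}" for u
    by (rule integrable_continuous_real) (rule cont[OF continuous_on_id continuous_on_const])
  have "(SOME i. i \<in> Basis) \<in> sphere (0::real^'a) 1" by (simp add: SOME_Basis)
  then have "sphere (0::real^'a) 1 \<noteq> {}" by blast
  then obtain u0 where u0: "u0 \<in> sphere 0 1" "\<And>u. u \<in> sphere 0 1 \<Longrightarrow> Q u0 \<le> Q u"
    using continuous_attains_inf[OF compact_sphere _ contQ] by blast
  have "Q u0 > 0"
  proof (rule ccontr)
    assume "\<not> Q u0 > 0"
    moreover have "Q u0 \<ge> 0" unfolding Q_def by (intro integral_nonneg int) auto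
    ultimately have "Q u0 = 0" by simp
    then have "((\<lambda>s. (norm (transpose Bw *v lin_flow (transpose A) s u0))\<^sup>2) has_integral 0) (cbox 0 t)"
      using int[of u0] by (simp add: Q_def has_integral_integral)
    \<comment> \<open>A continuous nonnegative function with integral 0 vanishes at every point, not
      just almost everywhere.\<close>
    then have "(norm (transpose Bw *v lin_flow (transpose A) s u0))\<^sup>2 = 0" if "s \<in> {0..t}" for s
      using that \<open>t > 0\<close> by (intro has_integral_0_cbox_imp_0[of 0 t "\<lambda>s. (norm (transpose Bw *v lin_flow (transpose A) s u0))\<^sup>2"])
        (auto intro!: cont)
    then have "u0 = 0" by (intro controllable_observable[OF ctrl \<open>t > 0\<close>]) auto
    with u0(1) show False by simp
  qed
  moreover have "Q u0 * (norm u)\<^sup>2 \<le> Q u" for u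
  proof (cases "u = 0")
    case False
    have "Q u = (norm u)\<^sup>2 * Q (u /\<^sub>R norm u)"
    proof -
      have "(norm u)\<^sup>2 * (norm (transpose Bw *v lin_flow (transpose A) s (u /\<^sub>R norm u)))\<^sup>2
          = (norm (transpose Bw *v lin_flow (transpose A) s u))\<^sup>2" for s
      proof -
        have "transpose Bw *v lin_flow (transpose A) s (u /\<^sub>R norm u) = (transpose Bw *v lin_flow (transpose A) s u) /\<^sub>R norm u"
          by (simp only: linear_cmul[OF linear_lin_flow] matrix_vector_mult_scaleR)
        then show ?thesis using False by (simp add: power_mult_distrib power_inverse)
      qed
      then show ?thesis unfolding Q_def by (simp flip: integral_mult_right)
    qed
    moreover have "Q u0 \<le> Q (u /\<^sub>R norm u)" using False by (intro u0) simp
    ultimately show ?thesis by (simp add: mult.commute[of "Q u0"] mult_left_mono)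
  qed (simp add: Q_def linear_0[OF linear_lin_flow])
  ultimately show ?thesis using that[of "Q u0"] by (simp add: Q_def)
qed

section \<open>The law of the sampled state\<close>

lemma integral_sum_uniform_partition:
  fixes f :: "real \<Rightarrow> 'a::banach"
  assumes "h \<ge> 0" and "f integrable_on {0..real m * h}"
  shows "(\<Sum>j<m. integral {real j * h..real (Suc j) * h} f) = integral {0..real m * h} f"
  using assms(2)
proof (induction m)
  case (Suc m)
  have le: "0 \<le> real m * h" "real m * h \<le> real (Suc m) * h" using assms(1) by (auto simp: algebra_simps)
  have "f integrable_on {0..real m * h}"
    by (rule integrable_on_subinterval[OF Suc.prems]) (use le in auto)
  with Suc.IH have "(\<Sum>j<m. integral {real j * h..real (Suc j) * h} f) = integral {0..real m * h} f" by blast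
  then show ?case
    using Henstock_Kurzweil_Integration.integral_combine[OF le Suc.prems] by simp
qed simp

text \<open>The error terms of all Riemann sums below have the shape \<open>E (t\<^sub>j, s, t\<^sub>j\<^sub>+\<^sub>1)\<close>, where
  \<open>E\<close> is continuous and vanishes on the diagonal.\<close>

lemma partition_error_tendsto_0:
  fixes E :: "real \<times> real \<times> real \<Rightarrow> real"
  assumes t: "t > 0" and cont: "continuous_on ({0..t} \<times> {0..t} \<times> {0..t}) E"
    and diag: "\<And>s. s \<in> {0..t} \<Longrightarrow> E (s, s, s) = 0"
  shows "(\<lambda>m. \<Sum>j<Suc m. integral {real j * (t / Suc m)..real (Suc j) * (t / Suc m)}
            (\<lambda>s. E (real j * (t / Suc m), s, real (Suc j) * (t / Suc m)))) \<longlonglongrightarrow> 0"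
proof (rule LIMSEQ_I)
  fix r :: real assume "r > 0"
  \<comment> \<open>The interval lengths add up to \<open>t\<close>, so a pointwise error of at most
    \<open>e\<close> leaves at most r / 2 in total.\<close>
  define e where "e = r / (2 * t)"
  have e: "e > 0" using \<open>r > 0\<close> t by (simp add: e_def)
  have "uniformly_continuous_on ({0..t} \<times> {0..t} \<times> {0..t}) E"
    by (intro compact_uniformly_continuous cont compact_Times) auto
  then obtain d where d: "d > 0"
    "\<And>p q. p \<in> {0..t} \<times> {0..t} \<times> {0..t} \<Longrightarrow> q \<in> {0..t} \<times> {0..t} \<times> {0..t} \<Longrightarrow> dist q p < d \<Longrightarrow> dist (E q) (E p) < e"
    using e unfolding uniformly_continuous_on_def by meson
  obtain M :: nat where M: "2 * t / d < real M" using reals_Archimedean2 by blast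
  show "\<exists>no. \<forall>m\<ge>no. norm ((\<Sum>j<Suc m. integral {real j * (t / Suc m)..real (Suc j) * (t / Suc m)}
            (\<lambda>s. E (real j * (t / Suc m), s, real (Suc j) * (t / Suc m)))) - 0) < r"
  proof (intro exI allI impI)
    fix m assume "m \<ge> M"
    define h where "h = t / real (Suc m)"
    have h: "h > 0" using t by (simp add: h_def)
    have hd: "2 * h < d"
    proof -
      have "2 * t / d < real (Suc m)" using M \<open>m \<ge> M\<close> by linarith
      then show ?thesis using d(1) by (simp add: h_def field_simps)
    qed
    have mh: "real (Suc m) * h = t" by (simp add: h_def)
    have bound: "norm (integral {real j * h..real (Suc j) * h} (\<lambda>s. E (real j * h, s, real (Suc j) * h))) \<le> e * h"
      if j: "j < Suc m" for j
    proof -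
      have range: "0 \<le> real j * h" "real j * h \<le> real (Suc j) * h" "real (Suc j) * h \<le> t"
        using h j mh mult_right_mono[of "real (Suc j)" "real (Suc m)" h] by (auto simp: algebra_simps)
      have "norm (integral {real j * h..real (Suc j) * h} (\<lambda>s. E (real j * h, s, real (Suc j) * h)))
          \<le> e * (real (Suc j) * h - real j * h)"
      proof (rule integral_bound)
        have "continuous_on {real j * h..real (Suc j) * h} (E \<circ> (\<lambda>s. (real j * h, s, real (Suc j) * h)))"
          by (intro continuous_on_compose continuous_on_subset[OF cont] continuous_on_Pair continuous_on_const continuous_on_id)
             (use range in auto)
        then show "continuous_on {real j * h..real (Suc j) * h} (\<lambda>s. E (real j * h, s, real (Suc j) * h))"
          by (simp add: o_def)
        fix s assume s: "s \<in> {real j * h..real (Suc j) * h}"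
        have "dist (real j * h, s, real (Suc j) * h) (s, s, s) \<le> \<bar>real j * h - s\<bar> + \<bar>real (Suc j) * h - s\<bar>"
          using sqrt_sum_squares_le_sum_abs[of "real j * h - s" "real (Suc j) * h - s"]
          by (simp add: dist_Pair_Pair dist_real_def)
        also have "\<dots> < d" using s hd h by (simp add: algebra_simps)
        finally have "dist (E (real j * h, s, real (Suc j) * h)) (E (s, s, s)) < e"
          using s range by (intro d(2)) auto
        then show "norm (E (real j * h, s, real (Suc j) * h)) \<le> e"
          using diag[of s] s range by (simp add: dist_real_def)
      qed (use range in auto)
      then show ?thesis by (simp add: algebra_simps)
    qed
    have "norm (\<Sum>j<Suc m. integral {real j * h..real (Suc j) * h} (\<lambda>s. E (real j * h, s, real (Suc j) * h)))
        \<le> (\<Sum>j<Suc m. e * h)"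
      by (rule sum_norm_le) (use bound in auto)
    also have "\<dots> = e * (real (Suc m) * h)" by simp
    also have "\<dots> < r" using \<open>r > 0\<close> t by (simp only: mh) (simp add: e_def)
    finally show "norm ((\<Sum>j<Suc m. integral {real j * (t / Suc m)..real (Suc j) * (t / Suc m)}
            (\<lambda>s. E (real j * (t / Suc m), s, real (Suc j) * (t / Suc m)))) - 0) < r"
      by (simp only: h_def diff_0_right)
  qed
qed

lemma riemann_sum_tendsto:
  fixes g :: "real \<Rightarrow> real"
  assumes t: "t > 0" and cont: "continuous_on {0..t} g"
  shows "(\<lambda>m. \<Sum>j<Suc m. t / Suc m * g (real j * (t / Suc m))) \<longlonglongrightarrow> integral {0..t} g"
proof -
  let ?E = "\<lambda>(a, s, b :: real). g a - g s"
  have "(\<lambda>m. \<Sum>j<Suc m. integral {real j * (t / Suc m)..real (Suc j) * (t / Suc m)}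
            (\<lambda>s. ?E (real j * (t / Suc m), s, real (Suc j) * (t / Suc m)))) \<longlonglongrightarrow> 0"
    by (rule partition_error_tendsto_0[OF t])
       (auto simp: case_prod_beta intro!: continuous_on_diff continuous_on_compose2[OF cont] continuous_intros)
  moreover have "(\<Sum>j<Suc m. integral {real j * (t / Suc m)..real (Suc j) * (t / Suc m)}
            (\<lambda>s. ?E (real j * (t / Suc m), s, real (Suc j) * (t / Suc m))))
      = (\<Sum>j<Suc m. t / Suc m * g (real j * (t / Suc m))) - integral {0..t} g" for m
  proof -
    define h where "h = t / real (Suc m)"
    have h: "h > 0" using t by (simp add: h_def)
    have mh: "real (Suc m) * h = t" by (simp add: h_def)
    have int: "g integrable_on {0..real (Suc m) * h}"
      unfolding mh by (rule integrable_continuous_real[OF cont])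
    have "integral {real j * h..real (Suc j) * h} (\<lambda>s. g (real j * h) - g s)
        = h * g (real j * h) - integral {real j * h..real (Suc j) * h} g" if j: "j < Suc m" for j
    proof -
      have "{real j * h..real (Suc j) * h} \<subseteq> {0..real (Suc m) * h}"
        using h j mult_right_mono[of "real (Suc j)" "real (Suc m)" h] by auto
      then have "g integrable_on {real j * h..real (Suc j) * h}"
        by (rule integrable_on_subinterval[OF int])
      then show ?thesis
        using h by (subst integral_diff) (auto simp: algebra_simps)
    qed
    then have "(\<Sum>j<Suc m. integral {real j * h..real (Suc j) * h} (\<lambda>s. g (real j * h) - g s))
        = (\<Sum>j<Suc m. h * g (real j * h) - integral {real j * h..real (Suc j) * h} g)"
      by (intro sum.cong) auto
    then have "(\<Sum>j<Suc m. integral {real j * h..real (Suc j) * h} (\<lambda>s. g (real j * h) - g s))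
        = (\<Sum>j<Suc m. h * g (real j * h)) - integral {0..real (Suc m) * h} g"
      using integral_sum_uniform_partition[OF less_imp_le[OF h] int] by (simp only: sum_subtractf)
    then show ?thesis by (simp only: h_def case_prod_conv mh[unfolded h_def])
  qed
  ultimately have "(\<lambda>m. (\<Sum>j<Suc m. t / Suc m * g (real j * (t / Suc m))) - integral {0..t} g) \<longlonglongrightarrow> 0"
    by simp
  then show ?thesis by (rule LIM_zero_cancel)
qed

text \<open>Pairing the path with the solution of the adjoint equation removes the drift: summation by
  parts leaves the Riemann--Stieltjes sums of the driving path.\<close>

lemma variation_of_constants_limit:
  fixes A :: "real^'n^'n" and Bw :: "real^'d^'n" and z :: "real \<Rightarrow> real^'n" and w :: "real \<Rightarrow> real^'d"
    and u :: "real^'n"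
  assumes t: "t > 0" and cont: "continuous_on {0..} z"
    and z: "\<And>s. s \<ge> 0 \<Longrightarrow> z s = x + integral {0..s} (\<lambda>r. A *v z r + c) + Bw *v (w s - w 0)"
  defines "v \<equiv> \<lambda>s. lin_flow (transpose A) (t - s) u"
  shows "(\<lambda>m. \<Sum>j<Suc m. (transpose Bw *v v (real j * (t / Suc m))) \<bullet>
              (w (real (Suc j) * (t / Suc m)) - w (real j * (t / Suc m))))
         \<longlonglongrightarrow> u \<bullet> z t - v 0 \<bullet> x - integral {0..t} (\<lambda>s. v s \<bullet> c)"
proof -
  have cz: "continuous_on {0..t} z" by (rule continuous_on_subset[OF cont]) auto
  have cv: "continuous_on S v" for S
    unfolding v_def by (intro continuous_on_lin_flow continuous_intros)
  have v': "(v has_vector_derivative - (transpose A *v v s)) (at s within S)" for s S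
  proof -
    have "(v has_vector_derivative (- 1) *\<^sub>R (transpose A *v v s)) (at s within S)"
      unfolding v_def
      by (rule vector_diff_chain_within[of "\<lambda>s. t - s" "-1" _ _ "\<lambda>s. lin_flow (transpose A) s u", unfolded o_def])
         (auto intro!: derivative_eq_intros has_vector_derivative_lin_flow[THEN has_vector_derivative_eq_rhs])
    then show ?thesis by simp
  qed
  \<comment> \<open>Summation by parts writes the increment of v \<bullet> z as v(a) paired with the
    increment of \<open>z\<close>, plus the increment of \<open>v\<close> paired with z(b). The
    drift of \<open>z\<close> and the derivative of \<open>v\<close> yield the first two terms; the
    third subtracts the input integral, so that everything cancels on the diagonal.\<close>
  let ?E = "\<lambda>(a, s, b). v a \<bullet> (A *v z s + c) - v s \<bullet> (A *v z b) - v s \<bullet> c"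
  let ?L = "u \<bullet> z t - v 0 \<bullet> x - integral {0..t} (\<lambda>s. v s \<bullet> c)"
  have "(\<lambda>m. \<Sum>j<Suc m. integral {real j * (t / Suc m)..real (Suc j) * (t / Suc m)}
            (\<lambda>s. ?E (real j * (t / Suc m), s, real (Suc j) * (t / Suc m)))) \<longlonglongrightarrow> 0"
  proof (rule partition_error_tendsto_0[OF t])
    have 1: "continuous_on ({0..t} \<times> {0..t} \<times> {0..t}) (\<lambda>p. z (fst (snd p)))"
            "continuous_on ({0..t} \<times> {0..t} \<times> {0..t}) (\<lambda>p. z (snd (snd p)))"
      by (rule continuous_on_compose2[OF cz]; force intro!: continuous_intros)+
    have 2: "continuous_on ({0..t} \<times> {0..t} \<times> {0..t}) (\<lambda>p. v (fst (snd p)))"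
            "continuous_on ({0..t} \<times> {0..t} \<times> {0..t}) (\<lambda>p. v (fst p))"
      by (rule continuous_on_compose2[OF cv[of UNIV]]; force intro!: continuous_intros)+
    show "continuous_on ({0..t} \<times> {0..t} \<times> {0..t}) ?E"
      unfolding case_prod_beta
      by (intro continuous_on_diff continuous_on_inner continuous_on_add continuous_on_const continuous_on_matrix_vector_mult 1 2)
  qed (simp add: inner_add_right)
  moreover have "(\<Sum>j<Suc m. integral {real j * (t / Suc m)..real (Suc j) * (t / Suc m)}
            (\<lambda>s. ?E (real j * (t / Suc m), s, real (Suc j) * (t / Suc m))))
      = ?L - (\<Sum>j<Suc m. (transpose Bw *v v (real j * (t / Suc m))) \<bullet>
              (w (real (Suc j) * (t / Suc m)) - w (real j * (t / Suc m))))" for m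
  proof -
    define h where "h = t / real (Suc m)"
    define \<tau> where "\<tau> j = real j * h" for j
    have h: "h > 0" using t by (simp add: h_def)
    have mh: "\<tau> (Suc m) = t" by (simp add: h_def \<tau>_def)
    have \<tau>0: "\<tau> 0 = 0" by (simp add: \<tau>_def)
    have cvc: "continuous_on S (\<lambda>s. v s \<bullet> c)" for S by (intro continuous_intros cv)
    have int: "(\<lambda>s. v s \<bullet> c) integrable_on {0..real (Suc m) * h}"
      by (rule integrable_continuous_real[OF cvc])
    have step: "integral {\<tau> j..\<tau> (Suc j)} (\<lambda>s. ?E (\<tau> j, s, \<tau> (Suc j)))
        = (v (\<tau> (Suc j)) \<bullet> z (\<tau> (Suc j)) - v (\<tau> j) \<bullet> z (\<tau> j)) - integral {\<tau> j..\<tau> (Suc j)} (\<lambda>s. v s \<bullet> c)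
          - (transpose Bw *v v (\<tau> j)) \<bullet> (w (\<tau> (Suc j)) - w (\<tau> j))" if j: "j < Suc m" for j
    proof -
      let ?I = "{\<tau> j..\<tau> (Suc j)}"
      have le: "0 \<le> \<tau> j" "\<tau> j \<le> \<tau> (Suc j)" using h by (auto simp: \<tau>_def algebra_simps)
      have czI: "continuous_on S (\<lambda>r. A *v z r + c)" if "S \<subseteq> {0..}" for S
        by (intro continuous_on_add continuous_on_matrix_vector_mult continuous_on_subset[OF cont that] continuous_on_const)
      have intz: "(\<lambda>r. A *v z r + c) integrable_on ?I"
        by (rule integrable_continuous_real) (rule czI, use le in auto)
      have intz': "(\<lambda>r. A *v z r + c) integrable_on {0..\<tau> (Suc j)}"
        by (rule integrable_continuous_real) (rule czI, use le in auto)
      have zdiff: "z (\<tau> (Suc j)) - z (\<tau> j) = integral ?I (\<lambda>r. A *v z r + c) + Bw *v (w (\<tau> (Suc j)) - w (\<tau> j))"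
        unfolding z[OF le(1)] z[OF order_trans[OF le]] Henstock_Kurzweil_Integration.integral_combine[OF le intz', symmetric]
        by (simp add: matrix_vector_mult_diff_distrib)
      have hv: "((\<lambda>s. - (transpose A *v v s)) has_integral v (\<tau> (Suc j)) - v (\<tau> j)) ?I"
        by (rule fundamental_theorem_of_calculus[OF le(2)]) (rule v')
      have "((\<lambda>s. (- (transpose A *v v s)) \<bullet> z (\<tau> (Suc j))) has_integral (v (\<tau> (Suc j)) - v (\<tau> j)) \<bullet> z (\<tau> (Suc j))) ?I"
        by (rule has_integral_linear[OF hv bounded_linear_inner_left, unfolded o_def])
      then have 1: "((\<lambda>s. - (v s \<bullet> (A *v z (\<tau> (Suc j))))) has_integral (v (\<tau> (Suc j)) - v (\<tau> j)) \<bullet> z (\<tau> (Suc j))) ?I"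
        by (simp add: inner_transpose)
      have 2: "((\<lambda>s. v (\<tau> j) \<bullet> (A *v z s + c)) has_integral v (\<tau> j) \<bullet> integral ?I (\<lambda>r. A *v z r + c)) ?I"
        by (rule has_integral_linear[OF integrable_integral[OF intz] bounded_linear_inner_right, unfolded o_def])
      have 3: "((\<lambda>s. v s \<bullet> c) has_integral integral ?I (\<lambda>s. v s \<bullet> c)) ?I"
        by (rule integrable_integral) (rule integrable_continuous_real[OF cvc])
      have "((\<lambda>s. v (\<tau> j) \<bullet> (A *v z s + c) + - (v s \<bullet> (A *v z (\<tau> (Suc j)))) - v s \<bullet> c) has_integral
          v (\<tau> j) \<bullet> integral ?I (\<lambda>r. A *v z r + c) + (v (\<tau> (Suc j)) - v (\<tau> j)) \<bullet> z (\<tau> (Suc j)) - integral ?I (\<lambda>s. v s \<bullet> c)) ?I"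
        by (intro has_integral_diff has_integral_add 1 2 3)
      then have "integral ?I (\<lambda>s. ?E (\<tau> j, s, \<tau> (Suc j))) =
          v (\<tau> j) \<bullet> integral ?I (\<lambda>r. A *v z r + c) + (v (\<tau> (Suc j)) - v (\<tau> j)) \<bullet> z (\<tau> (Suc j)) - integral ?I (\<lambda>s. v s \<bullet> c)"
        by (simp add: integral_unique)
      also have "integral ?I (\<lambda>r. A *v z r + c) = z (\<tau> (Suc j)) - z (\<tau> j) - Bw *v (w (\<tau> (Suc j)) - w (\<tau> j))"
        using zdiff by simp
      finally show ?thesis
        by (simp add: inner_diff_left inner_diff_right inner_transpose matrix_vector_mult_diff_distrib)
    qed
    have z0: "z 0 = x" using z[of 0] by simp
    have "(\<Sum>j<Suc m. integral {\<tau> j..\<tau> (Suc j)} (\<lambda>s. ?E (\<tau> j, s, \<tau> (Suc j))))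
       = (\<Sum>j<Suc m. (v (\<tau> (Suc j)) \<bullet> z (\<tau> (Suc j)) - v (\<tau> j) \<bullet> z (\<tau> j)) - integral {\<tau> j..\<tau> (Suc j)} (\<lambda>s. v s \<bullet> c)
          - (transpose Bw *v v (\<tau> j)) \<bullet> (w (\<tau> (Suc j)) - w (\<tau> j)))"
      by (rule sum.cong[OF refl]) (rule step, simp)
    also have "\<dots> = (v t \<bullet> z t - v 0 \<bullet> z 0) - integral {0..t} (\<lambda>s. v s \<bullet> c)
         - (\<Sum>j<Suc m. (transpose Bw *v v (\<tau> j)) \<bullet> (w (\<tau> (Suc j)) - w (\<tau> j)))"
    proof -
      have "(\<Sum>j<Suc m. v (\<tau> (Suc j)) \<bullet> z (\<tau> (Suc j)) - v (\<tau> j) \<bullet> z (\<tau> j)) = v t \<bullet> z t - v 0 \<bullet> z 0"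
        using sum_lessThan_telescope[of "\<lambda>j. v (\<tau> j) \<bullet> z (\<tau> j)" "Suc m"] by (simp only: mh \<tau>0)
      moreover have "(\<Sum>j<Suc m. integral {\<tau> j..\<tau> (Suc j)} (\<lambda>s. v s \<bullet> c)) = integral {0..t} (\<lambda>s. v s \<bullet> c)"
        using integral_sum_uniform_partition[OF less_imp_le[OF h] int] mh by (simp only: \<tau>_def)
      moreover have "(\<Sum>j<k. a j - b j - d j) = (\<Sum>j<k. a j) - (\<Sum>j<k. b j) - (\<Sum>j<k. d j)" for a b d :: "nat \<Rightarrow> real" and k
        by (simp add: sum_subtractf)
      ultimately show ?thesis by (simp only:)
    qed
    also have "v t = u" by (simp add: v_def)
    finally show ?thesis by (simp only: \<tau>_def h_def z0)
  qed
  ultimately have "(\<lambda>m. ?L - (\<Sum>j<Suc m. (transpose Bw *v v (real j * (t / Suc m))) \<bullet>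
              (w (real (Suc j) * (t / Suc m)) - w (real j * (t / Suc m))))) \<longlonglongrightarrow> 0"
    by simp
  from tendsto_diff[OF tendsto_const[of ?L] this] show ?thesis
    by simp
qed

lemma (in prob_space) char_normal_scaled:
  assumes D: "distributed M lborel Y (normal_density 0 \<sigma>)" and "\<sigma> > 0"
  shows "char (distr M borel (\<lambda>\<omega>. a * Y \<omega>)) 1 = exp (- (a\<^sup>2 * \<sigma>\<^sup>2) / 2)"
proof -
  have Y: "Y \<in> borel_measurable M"
    using D by (auto simp: distributed_def)
  have N: "distributed M lborel (\<lambda>\<omega>. Y \<omega> / \<sigma>) std_normal_density"
    using D normal_standard_normal_convert[OF \<open>\<sigma> > 0\<close>, of Y 0] by simp
  then have "distr M borel (\<lambda>\<omega>. Y \<omega> / \<sigma>) = std_normal_distribution"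
    using distributed_distr_eq_density[OF N] by (metis distr_cong sets_lborel)
  moreover have "char (distr M borel (\<lambda>\<omega>. a * Y \<omega>)) 1 = char (distr M borel (\<lambda>\<omega>. Y \<omega> / \<sigma>)) (a * \<sigma>)"
    using Y \<open>\<sigma> > 0\<close> by (simp add: char_def integral_distr)
  ultimately show ?thesis
    by (simp add: char_std_normal_distribution power_mult_distrib)
qed

text \<open>The coordinates of an increment are independent normal variables of variance t - s, so
  the characteristic function factorises. Evaluation at 1 suffices, as \<open>f\<close> carries the
  frequency.\<close>

lemma wiener_increment_char:
  fixes W :: "real \<Rightarrow> 'w \<Rightarrow> real^'d" and f :: "real^'d"
  assumes "wiener_process M W" and st: "0 \<le> s" "s < t"
  shows "char (distr M borel (\<lambda>\<omega>. f \<bullet> (W t \<omega> - W s \<omega>))) 1 = exp (- ((t - s) * (norm f)\<^sup>2) / 2)"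
proof -
  interpret prob_space M using assms(1) by (simp add: wiener_process_def)
  have ind: "indep_vars (\<lambda>_. borel) (\<lambda>j \<omega>. (W t \<omega> - W s \<omega>) $ j) UNIV"
    and nrm: "distributed M lborel (\<lambda>\<omega>. (W t \<omega> - W s \<omega>) $ j) (normal_density 0 (sqrt (t - s)))" for j
    using assms unfolding wiener_process_def by blast+
  have ind': "indep_vars (\<lambda>_. borel) (\<lambda>j \<omega>. f $ j * (W t \<omega> - W s \<omega>) $ j) UNIV"
    by (rule indep_vars_compose2[OF ind]) simp
  have "char (distr M borel (\<lambda>\<omega>. f \<bullet> (W t \<omega> - W s \<omega>))) 1
      = (\<Prod>j\<in>UNIV. char (distr M borel (\<lambda>\<omega>. f $ j * (W t \<omega> - W s \<omega>) $ j)) 1)"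
    unfolding inner_vec_def inner_real_def by (rule char_distr_sum[OF ind'])
  also have "\<dots> = (\<Prod>j\<in>UNIV. complex_of_real (exp (- ((f $ j)\<^sup>2 * (sqrt (t - s))\<^sup>2) / 2)))"
    using st by (intro prod.cong refl char_normal_scaled nrm) simp
  also have "\<dots> = exp (- ((t - s) * (norm f)\<^sup>2) / 2)"
    using st by (simp add: norm_vec_def L2_set_def sum_nonneg sum_distrib_left sum_divide_distrib sum_negf mult.commute
        flip: exp_sum of_real_prod)
  finally show ?thesis .
qed

text \<open>Independent increments turn the expectation into a product whose exponents form a
  Riemann sum of squared norms: the Ito isometry for step functions at the level of characteristic
  functions.\<close>

lemma wiener_sum_char:
  fixes W :: "real \<Rightarrow> 'w \<Rightarrow> real^'d" and f :: "nat \<Rightarrow> real^'d"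
  assumes W: "wiener_process M W" and h: "h > 0"
  shows "(CLINT \<omega>|M. iexp (\<Sum>j<m. f j \<bullet> (W (real (Suc j) * h) \<omega> - W (real j * h) \<omega>)))
           = exp (- (\<Sum>j<m. h * (norm (f j))\<^sup>2) / 2)"
proof -
  interpret prob_space M using W by (simp add: wiener_process_def)
  have "strict_mono (\<lambda>j. real j * h)" using h by (auto simp: strict_mono_def)
  then have ind: "indep_vars (\<lambda>_. borel) (\<lambda>j \<omega>. W (real (Suc j) * h) \<omega> - W (real j * h) \<omega>) {..<m}"
    using W[unfolded wiener_process_def, THEN conjunct2, THEN conjunct2, THEN conjunct2, THEN conjunct2, THEN conjunct1,
        THEN spec[of _ "\<lambda>j. real j * h"]] by simp
  have ind': "indep_vars (\<lambda>_. borel) (\<lambda>j \<omega>. f j \<bullet> (W (real (Suc j) * h) \<omega> - W (real j * h) \<omega>)) {..<m}"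
    by (rule indep_vars_compose2[OF ind]) simp
  have meas: "(\<lambda>\<omega>. \<Sum>j<m. f j \<bullet> (W (real (Suc j) * h) \<omega> - W (real j * h) \<omega>)) \<in> borel_measurable M"
    by (rule borel_measurable_sum) (use ind' in \<open>auto simp: indep_vars_def\<close>)
  have "(CLINT \<omega>|M. iexp (\<Sum>j<m. f j \<bullet> (W (real (Suc j) * h) \<omega> - W (real j * h) \<omega>)))
     = char (distr M borel (\<lambda>\<omega>. \<Sum>j<m. f j \<bullet> (W (real (Suc j) * h) \<omega> - W (real j * h) \<omega>))) 1"
    unfolding char_def by (subst integral_distr[OF meas]) auto
  also have "\<dots> = (\<Prod>j<m. char (distr M borel (\<lambda>\<omega>. f j \<bullet> (W (real (Suc j) * h) \<omega> - W (real j * h) \<omega>))) 1)"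
    by (rule char_distr_sum[OF ind'])
  also have "\<dots> = (\<Prod>j<m. complex_of_real (exp (- ((real (Suc j) * h - real j * h) * (norm (f j))\<^sup>2) / 2)))"
    using h by (intro prod.cong refl wiener_increment_char[OF W]) auto
  also have "\<dots> = (\<Prod>j<m. complex_of_real (exp (- (h * (norm (f j))\<^sup>2) / 2)))"
    by (simp add: algebra_simps)
  also have "\<dots> = exp (- (\<Sum>j<m. h * (norm (f j))\<^sup>2) / 2)"
    by (simp add: sum_divide_distrib sum_negf flip: exp_sum of_real_prod)
  finally show ?thesis .
qed

lemma integral_time_reversal:
  fixes f :: "real \<Rightarrow> 'a::banach"
  assumes "f integrable_on {0..t}" "t \<ge> 0"
  shows "integral {0..t} (\<lambda>s. f (t - s)) = integral {0..t} f"
proof -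
  have "(\<lambda>x. t - x) ` {0..t} = {0..t}"
    using image_diff_atLeastAtMost[of t 0 t] assms(2) by simp
  then show ?thesis
    using has_integral_affinity[of f "integral {0..t} f" 0 t "-1" t] assms
    by (intro integral_unique) (simp add: has_integral_integral)
qed

text \<open>Up to the deterministic shift \<open>a\<close>, the pairing of \<open>u\<close> with the
  state is an almost sure limit of the sums \<open>S m\<close>, whose characteristic functions are
  known. All integrands have modulus 1, so the expectations converge. Taking the modulus discards
  the shift, which contributes a factor of modulus 1.\<close>

lemma solves_sde_char:
  fixes A :: "real^'n^'n" and Bw :: "real^'d^'n"
  assumes W: "wiener_process M W" and sol: "solves_sde M W A B K Bw \<zeta>" and t: "t > 0"
  shows "cmod (CLINT \<omega>|M. iexp (u \<bullet> \<zeta> t x \<omega>))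
     = exp (- integral {0..t} (\<lambda>s. (norm (transpose Bw *v lin_flow (transpose A) s u))\<^sup>2) / 2)"
proof -
  interpret prob_space M using W by (simp add: wiener_process_def)
  define c where "c = B *v (K *v x)"
  define v where "v s = lin_flow (transpose A) (t - s) u" for s
  define f where "f s = transpose Bw *v v s" for s
  define a where "a = v 0 \<bullet> x + integral {0..t} (\<lambda>s. v s \<bullet> c)"
  define S where "S m \<omega> = (\<Sum>j<Suc m. f (real j * (t / Suc m)) \<bullet>
              (W (real (Suc j) * (t / Suc m)) \<omega> - W (real j * (t / Suc m)) \<omega>))" for m \<omega>
  have W_meas: "W s \<in> borel_measurable M" if "s \<ge> 0" for s
    using W that by (simp add: wiener_process_def)
  have S_meas[measurable]: "S m \<in> borel_measurable M" for m
    unfolding S_def using t by (intro borel_measurable_sum borel_measurable_inner borel_measurable_diff borel_measurable_const W_meas) auto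
  have [measurable]: "\<zeta> t x \<in> borel_measurable M"
    using sol t by (simp add: solves_sde_def)
  have lim: "AE \<omega> in M. (\<lambda>m. S m \<omega>) \<longlonglongrightarrow> u \<bullet> \<zeta> t x \<omega> - a"
  proof -
    have "AE \<omega> in M. continuous_on {0..} (\<lambda>t. \<zeta> t x \<omega>) \<and>
        (\<forall>t\<ge>0. \<zeta> t x \<omega> = x + integral {0..t} (\<lambda>r. A *v \<zeta> r x \<omega> + c) + Bw *v (W t \<omega> - W 0 \<omega>))"
      using sol by (simp add: solves_sde_def c_def)
    then show ?thesis
    proof eventually_elim
      case (elim \<omega>)
      show ?case
        using variation_of_constants_limit[OF t, of "\<lambda>t. \<zeta> t x \<omega>" x A c Bw "\<lambda>t. W t \<omega>" u] elim
        unfolding S_def f_def v_def a_def by (simp add: diff_diff_eq)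
    qed
  qed
  have "(\<lambda>m. CLINT \<omega>|M. iexp (S m \<omega>)) \<longlonglongrightarrow> (CLINT \<omega>|M. iexp (u \<bullet> \<zeta> t x \<omega> - a))"
  proof (rule integral_dominated_convergence[where w = "\<lambda>_. 1"])
    show "AE \<omega> in M. (\<lambda>m. iexp (S m \<omega>)) \<longlonglongrightarrow> iexp (u \<bullet> \<zeta> t x \<omega> - a)"
      using lim by eventually_elim (intro tendsto_intros)
  qed auto
  then have "(\<lambda>m. cmod (CLINT \<omega>|M. iexp (S m \<omega>))) \<longlonglongrightarrow> cmod (CLINT \<omega>|M. iexp (u \<bullet> \<zeta> t x \<omega> - a))"
    by (rule tendsto_norm)
  moreover have "cmod (CLINT \<omega>|M. iexp (u \<bullet> \<zeta> t x \<omega> - a)) = cmod (CLINT \<omega>|M. iexp (u \<bullet> \<zeta> t x \<omega>))"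
  proof -
    have "iexp (u \<bullet> \<zeta> t x \<omega> - a) = iexp (u \<bullet> \<zeta> t x \<omega>) * iexp (- a)" for \<omega>
      by (simp add: algebra_simps flip: exp_add)
    then show ?thesis by (simp add: norm_mult)
  qed
  moreover have "cmod (CLINT \<omega>|M. iexp (S m \<omega>)) = exp (- (\<Sum>j<Suc m. t / Suc m * (norm (f (real j * (t / Suc m))))\<^sup>2) / 2)" for m
    unfolding S_def using t by (subst wiener_sum_char[OF W]) (auto simp del: of_real_exp of_nat_Suc sum.lessThan_Suc)
  moreover have "(\<lambda>m. exp (- (\<Sum>j<Suc m. t / Suc m * (norm (f (real j * (t / Suc m))))\<^sup>2) / 2))
      \<longlonglongrightarrow> exp (- integral {0..t} (\<lambda>s. (norm (f s))\<^sup>2) / 2)"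
    by (intro tendsto_intros riemann_sum_tendsto[OF t]) 
       (auto simp: f_def v_def intro!: continuous_on_power continuous_on_norm continuous_on_matrix_vector_mult continuous_on_lin_flow
         continuous_on_diff continuous_on_const continuous_on_id)
  ultimately have "cmod (CLINT \<omega>|M. iexp (u \<bullet> \<zeta> t x \<omega>)) = exp (- integral {0..t} (\<lambda>s. (norm (f s))\<^sup>2) / 2)"
    by (simp only: LIMSEQ_unique)
  \<comment> \<open>The adjoint solution runs backwards from time \<open>t\<close>; reversing time
    gives the Gramian in its usual form.\<close>
  also have "integral {0..t} (\<lambda>s. (norm (f s))\<^sup>2) = integral {0..t} (\<lambda>s. (norm (transpose Bw *v lin_flow (transpose A) s u))\<^sup>2)"
    unfolding f_def v_def
    by (rule integral_time_reversal[of "\<lambda>s. (norm (transpose Bw *v lin_flow (transpose A) s u))\<^sup>2"])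
       (use t in \<open>auto intro!: integrable_continuous_real continuous_on_power continuous_on_norm continuous_on_matrix_vector_mult
         continuous_on_lin_flow continuous_on_id\<close>)
  finally show ?thesis .
qed

lemma solves_sde_null_set:
  fixes A :: "real^'n^'n" and Bw :: "real^'d^'n"
  assumes ctrl: "controllable A Bw" and W: "wiener_process M W" and sol: "solves_sde M W A B K Bw \<zeta>" and t: "t > 0"
    and N: "N \<in> null_sets lborel" "bounded N"
  shows "measure M {\<omega>\<in>space M. \<zeta> t x \<omega> \<in> N} = 0"
proof -
  interpret prob_space M using W by (simp add: wiener_process_def)
  obtain \<theta> where \<theta>: "\<theta> > 0"
    "\<And>u. \<theta> * (norm u)\<^sup>2 \<le> integral {0..t} (\<lambda>s. (norm (transpose Bw *v lin_flow (transpose A) s u))\<^sup>2)"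
    using controllable_gramian_pos[OF ctrl t] by blast
  show ?thesis
  proof (rule prob_null_set_eq_0[OF _ _ \<theta>(1) N])
    show "\<zeta> t x \<in> borel_measurable M" using sol t by (simp add: solves_sde_def)
    show "cmod (CLINT \<omega>|M. iexp (u \<bullet> \<zeta> t x \<omega>)) \<le> exp (- (\<theta> * (norm u)\<^sup>2 / 2))" for u
      unfolding solves_sde_char[OF W sol t] using \<theta>(2)[of u] by simp
  qed
qed

lemma solves_sde_initial:
  assumes "solves_sde M W A B K Bw \<zeta>"
  shows "AE \<omega> in M. \<zeta> 0 x \<omega> = x"
proof -
  have "AE \<omega> in M. (\<forall>t\<ge>0. \<zeta> t x \<omega> =
           x + integral {0..t} (\<lambda>r. A *v \<zeta> r x \<omega> + B *v (K *v x)) + Bw *v (W t \<omega> - W 0 \<omega>))"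
    using assms by (auto simp: solves_sde_def)
  then show ?thesis by eventually_elim (auto dest: spec[of _ 0])
qed

text \<open>The noise-free solution at time \<open>t\<close> with held input, exp (t A) x plus the
  integral of exp ((t - s) A) B K x. The exponential is moved onto the basis vectors through the
  transpose, which is the form that pairing with adjoint solutions delivers.\<close>

definition drift_shift :: "real^'n^'n \<Rightarrow> real^'p^'n \<Rightarrow> real^'n^'p \<Rightarrow> real \<Rightarrow> real^'n \<Rightarrow> real^'n" where
  "drift_shift A B K t x = (\<chi> i. lin_flow (transpose A) t (axis i 1) \<bullet> x
      + integral {0..t} (\<lambda>s. lin_flow (transpose A) (t - s) (axis i 1)) \<bullet> (B *v (K *v x)))"

lemma continuous_on_drift_shift: "continuous_on S (drift_shift A B K t)"
  unfolding drift_shift_def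
  by (intro continuous_on_vec_lambda continuous_on_add continuous_on_inner continuous_on_const continuous_on_id
       continuous_on_matrix_vector_mult)

text \<open>The noise enters additively, so solutions from different initial states differ by a
  deterministic term. This is what makes the transition kernel measurable in the state.\<close>

lemma solves_sde_shift:
  fixes A :: "real^'n^'n" and Bw :: "real^'d^'n"
  assumes sol: "solves_sde M W A B K Bw \<zeta>" and t: "t \<ge> 0"
  shows "AE \<omega> in M. \<zeta> t x \<omega> = \<zeta> t 0 \<omega> + drift_shift A B K t x"
proof (cases "t = 0")
  case True
  have "AE \<omega> in M. \<zeta> 0 x \<omega> = x" "AE \<omega> in M. \<zeta> 0 0 \<omega> = 0"
    using solves_sde_initial[OF sol] by auto
  then show ?thesis
    by eventually_elim (simp add: True drift_shift_def vec_eq_iff inner_axis')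
next
  case False
  with t have t: "t > 0" by simp
  let ?c = "B *v (K *v x)"
  have "AE \<omega> in M. continuous_on {0..} (\<lambda>t. \<zeta> t x \<omega>) \<and>
        (\<forall>t\<ge>0. \<zeta> t x \<omega> = x + integral {0..t} (\<lambda>r. A *v \<zeta> r x \<omega> + ?c) + Bw *v (W t \<omega> - W 0 \<omega>))"
       "AE \<omega> in M. continuous_on {0..} (\<lambda>t. \<zeta> t 0 \<omega>) \<and>
        (\<forall>t\<ge>0. \<zeta> t 0 \<omega> = integral {0..t} (\<lambda>r. A *v \<zeta> r 0 \<omega>) + Bw *v (W t \<omega> - W 0 \<omega>))"
    using sol[unfolded solves_sde_def, THEN spec[of _ x]] sol[unfolded solves_sde_def, THEN spec[of _ 0]] by auto
  then show ?thesis
  proof eventually_elim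
    case (elim \<omega>)
    define z where "z s = \<zeta> s x \<omega> - \<zeta> s 0 \<omega>" for s
    have cz: "continuous_on {0..} z" unfolding z_def by (intro continuous_on_diff) (use elim in auto)
    \<comment> \<open>The noise cancels in the difference. A zero noise matrix brings the equation
      under \<open>variation_of_constants_limit\<close>; its sums are then identically 0, so the
      limit expression vanishes.\<close>
    have z: "z s = x + integral {0..s} (\<lambda>r. A *v z r + ?c) + (0::real^'d^'n) *v (0 - 0)" if "s \<ge> 0" for s
    proof -
      have int: "(\<lambda>r. A *v \<zeta> r x \<omega> + ?c) integrable_on {0..s}" "(\<lambda>r. A *v \<zeta> r 0 \<omega>) integrable_on {0..s}"
        by (rule integrable_continuous_real; use elim in \<open>auto intro!: continuous_on_add continuous_on_matrix_vector_mult continuous_on_const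
              intro: continuous_on_subset\<close>)+
      have "integral {0..s} (\<lambda>r. A *v z r + ?c) = integral {0..s} (\<lambda>r. (A *v \<zeta> r x \<omega> + ?c) - A *v \<zeta> r 0 \<omega>)"
        by (simp add: z_def matrix_vector_mult_diff_distrib algebra_simps)
      also have "\<dots> = integral {0..s} (\<lambda>r. A *v \<zeta> r x \<omega> + ?c) - integral {0..s} (\<lambda>r. A *v \<zeta> r 0 \<omega>)"
        by (rule integral_diff[OF int])
      moreover have "\<zeta> s x \<omega> = x + integral {0..s} (\<lambda>r. A *v \<zeta> r x \<omega> + ?c) + Bw *v (W s \<omega> - W 0 \<omega>)"
        "\<zeta> s 0 \<omega> = integral {0..s} (\<lambda>r. A *v \<zeta> r 0 \<omega>) + Bw *v (W s \<omega> - W 0 \<omega>)"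
        using elim that by blast+
      ultimately show ?thesis unfolding z_def by simp
    qed
    have "z t $ i = drift_shift A B K t x $ i" for i
    proof -
      let ?v = "\<lambda>s. lin_flow (transpose A) (t - s) (axis i 1)"
      have "(\<lambda>m::nat. 0) \<longlonglongrightarrow> axis i 1 \<bullet> z t - ?v 0 \<bullet> x - integral {0..t} (\<lambda>s. ?v s \<bullet> ?c)"
        using variation_of_constants_limit[OF t cz z, where u = "axis i 1"] by simp
      then have "axis i 1 \<bullet> z t - ?v 0 \<bullet> x - integral {0..t} (\<lambda>s. ?v s \<bullet> ?c) = 0"
        by (simp add: LIMSEQ_const_iff)
      moreover have "integral {0..t} (\<lambda>s. ?v s \<bullet> ?c) = integral {0..t} ?v \<bullet> ?c"
      proof -
        have "?v integrable_on {0..t}"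
          by (intro integrable_continuous_real continuous_on_lin_flow continuous_on_diff continuous_on_const continuous_on_id)
        from integral_linear[OF this bounded_linear_inner_left[of ?c]] show ?thesis by (simp add: o_def)
      qed
      ultimately show ?thesis by (simp add: drift_shift_def inner_axis')
    qed
    then have "z t = drift_shift A B K t x" by (simp add: vec_eq_iff)
    then show ?case by (simp add: z_def algebra_simps)
  qed
qed

section \<open>The transition kernel\<close>

text \<open>Only the displacement from the last sample matters, so a varying base point can be
  traded for the fixed base point 0.\<close>

lemma intersampling_time_cong:
  assumes "\<And>k. \<zeta> (real k) x \<omega> = \<zeta>' (real k) x' \<omega>' + (x - x')"
  shows "intersampling_time \<zeta> \<epsilon> kbar x \<omega> = intersampling_time \<zeta>' \<epsilon> kbar x' \<omega>'"
  using assms by (simp add: intersampling_time_def)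

text \<open>\<zeta> is only known to be measurable in \<omega> for each fixed state. Its version
  \<open>\<zeta>'\<close> is the solution from 0 plus a deterministic continuous function of the
  state, hence jointly measurable, and it has the same kernel.\<close>

lemma sample_kernel_measurable:
  fixes A :: "real^'n^'n" and Bw :: "real^'d^'n" and M :: "'w measure"
  assumes W: "wiener_process M W" and sol: "solves_sde M W A B K Bw \<zeta>"
  shows "sample_kernel M \<zeta> \<epsilon> kbar \<in> measurable (sample_space kbar) (prob_algebra (sample_space kbar))"
proof -
  interpret prob_space M using W by (simp add: wiener_process_def)
  let ?S = "sample_space kbar :: ((real^'n) \<times> nat) measure"
  let ?P = "?S \<Otimes>\<^sub>M M"
  have meas: "\<zeta> t x \<in> borel_measurable M" if "t \<ge> 0" for t x
    using sol that by (simp add: solves_sde_def)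
  define \<zeta>' where "\<zeta>' t x \<omega> = \<zeta> t 0 \<omega> + drift_shift A B K t x" for t x \<omega>
  define G where "G = (\<lambda>(y :: (real^'n) \<times> nat) \<omega>. let s' = intersampling_time \<zeta>' \<epsilon> kbar (fst y) \<omega> in (\<zeta>' (real s') (fst y) \<omega>, s'))"
  \<comment> \<open>State and noise are merged into one sample point \<open>p\<close>, so that
    measurability of intersampling times can be reused on the product space; \<open>Z0\<close>
    subtracts the state to move the base point to 0.\<close>
  define Z where "Z t (x :: real^'n) p = \<zeta>' t (fst (fst p)) (snd p)" for t x and p :: "((real^'n) \<times> nat) \<times> 'w"
  define Z0 where "Z0 t (x :: real^'n) p = Z t x p - fst (fst p)" for t x and p :: "((real^'n) \<times> nat) \<times> 'w"
  have fst_meas: "(\<lambda>p. fst (fst p)) \<in> borel_measurable ?P"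
    unfolding sample_space_def by measurable
  have Z: "Z t x \<in> borel_measurable ?P" if "t \<ge> 0" for t x
    unfolding Z_def \<zeta>'_def
    by (intro borel_measurable_add measurable_compose[OF measurable_snd meas[OF that]]
        borel_measurable_continuous_on[OF continuous_on_drift_shift fst_meas])
  have Z0: "Z0 t x \<in> borel_measurable ?P" if "t \<ge> 0" for t x
    unfolding Z0_def by (intro borel_measurable_diff Z that fst_meas)
  have tau: "intersampling_time Z0 \<epsilon> kbar 0 \<in> measurable ?P (count_space UNIV)"
    by (rule measurable_intersampling_time) (rule Z0)
  have tau_eq: "intersampling_time \<zeta>' \<epsilon> kbar (fst (fst p)) (snd p) = intersampling_time Z0 \<epsilon> kbar 0 p" for p
    by (rule intersampling_time_cong) (simp add: Z0_def Z_def)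
  have "(\<lambda>p. Z (real (intersampling_time Z0 \<epsilon> kbar 0 p)) 0 p) \<in> borel_measurable ?P"
    by (rule measurable_compose_countable[OF _ tau]) (simp add: Z)
  moreover have "intersampling_time Z0 \<epsilon> kbar 0 \<in> measurable ?P (count_space {0..kbar})"
    using tau by (auto simp: measurable_count_space_eq2_countable intersampling_time_le)
  ultimately have "(\<lambda>p. (Z (real (intersampling_time Z0 \<epsilon> kbar 0 p)) 0 p, intersampling_time Z0 \<epsilon> kbar 0 p)) \<in> measurable ?P ?S"
    unfolding sample_space_def by (rule measurable_Pair)
  moreover have "case_prod G = (\<lambda>p. (Z (real (intersampling_time Z0 \<epsilon> kbar 0 p)) 0 p, intersampling_time Z0 \<epsilon> kbar 0 p))"
    by (rule ext) (simp add: G_def case_prod_beta Let_def tau_eq Z_def)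
  ultimately have G: "case_prod G \<in> measurable ?P ?S" by simp
  have eq: "sample_kernel M \<zeta> \<epsilon> kbar y = distr M ?S (G y)" for y
  proof -
    \<comment> \<open>Only natural times are inspected, so countably many null sets suffice.\<close>
    have "AE \<omega> in M. \<forall>k::nat. \<zeta> (real k) (fst y) \<omega> = \<zeta>' (real k) (fst y) \<omega>"
      unfolding AE_all_countable \<zeta>'_def using solves_sde_shift[OF sol] by simp
    then have ae: "AE \<omega> in M. (let s' = intersampling_time \<zeta> \<epsilon> kbar (fst y) \<omega> in (\<zeta> (real s') (fst y) \<omega>, s')) = G y \<omega>"
    proof eventually_elim
      case (elim \<omega>)
      have "intersampling_time \<zeta> \<epsilon> kbar (fst y) \<omega> = intersampling_time \<zeta>' \<epsilon> kbar (fst y) \<omega>"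
        by (rule intersampling_time_cong) (simp add: elim)
      then show ?case by (simp add: G_def elim)
    qed
    have meas': "\<zeta>' t x \<in> borel_measurable M" if "t \<ge> 0" for t x
      unfolding \<zeta>'_def using meas[OF that, of 0] by simp
    show ?thesis
      unfolding sample_kernel_def
      by (rule distr_cong_AE[OF refl refl ae measurable_sample])
         (auto simp: G_def intro: meas measurable_sample meas')
  qed
  show ?thesis
  proof (rule measurable_prob_algebraI)
    show "prob_space (sample_kernel M \<zeta> \<epsilon> kbar y)" for y
      unfolding sample_kernel_def by (rule prob_space_distr) (rule measurable_sample, rule meas)
    have "M \<in> space (subprob_algebra M)"
      by (simp add: space_subprob_algebra prob_space_imp_subprob_space prob_space_axioms)
    then have "(\<lambda>y. distr M ?S (G y)) \<in> measurable ?S (subprob_algebra ?S)"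
      by (intro measurable_distr2[OF G] measurable_const)
    then show "sample_kernel M \<zeta> \<epsilon> kbar \<in> measurable ?S (subprob_algebra ?S)"
      unfolding eq[abs_def] .
  qed
qed

text \<open>This is why the reward of the absorbing state may ignore the intersampling time \<open>0\<close>.\<close>

lemma intersampling_time_pos:
  assumes sol: "solves_sde M W A B K Bw \<zeta>" and "\<epsilon> > 0" "kbar \<ge> 1"
  shows "AE \<omega> in M. intersampling_time \<zeta> \<epsilon> kbar x \<omega> \<ge> 1"
  using solves_sde_initial[OF sol, of x]
proof eventually_elim
  case (elim \<omega>)
  have "(LEAST k. infnorm (\<zeta> (real k) x \<omega> - x) - \<epsilon> > 0) \<noteq> 0" if "\<exists>k. infnorm (\<zeta> (real k) x \<omega> - x) - \<epsilon> > 0"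
  proof
    assume "(LEAST k. infnorm (\<zeta> (real k) x \<omega> - x) - \<epsilon> > 0) = 0"
    then have "infnorm (\<zeta> (real 0) x \<omega> - x) - \<epsilon> > 0" using LeastI_ex[OF that] by simp
    then show False using elim \<open>\<epsilon> > 0\<close> by (simp add: infnorm_0)
  qed
  then show ?case using \<open>kbar \<ge> 1\<close> by (auto simp: intersampling_time_def Suc_le_eq)
qed

section \<open>Backward recursion for path rewards\<close>

text \<open>All criteria fit the recursion value = gain + factor * expected next value. The additive
  ones have factor 1 and terminal value 0, the product has gain 0, factor \<open>r\<close> and
  terminal value 1; the discount enters through the time \<open>i\<close>.\<close>

fun stage_gain :: "criterion \<Rightarrow> real \<Rightarrow> nat \<Rightarrow> nat \<Rightarrow> real \<Rightarrow> real" where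
  "stage_gain Cum \<gamma> N i r = \<gamma> ^ i * r"
| "stage_gain Avg \<gamma> N i r = 1 / (real N + 1) * r"
| "stage_gain Mul \<gamma> N i r = 0"

fun stage_factor :: "criterion \<Rightarrow> real \<Rightarrow> real" where
  "stage_factor Mul r = r"
| "stage_factor _ r = 1"

fun terminal_gain :: "criterion \<Rightarrow> real" where
  "terminal_gain Mul = 1"
| "terminal_gain _ = 0"

text \<open>In \<open>reward_to_go crit \<gamma> N r E n i\<close>, \<open>i\<close> is the current time, \<open>n\<close> the number of
  remaining steps, and \<open>E\<close> the one-step expectation operator.\<close>

primrec reward_to_go ::
  "criterion \<Rightarrow> real \<Rightarrow> nat \<Rightarrow> ('s \<Rightarrow> real) \<Rightarrow> (('s \<Rightarrow> real) \<Rightarrow> 's \<Rightarrow> real) \<Rightarrow> nat \<Rightarrow> nat \<Rightarrow> 's \<Rightarrow> real" where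
  "reward_to_go crit \<gamma> N r E 0 i y =
     stage_gain crit \<gamma> N i (r y) + stage_factor crit (r y) * terminal_gain crit"
| "reward_to_go crit \<gamma> N r E (Suc n) i y =
     stage_gain crit \<gamma> N i (r y) + stage_factor crit (r y) * E (reward_to_go crit \<gamma> N r E n (Suc i)) y"

definition past_gain :: "criterion \<Rightarrow> real \<Rightarrow> nat \<Rightarrow> ('s \<Rightarrow> real) \<Rightarrow> nat \<Rightarrow> (nat \<Rightarrow> 's) \<Rightarrow> real" where
  "past_gain crit \<gamma> N r n \<omega> = (\<Sum>i<n. (\<Prod>j<i. stage_factor crit (r (\<omega> j))) * stage_gain crit \<gamma> N i (r (\<omega> i)))"

definition past_factor :: "criterion \<Rightarrow> ('s \<Rightarrow> real) \<Rightarrow> nat \<Rightarrow> (nat \<Rightarrow> 's) \<Rightarrow> real" where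
  "past_factor crit r n \<omega> = (\<Prod>j<n. stage_factor crit (r (\<omega> j)))"

text \<open>The conditional expectation of the path reward given the states up to time
  \<open>n\<close>. As a martingale it has constant mean, which links the recursion at n = 0 with
  the path reward at n = N.\<close>

definition expected_total ::
  "criterion \<Rightarrow> real \<Rightarrow> nat \<Rightarrow> ('s \<Rightarrow> real) \<Rightarrow> (('s \<Rightarrow> real) \<Rightarrow> 's \<Rightarrow> real) \<Rightarrow> nat \<Rightarrow> (nat \<Rightarrow> 's) \<Rightarrow> real" where
  "expected_total crit \<gamma> N r E n \<omega> =
     past_gain crit \<gamma> N r n \<omega> + past_factor crit r n \<omega> * reward_to_go crit \<gamma> N r E (N - n) n (\<omega> n)"

lemma expected_total_0: "expected_total crit \<gamma> N r E 0 \<omega> = reward_to_go crit \<gamma> N r E N 0 (\<omega> 0)"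
  by (simp add: expected_total_def past_gain_def past_factor_def)

lemma expected_total_last: "expected_total crit \<gamma> N r E N \<omega> = path_reward crit \<gamma> N r \<omega>"
  by (cases crit)
     (simp_all add: expected_total_def past_gain_def past_factor_def lessThan_Suc_atMost[symmetric] sum_distrib_left
       sum_divide_distrib add_divide_distrib)

lemma expected_total_cong:
  assumes "\<And>j. j \<le> n \<Longrightarrow> \<omega> j = \<omega>' j"
  shows "expected_total crit \<gamma> N r E n \<omega> = expected_total crit \<gamma> N r E n \<omega>'"
  using assms by (simp add: expected_total_def past_gain_def past_factor_def)

lemma expected_total_step:
  assumes "n < N"
  shows "past_gain crit \<gamma> N r (Suc n) \<omega> + past_factor crit r (Suc n) \<omega> * E (reward_to_go crit \<gamma> N r E (N - Suc n) (Suc n)) (\<omega> n)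
    = expected_total crit \<gamma> N r E n \<omega>"
proof -
  from assms obtain k where k: "N - n = Suc k" "N - Suc n = k" by (metis Suc_diff_Suc)
  then show ?thesis
    by (simp add: expected_total_def past_gain_def past_factor_def algebra_simps)
qed

lemma expected_total_update:
  "expected_total crit \<gamma> N r E (Suc n) (fun_upd \<omega> (Suc n) y) =
     past_gain crit \<gamma> N r (Suc n) \<omega> + past_factor crit r (Suc n) \<omega> * reward_to_go crit \<gamma> N r E (N - Suc n) (Suc n) y"
  by (simp add: expected_total_def past_gain_def past_factor_def)

section \<open>Bounded measurable functions\<close>

definition bounded_measurable :: "'a measure \<Rightarrow> ('a \<Rightarrow> real) \<Rightarrow> bool" where
  "bounded_measurable M f \<longleftrightarrow> f \<in> borel_measurable M \<and> (\<exists>B. \<forall>x\<in>space M. \<bar>f x\<bar> \<le> B)"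

lemma bounded_measurable_const: "bounded_measurable M (\<lambda>_. c)"
  by (auto simp: bounded_measurable_def)

lemma bounded_measurable_add:
  assumes "bounded_measurable M f" "bounded_measurable M g"
  shows "bounded_measurable M (\<lambda>x. f x + g x)"
proof -
  obtain B C where "\<forall>x\<in>space M. \<bar>f x\<bar> \<le> B" "\<forall>x\<in>space M. \<bar>g x\<bar> \<le> C"
    using assms unfolding bounded_measurable_def by blast
  then have "\<bar>f x + g x\<bar> \<le> B + C" if "x \<in> space M" for x
    using that abs_triangle_ineq[of "f x" "g x"] by fastforce
  then show ?thesis using assms unfolding bounded_measurable_def by (blast intro: borel_measurable_add)
qed

lemma bounded_measurable_mult:
  assumes "bounded_measurable M f" "bounded_measurable M g"
  shows "bounded_measurable M (\<lambda>x. f x * g x)"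
proof -
  obtain B C where "\<forall>x\<in>space M. \<bar>f x\<bar> \<le> B" "\<forall>x\<in>space M. \<bar>g x\<bar> \<le> C"
    using assms unfolding bounded_measurable_def by blast
  then have "\<bar>f x * g x\<bar> \<le> B * C" if "x \<in> space M" for x
    unfolding abs_mult using that by (intro mult_mono) (auto intro: order_trans[OF abs_ge_zero])
  then show ?thesis using assms unfolding bounded_measurable_def by (blast intro: borel_measurable_times)
qed

lemma bounded_measurable_sum:
  "(\<And>i. i \<in> I \<Longrightarrow> bounded_measurable M (f i)) \<Longrightarrow> bounded_measurable M (\<lambda>x. \<Sum>i\<in>I. f i x)"
  by (induction I rule: infinite_finite_induct) (auto intro: bounded_measurable_const bounded_measurable_add)

lemma bounded_measurable_prod:
  "(\<And>i. i \<in> I \<Longrightarrow> bounded_measurable M (f i)) \<Longrightarrow> bounded_measurable M (\<lambda>x. \<Prod>i\<in>I. f i x)"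
  by (induction I rule: infinite_finite_induct) (auto intro: bounded_measurable_const bounded_measurable_mult)

lemma bounded_measurable_compose:
  assumes "bounded_measurable N f" "g \<in> measurable M N"
  shows "bounded_measurable M (\<lambda>x. f (g x))"
  using assms measurable_space[OF assms(2)] unfolding bounded_measurable_def by (blast intro: measurable_compose)

lemma bounded_measurable_integrable:
  assumes "prob_space P" "sets P = sets M" "bounded_measurable M f"
  shows "integrable P f"
proof -
  interpret prob_space P by fact
  obtain B where B: "\<forall>x\<in>space M. \<bar>f x\<bar> \<le> B" and "f \<in> borel_measurable M"
    using assms(3) by (auto simp: bounded_measurable_def)
  then show ?thesis
    using sets_eq_imp_space_eq[OF assms(2)] assms(2)
    by (intro integrable_const_bound[where B = B]) (auto cong: measurable_cong_sets)
qed

lemma bounded_measurable_kernel_integral: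
  assumes \<kappa>: "\<kappa> \<in> measurable S (prob_algebra S)" and f: "bounded_measurable S f"
  shows "bounded_measurable S (\<lambda>y. \<integral>z. f z \<partial>\<kappa> y)"
  unfolding bounded_measurable_def
proof
  have fm: "f \<in> borel_measurable S" using f by (simp add: bounded_measurable_def)
  show "(\<lambda>y. \<integral>z. f z \<partial>\<kappa> y) \<in> borel_measurable S"
    by (rule measurable_compose[OF measurable_prob_algebraD[OF \<kappa>] integral_measurable_subprob_algebra[OF fm]])
  obtain B where B: "\<forall>x\<in>space S. \<bar>f x\<bar> \<le> B" using f by (auto simp: bounded_measurable_def)
  have "\<bar>\<integral>z. f z \<partial>\<kappa> y\<bar> \<le> B" if "y \<in> space S" for y
  proof -
    have k: "prob_space (\<kappa> y)" "sets (\<kappa> y) = sets S"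
      using measurable_space[OF \<kappa> that] by (auto simp: space_prob_algebra)
    interpret prob_space "\<kappa> y" by (rule k)
    have "\<bar>\<integral>z. f z \<partial>\<kappa> y\<bar> \<le> (\<integral>z. \<bar>f z\<bar> \<partial>\<kappa> y)" by (rule integral_abs_bound)
    also have "\<dots> \<le> (\<integral>z. B \<partial>\<kappa> y)"
      using B sets_eq_imp_space_eq[OF k(2)]
      by (intro integral_mono integrable_abs bounded_measurable_integrable[OF k f]) auto
    finally show ?thesis by (simp add: prob_space)
  qed
  then show "\<exists>B. \<forall>y\<in>space S. \<bar>\<integral>z. f z \<partial>\<kappa> y\<bar> \<le> B" by blast
qed

lemma bounded_measurable_stage:
  assumes "bounded_measurable M (\<lambda>x. r (f x))"
  shows "bounded_measurable M (\<lambda>x. stage_gain crit \<gamma> N i (r (f x)))"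
    and "bounded_measurable M (\<lambda>x. stage_factor crit (r (f x)))"
  by (cases crit; simp only: stage_gain.simps stage_factor.simps; intro bounded_measurable_mult bounded_measurable_const assms)+

lemma bounded_measurable_reward_to_go:
  assumes \<kappa>: "\<kappa> \<in> measurable S (prob_algebra S)" and r: "bounded_measurable S r"
  shows "bounded_measurable S (reward_to_go crit \<gamma> N r (\<lambda>f y. \<integral>z. f z \<partial>\<kappa> y) n i)"
proof (induction n arbitrary: i)
  case 0
  have "bounded_measurable S (\<lambda>y. stage_gain crit \<gamma> N i (r y) + stage_factor crit (r y) * terminal_gain crit)"
    by (intro bounded_measurable_add bounded_measurable_mult bounded_measurable_const bounded_measurable_stage r)
  then show ?case by (simp cong: arg_cong2[where f = bounded_measurable] add: fun_eq_iff)
next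
  case (Suc n)
  have "bounded_measurable S (\<lambda>y. stage_gain crit \<gamma> N i (r y) + stage_factor crit (r y) *
      (\<integral>z. reward_to_go crit \<gamma> N r (\<lambda>f y. \<integral>z. f z \<partial>\<kappa> y) n (Suc i) z \<partial>\<kappa> y))"
    by (intro bounded_measurable_add bounded_measurable_mult bounded_measurable_kernel_integral[OF \<kappa>] bounded_measurable_stage r Suc)
  then show ?case by simp
qed

section \<open>Path law of the sampled chain\<close>

lemma markov_path_step_measurable:
  assumes \<kappa>: "\<kappa> \<in> measurable S (prob_algebra S)"
  shows "(\<lambda>\<omega>. distr (\<kappa> (\<omega> n)) (PiM {..Suc n} (\<lambda>_. S)) (fun_upd \<omega> (Suc n)))
     \<in> measurable (PiM {..n} (\<lambda>_. S)) (prob_algebra (PiM {..Suc n} (\<lambda>_. S)))"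
proof (rule measurable_prob_algebraI)
  have upd: "(\<lambda>(\<omega>, y). fun_upd \<omega> (Suc n) y) \<in> measurable (PiM {..n} (\<lambda>_. S) \<Otimes>\<^sub>M S) (PiM {..Suc n} (\<lambda>_. S))"
    using measurable_add_dim[of "Suc n" "{..n}" "\<lambda>_. S"] by (simp add: atMost_Suc)
  have comp: "(\<lambda>\<omega>. \<omega> n) \<in> measurable (PiM {..n} (\<lambda>_. S)) S" by simp
  show "(\<lambda>\<omega>. distr (\<kappa> (\<omega> n)) (PiM {..Suc n} (\<lambda>_. S)) (fun_upd \<omega> (Suc n)))
     \<in> measurable (PiM {..n} (\<lambda>_. S)) (subprob_algebra (PiM {..Suc n} (\<lambda>_. S)))"
    using upd measurable_compose[OF comp measurable_prob_algebraD[OF \<kappa>]] by (rule measurable_distr2)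
  fix \<omega> assume \<omega>: "\<omega> \<in> space (PiM {..n} (\<lambda>_. S))"
  then have "\<omega> n \<in> space S" by (auto simp: space_PiM)
  then have k: "prob_space (\<kappa> (\<omega> n))" "sets (\<kappa> (\<omega> n)) = sets S"
    using measurable_space[OF \<kappa>] by (auto simp: space_prob_algebra)
  have "fun_upd \<omega> (Suc n) \<in> measurable (\<kappa> (\<omega> n)) (PiM {..Suc n} (\<lambda>_. S))"
    using measurable_compose[OF measurable_Pair1'[OF \<omega>] upd] k(2) by (simp cong: measurable_cong_sets)
  then show "prob_space (distr (\<kappa> (\<omega> n)) (PiM {..Suc n} (\<lambda>_. S)) (fun_upd \<omega> (Suc n)))"
    by (rule prob_space.prob_space_distr[OF k(1)])
qed

lemma markov_path_law_prob:
  assumes \<kappa>: "\<kappa> \<in> measurable S (prob_algebra S)" and y0: "y0 \<in> space S"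
  shows "markov_path_law S \<kappa> y0 n \<in> space (prob_algebra (PiM {..n} (\<lambda>_. S)))"
proof (induction n)
  case 0
  have "(\<lambda>i\<in>{..0}. y0) \<in> space (PiM {..0::nat} (\<lambda>_. S))" using y0 by (auto simp: space_PiM)
  then show ?case by (simp add: space_prob_algebra prob_space_return)
next
  case (Suc n)
  show ?case
    unfolding markov_path_law.simps space_prob_algebra
    using prob_space_bind'[OF Suc markov_path_step_measurable[OF \<kappa>]]
      sets_bind'[OF Suc markov_path_step_measurable[OF \<kappa>]] by simp
qed

text \<open>The tower property: the last state is integrated out against the kernel at the state
  before it.\<close>

lemma integral_markov_path_law_Suc:
  assumes \<kappa>: "\<kappa> \<in> measurable S (prob_algebra S)" and y0: "y0 \<in> space S"
    and f: "bounded_measurable (PiM {..Suc n} (\<lambda>_. S)) f"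
  shows "(\<integral>\<omega>. f \<omega> \<partial>markov_path_law S \<kappa> y0 (Suc n))
     = (\<integral>\<omega>. (\<integral>y. f (fun_upd \<omega> (Suc n) y) \<partial>\<kappa> (\<omega> n)) \<partial>markov_path_law S \<kappa> y0 n)"
proof -
  have law: "prob_space (markov_path_law S \<kappa> y0 n)" "sets (markov_path_law S \<kappa> y0 n) = sets (PiM {..n} (\<lambda>_. S))"
    using markov_path_law_prob[OF \<kappa> y0, of n] by (auto simp: space_prob_algebra)
  interpret prob_space "markov_path_law S \<kappa> y0 n" by (rule law)
  have sp: "space (markov_path_law S \<kappa> y0 n) = space (PiM {..n} (\<lambda>_. S))"
    by (rule sets_eq_imp_space_eq[OF law(2)])
  have step: "(\<lambda>\<omega>. distr (\<kappa> (\<omega> n)) (PiM {..Suc n} (\<lambda>_. S)) (fun_upd \<omega> (Suc n)))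
     \<in> measurable (markov_path_law S \<kappa> y0 n) (prob_algebra (PiM {..Suc n} (\<lambda>_. S)))"
    using markov_path_step_measurable[OF \<kappa>, of n] measurable_cong_sets[OF law(2) refl] by blast
  obtain B where B: "\<And>x. x \<in> space (PiM {..Suc n} (\<lambda>_. S)) \<Longrightarrow> \<bar>f x\<bar> \<le> B" and fm: "f \<in> borel_measurable (PiM {..Suc n} (\<lambda>_. S))"
    using f by (auto simp: bounded_measurable_def)
  have "(\<integral>\<omega>. f \<omega> \<partial>markov_path_law S \<kappa> y0 (Suc n))
     = (\<integral>\<omega>. integral\<^sup>L (distr (\<kappa> (\<omega> n)) (PiM {..Suc n} (\<lambda>_. S)) (fun_upd \<omega> (Suc n))) f \<partial>markov_path_law S \<kappa> y0 n)"
    unfolding markov_path_law.simps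
  proof (rule integral_bind[OF fm B measurable_prob_algebraD[OF step] finite_measure_axioms])
    show "AE \<omega> in markov_path_law S \<kappa> y0 n.
        emeasure (distr (\<kappa> (\<omega> n)) (PiM {..Suc n} (\<lambda>_. S)) (fun_upd \<omega> (Suc n)))
          (space (distr (\<kappa> (\<omega> n)) (PiM {..Suc n} (\<lambda>_. S)) (fun_upd \<omega> (Suc n)))) \<le> ennreal 1"
    proof (rule AE_I2)
      fix \<omega> assume "\<omega> \<in> space (markov_path_law S \<kappa> y0 n)"
      then have "prob_space (distr (\<kappa> (\<omega> n)) (PiM {..Suc n} (\<lambda>_. S)) (fun_upd \<omega> (Suc n)))"
        using measurable_space[OF step] by (simp add: space_prob_algebra)
      then show "emeasure (distr (\<kappa> (\<omega> n)) (PiM {..Suc n} (\<lambda>_. S)) (fun_upd \<omega> (Suc n)))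
          (space (distr (\<kappa> (\<omega> n)) (PiM {..Suc n} (\<lambda>_. S)) (fun_upd \<omega> (Suc n)))) \<le> ennreal 1"
        by (simp only: prob_space.emeasure_space_1 ennreal_1 order_refl)
    qed
  qed
  also have "\<dots> = (\<integral>\<omega>. (\<integral>y. f (fun_upd \<omega> (Suc n) y) \<partial>\<kappa> (\<omega> n)) \<partial>markov_path_law S \<kappa> y0 n)"
  proof (rule Bochner_Integration.integral_cong[OF refl])
    fix \<omega> assume "\<omega> \<in> space (markov_path_law S \<kappa> y0 n)"
    then have \<omega>: "\<omega> \<in> space (PiM {..n} (\<lambda>_. S))" by (simp add: sp)
    then have "\<omega> n \<in> space S" by (auto simp: space_PiM)
    then have k: "sets (\<kappa> (\<omega> n)) = sets S"
      using measurable_space[OF \<kappa>] by (auto simp: space_prob_algebra)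
    have upd: "(\<lambda>(\<omega>, y). fun_upd \<omega> (Suc n) y) \<in> measurable (PiM {..n} (\<lambda>_. S) \<Otimes>\<^sub>M S) (PiM {..Suc n} (\<lambda>_. S))"
      using measurable_add_dim[of "Suc n" "{..n}" "\<lambda>_. S"] by (simp add: atMost_Suc)
    have "fun_upd \<omega> (Suc n) \<in> measurable (\<kappa> (\<omega> n)) (PiM {..Suc n} (\<lambda>_. S))"
      using measurable_compose[OF measurable_Pair1'[OF \<omega>] upd] k by (simp cong: measurable_cong_sets)
    then show "integral\<^sup>L (distr (\<kappa> (\<omega> n)) (PiM {..Suc n} (\<lambda>_. S)) (fun_upd \<omega> (Suc n))) f = (\<integral>y. f (fun_upd \<omega> (Suc n) y) \<partial>\<kappa> (\<omega> n))"
      using fm by (rule integral_distr)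
  qed
  finally show ?thesis .
qed

lemma markov_path_reward:
  assumes \<kappa>: "\<kappa> \<in> measurable S (prob_algebra S)" and y0: "y0 \<in> space S" and r: "bounded_measurable S r"
  shows "(\<integral>\<omega>. path_reward crit \<gamma> N r \<omega> \<partial>markov_path_law S \<kappa> y0 N)
     = reward_to_go crit \<gamma> N r (\<lambda>f y. \<integral>z. f z \<partial>\<kappa> y) N 0 y0"
proof -
  let ?E = "\<lambda>f y. \<integral>z. f z \<partial>\<kappa> y"
  let ?T = "expected_total crit \<gamma> N r ?E"
  have coord: "bounded_measurable (PiM {..n} (\<lambda>_. S)) (\<lambda>\<omega>. r (\<omega> j))" if "j \<le> n" for j n
    by (rule bounded_measurable_compose[OF r]) (use that in simp)
  have past: "bounded_measurable (PiM {..m} (\<lambda>_. S)) (past_gain crit \<gamma> N r n)"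
    "bounded_measurable (PiM {..m} (\<lambda>_. S)) (past_factor crit r n)" if "n \<le> Suc m" for n m
    unfolding past_gain_def past_factor_def
    by (intro bounded_measurable_sum bounded_measurable_mult bounded_measurable_prod bounded_measurable_stage coord; use that in simp)+
  have bT: "bounded_measurable (PiM {..n} (\<lambda>_. S)) (?T n)" for n
    unfolding expected_total_def
    by (intro bounded_measurable_add bounded_measurable_mult past
        bounded_measurable_compose[OF bounded_measurable_reward_to_go[OF \<kappa> r]]) auto
  have "(\<integral>\<omega>. ?T n \<omega> \<partial>markov_path_law S \<kappa> y0 n) = reward_to_go crit \<gamma> N r ?E N 0 y0" if "n \<le> N" for n
    using that
  proof (induction n)
    case 0
    have "(\<lambda>i\<in>{..0}. y0) \<in> space (PiM {..0::nat} (\<lambda>_. S))" using y0 by (auto simp: space_PiM)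
    then have "(\<integral>\<omega>. ?T 0 \<omega> \<partial>markov_path_law S \<kappa> y0 0) = ?T 0 (\<lambda>i\<in>{..0}. y0)"
      unfolding markov_path_law.simps using bT[of 0] by (intro integral_return) (auto simp: bounded_measurable_def)
    then show ?case by (simp add: expected_total_0)
  next
    case (Suc n)
    have law: "prob_space (markov_path_law S \<kappa> y0 n)" "sets (markov_path_law S \<kappa> y0 n) = sets (PiM {..n} (\<lambda>_. S))"
      using markov_path_law_prob[OF \<kappa> y0, of n] by (auto simp: space_prob_algebra)
    have "(\<integral>\<omega>. ?T (Suc n) \<omega> \<partial>markov_path_law S \<kappa> y0 (Suc n))
        = (\<integral>\<omega>. (\<integral>y. ?T (Suc n) (fun_upd \<omega> (Suc n) y) \<partial>\<kappa> (\<omega> n)) \<partial>markov_path_law S \<kappa> y0 n)"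
      by (rule integral_markov_path_law_Suc[OF \<kappa> y0 bT])
    \<comment> \<open>Martingale property: the past terms do not see the new state, and integrating
      the remainder is one step of the recursion.\<close>
    also have "\<dots> = (\<integral>\<omega>. ?T n \<omega> \<partial>markov_path_law S \<kappa> y0 n)"
    proof (rule Bochner_Integration.integral_cong[OF refl])
      fix \<omega> assume "\<omega> \<in> space (markov_path_law S \<kappa> y0 n)"
      then have "\<omega> \<in> space (PiM {..n} (\<lambda>_. S))" using sets_eq_imp_space_eq[OF law(2)] by simp
      then have "\<omega> n \<in> space S" by (auto simp: space_PiM)
      then have k: "prob_space (\<kappa> (\<omega> n))" "sets (\<kappa> (\<omega> n)) = sets S"
        using measurable_space[OF \<kappa>] by (auto simp: space_prob_algebra)
      interpret k: prob_space "\<kappa> (\<omega> n)" by (rule k)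
      have "integrable (\<kappa> (\<omega> n)) (reward_to_go crit \<gamma> N r ?E (N - Suc n) (Suc n))"
        by (rule bounded_measurable_integrable[OF k bounded_measurable_reward_to_go[OF \<kappa> r]])
      then have "(\<integral>y. ?T (Suc n) (fun_upd \<omega> (Suc n) y) \<partial>\<kappa> (\<omega> n))
        = past_gain crit \<gamma> N r (Suc n) \<omega> + past_factor crit r (Suc n) \<omega> * ?E (reward_to_go crit \<gamma> N r ?E (N - Suc n) (Suc n)) (\<omega> n)"
        unfolding expected_total_update by (simp add: k.prob_space)
      then show "(\<integral>y. ?T (Suc n) (fun_upd \<omega> (Suc n) y) \<partial>\<kappa> (\<omega> n)) = ?T n \<omega>"
        using Suc.prems by (simp only: expected_total_step[of n N, symmetric] Suc_le_lessD)
    qed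
    also have "\<dots> = reward_to_go crit \<gamma> N r ?E N 0 y0" using Suc by simp
    finally show ?case .
  qed
  from this[of N] show ?thesis by (simp only: expected_total_last order_refl)
qed

section \<open>Adversaries of the interval Markov chain\<close>

lemma set_imc_path_law:
  assumes \<pi>: "\<pi> \<in> adversaries Q Plo Phi" and q0: "q0 \<in> Q"
  shows "set_pmf (imc_path_law \<pi> q0 n) \<subseteq> {w. set w \<subseteq> Q \<and> length w = Suc n}"
proof (induction n)
  case (Suc n)
  have step: "set_pmf (\<pi> w) \<subseteq> Q" if "set w \<subseteq> Q" "length w = Suc n" for w
  proof -
    have "w \<noteq> []" using that(2) by auto
    then show ?thesis using \<pi> that(1) by (simp add: adversaries_def feasible_def)
  qed
  show ?case
  proof
    fix w' assume "w' \<in> set_pmf (imc_path_law \<pi> q0 (Suc n))"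
    then obtain w q where w: "w \<in> set_pmf (imc_path_law \<pi> q0 n)" and q: "q \<in> set_pmf (\<pi> w)" and "w' = w @ [q]"
      by auto
    moreover have "set w \<subseteq> Q" "length w = Suc n" using Suc w by auto
    moreover have "q \<in> Q" using step calculation q by blast
    ultimately show "w' \<in> {w. set w \<subseteq> Q \<and> length w = Suc (Suc n)}" by simp
  qed
qed (use q0 in simp)

text \<open>A path of length n + 1 stands at time n, so \<open>length w\<close> is the time of the
  next state and \<open>N - length w\<close> the number of steps remaining after it. On paths longer
  than \<open>N\<close> the difference is 0 and the choice is still feasible.\<close>

definition adversary_of :: "nat \<Rightarrow> (nat \<Rightarrow> nat \<Rightarrow> 's \<Rightarrow> real) \<Rightarrow> (('s \<Rightarrow> real) \<Rightarrow> 's \<Rightarrow> 's pmf) \<Rightarrow> 's list \<Rightarrow> 's pmf" where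
  "adversary_of N V sel w = sel (V (N - length w) (length w)) (last w)"

text \<open>The selector depends on the function whose expectation is optimised, hence on the time.
  The adversary reads the time off the length of the path and otherwise looks only at the last
  state.\<close>

lemma imc_path_reward:
  fixes sel :: "('s \<Rightarrow> real) \<Rightarrow> 's \<Rightarrow> 's pmf"
  assumes Q: "finite Q" and q0: "q0 \<in> Q" and sel: "\<And>f q. q \<in> Q \<Longrightarrow> feasible Q Plo Phi q (sel f q)"
  defines "E \<equiv> \<lambda>f q. measure_pmf.expectation (sel f q) f"
  shows "\<exists>\<pi>\<in>adversaries Q Plo Phi.
    imc_expectation \<pi> q0 N (path_reward crit \<gamma> N r) = reward_to_go crit \<gamma> N r E N 0 q0"
proof
  define \<pi> where "\<pi> = adversary_of N (reward_to_go crit \<gamma> N r E) sel"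
  show \<pi>: "\<pi> \<in> adversaries Q Plo Phi"
    unfolding adversaries_def \<pi>_def adversary_of_def using sel by (auto simp: subset_iff)
  let ?T = "expected_total crit \<gamma> N r E"
  have "measure_pmf.expectation (imc_path_law \<pi> q0 n) (\<lambda>w. ?T n (nth w)) = reward_to_go crit \<gamma> N r E N 0 q0" if "n \<le> N" for n
    using that
  proof (induction n)
    case 0
    show ?case by (simp add: expected_total_0)
  next
    case (Suc n)
    let ?A = "{w. set w \<subseteq> Q \<and> length w = Suc n}"
    have fin: "finite ?A" by (rule finite_lists_length_eq[OF Q])
    have finp: "finite (set_pmf (\<pi> w))" "set_pmf (\<pi> w) \<subseteq> Q" if "w \<in> ?A" for w
    proof -
      have "w \<noteq> []" using that by auto
      then show "set_pmf (\<pi> w) \<subseteq> Q" using \<pi> that unfolding adversaries_def feasible_def by auto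
      then show "finite (set_pmf (\<pi> w))" using Q by (rule finite_subset)
    qed
    have inner: "measure_pmf.expectation (map_pmf (\<lambda>q. w @ [q]) (\<pi> w)) (\<lambda>w. ?T (Suc n) (nth w)) = ?T n (nth w)"
      if w: "w \<in> ?A" for w
    proof -
      have len: "length w = Suc n" using w by simp
      have "?T (Suc n) (nth (w @ [q])) = past_gain crit \<gamma> N r (Suc n) (nth w)
          + past_factor crit r (Suc n) (nth w) * reward_to_go crit \<gamma> N r E (N - Suc n) (Suc n) q" for q
        unfolding expected_total_update[symmetric]
        by (rule expected_total_cong) (simp add: nth_append len)
      then have "measure_pmf.expectation (map_pmf (\<lambda>q. w @ [q]) (\<pi> w)) (\<lambda>w. ?T (Suc n) (nth w))
        = past_gain crit \<gamma> N r (Suc n) (nth w)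
          + past_factor crit r (Suc n) (nth w) * measure_pmf.expectation (\<pi> w) (reward_to_go crit \<gamma> N r E (N - Suc n) (Suc n))"
        using finp[OF w] by (simp add: integrable_measure_pmf_finite)
      also have "measure_pmf.expectation (\<pi> w) (reward_to_go crit \<gamma> N r E (N - Suc n) (Suc n))
          = E (reward_to_go crit \<gamma> N r E (N - Suc n) (Suc n)) (w ! n)"
        by (cases "w = []") (use len in \<open>auto simp: \<pi>_def adversary_of_def E_def last_conv_nth\<close>)
      also have "past_gain crit \<gamma> N r (Suc n) (nth w) + past_factor crit r (Suc n) (nth w) * \<dots> = ?T n (nth w)"
        using Suc.prems by (intro expected_total_step) simp
      finally show ?thesis .
    qed
    have "measure_pmf.expectation (imc_path_law \<pi> q0 (Suc n)) (\<lambda>w. ?T (Suc n) (nth w))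
      = (\<Sum>w\<in>?A. pmf (imc_path_law \<pi> q0 n) w *\<^sub>R
          measure_pmf.expectation (map_pmf (\<lambda>q. w @ [q]) (\<pi> w)) (\<lambda>w. ?T (Suc n) (nth w)))"
      unfolding imc_path_law.simps
      by (rule pmf_expectation_bind[OF fin _ set_imc_path_law[OF \<pi> q0]]) (use finp in auto)
    also have "\<dots> = (\<Sum>w\<in>?A. pmf (imc_path_law \<pi> q0 n) w *\<^sub>R ?T n (nth w))"
      by (intro sum.cong refl) (simp only: inner)
    also have "\<dots> = measure_pmf.expectation (imc_path_law \<pi> q0 n) (\<lambda>w. ?T n (nth w))"
      using set_imc_path_law[OF \<pi> q0, of n] by (intro integral_measure_pmf[OF fin, symmetric]) auto
    finally show ?case using Suc by simp
  qed
  from this[of N] show "imc_expectation \<pi> q0 N (path_reward crit \<gamma> N r) = reward_to_go crit \<gamma> N r E N 0 q0"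
    by (simp only: imc_expectation_def expected_total_last order_refl)
qed

text \<open>Infimum and supremum of reals can be compared with members only for bounded sets. All
  adversaries put their mass on the same finite set of paths, which gives a common bound.\<close>

lemma imc_expectations_bounded:
  assumes Q: "finite Q" and q0: "q0 \<in> Q"
  shows "bdd_below ((\<lambda>\<pi>. imc_expectation \<pi> q0 N g) ` adversaries Q Plo Phi)"
    and "bdd_above ((\<lambda>\<pi>. imc_expectation \<pi> q0 N g) ` adversaries Q Plo Phi)"
proof -
  let ?A = "{w. set w \<subseteq> Q \<and> length w = Suc N}"
  have fin: "finite ?A" by (rule finite_lists_length_eq[OF Q])
  have "\<bar>imc_expectation \<pi> q0 N g\<bar> \<le> (\<Sum>w\<in>?A. \<bar>g (nth w)\<bar>)" if \<pi>: "\<pi> \<in> adversaries Q Plo Phi" for \<pi>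
  proof -
    have "imc_expectation \<pi> q0 N g = (\<Sum>w\<in>?A. g (nth w) * pmf (imc_path_law \<pi> q0 N) w)"
      unfolding imc_expectation_def
      using set_imc_path_law[OF \<pi> q0, of N] by (intro integral_measure_pmf_real[OF fin]) auto
    also have "\<bar>\<dots>\<bar> \<le> (\<Sum>w\<in>?A. \<bar>g (nth w) * pmf (imc_path_law \<pi> q0 N) w\<bar>)" by (rule sum_abs)
    also have "\<dots> \<le> (\<Sum>w\<in>?A. \<bar>g (nth w)\<bar>)"
      by (intro sum_mono) (simp add: abs_mult mult_left_le pmf_le_1)
    finally show ?thesis .
  qed
  then show "bdd_below ((\<lambda>\<pi>. imc_expectation \<pi> q0 N g) ` adversaries Q Plo Phi)"
    and "bdd_above ((\<lambda>\<pi>. imc_expectation \<pi> q0 N g) ` adversaries Q Plo Phi)"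
    by (meson abs_le_iff bdd_belowI2 bdd_aboveI2 minus_le_iff)+
qed

text \<open>The feasible distributions form a compact polytope, on which the linear functional
  \<open>p \<mapsto> E\<^sub>p f\<close> attains its minimum.\<close>

lemma feasible_minimiser:
  fixes f :: "'s \<Rightarrow> real"
  assumes Q: "finite Q" and lo: "\<And>q'. q' \<in> Q \<Longrightarrow> 0 \<le> Plo q q'" and ne: "feasible Q Plo Phi q p0"
  shows "\<exists>p. feasible Q Plo Phi q p \<and>
    (\<forall>p'. feasible Q Plo Phi q p' \<longrightarrow> measure_pmf.expectation p f \<le> measure_pmf.expectation p' f)"
proof -
  \<comment> \<open>Coordinates outside \<open>Q\<close> are pinned to 0: every factor is compact,
    so Tychonoff applies, and the points of \<open>K\<close> are mass functions supported in
    \<open>Q\<close>.\<close>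
  define D where "D = (\<Pi>\<^sub>E q'\<in>UNIV. if q' \<in> Q then {Plo q q'..Phi q q'} else {0})"
  define K where "K = D \<inter> {g. (\<Sum>q'\<in>Q. g q') = 1}"
  have "compactin (product_topology (\<lambda>_. euclidean) UNIV) D"
    unfolding D_def compactin_PiE by auto
  then have "compact D" by (simp add: euclidean_product_topology)
  moreover have "closed {g :: 's \<Rightarrow> real. (\<Sum>q'\<in>Q. g q') = 1}"
    by (intro closed_Collect_eq continuous_on_sum continuous_on_product_coordinates continuous_on_const)
  ultimately have "compact K" unfolding K_def by (rule compact_Int_closed)
  have E: "measure_pmf.expectation p f = (\<Sum>q'\<in>Q. f q' * pmf p q')" if "feasible Q Plo Phi q p" for p
    using that Q by (intro integral_measure_pmf_real) (auto simp: feasible_def)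
  have K: "pmf p \<in> K" if "feasible Q Plo Phi q p" for p
    using that Q sum_pmf_eq_1[OF Q, of p] by (auto simp: K_def D_def feasible_def PiE_iff set_pmf_iff)
  have "continuous_on K (\<lambda>g. \<Sum>q'\<in>Q. f q' * g q')"
    by (intro continuous_on_sum continuous_on_mult continuous_on_const continuous_on_subset[OF continuous_on_product_coordinates]) auto
  then obtain g where g: "g \<in> K" "\<And>g'. g' \<in> K \<Longrightarrow> (\<Sum>q'\<in>Q. f q' * g q') \<le> (\<Sum>q'\<in>Q. f q' * g' q')"
    using continuous_attains_inf[OF \<open>compact K\<close>] K[OF ne] by blast
  have gD: "g q' \<in> (if q' \<in> Q then {Plo q q'..Phi q q'} else {0})" for q'
    using g(1) by (simp add: K_def D_def PiE_iff)
  have gin: "Plo q q' \<le> g q' \<and> g q' \<le> Phi q q'" if "q' \<in> Q" for q'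
    using gD[of q'] that by simp
  have gout: "g q' = 0" if "q' \<notin> Q" for q'
    using gD[of q'] that by simp
  have g0: "g q' \<ge> 0" for q'
    using gin[of q'] gout[of q'] lo[of q'] by (cases "q' \<in> Q") auto
  have "(\<integral>\<^sup>+ q'. ennreal (g q') \<partial>count_space UNIV) = (\<Sum>q'\<in>Q. ennreal (g q'))"
    using gout by (intro nn_integral_count_space'[OF Q]) auto
  also have "\<dots> = 1" using g(1) g0 by (simp add: K_def)
  finally have pmf: "pmf (embed_pmf g) q' = g q'" for q'
    by (intro pmf_embed_pmf g0)
  have "feasible Q Plo Phi q (embed_pmf g)"
    unfolding feasible_def
  proof
    show "set_pmf (embed_pmf g) \<subseteq> Q"
    proof
      fix q' assume "q' \<in> set_pmf (embed_pmf g)"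
      then show "q' \<in> Q" using gout[of q'] by (auto simp: set_pmf_iff pmf)
    qed
    show "\<forall>q'\<in>Q. Plo q q' \<le> pmf (embed_pmf g) q' \<and> pmf (embed_pmf g) q' \<le> Phi q q'"
      using gin by (simp add: pmf)
  qed
  then show ?thesis
    by (intro exI[of _ "embed_pmf g"]) (simp add: E pmf g(2) K)
qed

section \<open>Comparison of the chain with its abstraction\<close>

text \<open>Nonnegative factors allow inequalities between remaining values to be multiplied, which
  the product criterion requires.\<close>

lemma stage_mono:
  assumes "0 \<le> \<gamma>" "0 \<le> a" "a \<le> b"
  shows "0 \<le> stage_gain crit \<gamma> N i a" "stage_gain crit \<gamma> N i a \<le> stage_gain crit \<gamma> N i b"
    and "0 \<le> stage_factor crit a" "stage_factor crit a \<le> stage_factor crit b"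
  using assms by (cases crit; auto simp: mult_left_mono divide_right_mono)+

lemma terminal_gain_nonneg: "0 \<le> terminal_gain crit"
  by (cases crit) auto

text \<open>The carrier \<open>A\<close> lets one statement serve both the IMC, with its state set,
  and the chain, with its state space.\<close>

lemma reward_to_go_nonneg:
  assumes "0 \<le> \<gamma>" and r: "\<And>z. z \<in> A \<Longrightarrow> 0 \<le> r z"
    and E: "\<And>f z. (\<And>z. z \<in> A \<Longrightarrow> 0 \<le> f z) \<Longrightarrow> z \<in> A \<Longrightarrow> 0 \<le> E f z"
    and "y \<in> A"
  shows "0 \<le> reward_to_go crit \<gamma> N r E n i y"
  using \<open>y \<in> A\<close>
proof (induction n arbitrary: i y)
  case 0
  then show ?case
    using stage_mono[OF \<open>0 \<le> \<gamma>\<close> r order_refl] by (simp add: terminal_gain_nonneg)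
next
  case (Suc n)
  have "0 \<le> E (reward_to_go crit \<gamma> N r E n (Suc i)) y" by (rule E) (use Suc in auto)
  then show ?case
    using Suc.prems stage_mono[OF \<open>0 \<le> \<gamma>\<close> r order_refl] by simp
qed

text \<open>A coupling of \<open>\<kappa> y\<close> and \<open>p\<close> supported on the abstraction relation \<open>z \<in> D q\<close> is recorded only
  through the comparison of expectations that it yields.\<close>

definition couples ::
  "'y measure \<Rightarrow> ('y \<Rightarrow> 'y measure) \<Rightarrow> 'q set \<Rightarrow> ('q \<Rightarrow> 'y set) \<Rightarrow> 'y \<Rightarrow> 'q pmf \<Rightarrow> bool" where
  "couples S \<kappa> Q D y p \<longleftrightarrow> (\<forall>U V. bounded_measurable S V \<longrightarrow>
     (\<forall>q\<in>Q. \<forall>z\<in>D q. U q \<le> V z) \<longrightarrow> measure_pmf.expectation p U \<le> (\<integral>z. V z \<partial>\<kappa> y))"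

text \<open>The induction hypothesis says that the abstract value lies below the concrete one on
  related states. The coupled distribution \<open>p\<close> transports this through one expectation,
  and the selector does at least as well as \<open>p\<close>. Nonnegativity of the smaller, abstract
  value permits multiplication by the stage factors.\<close>

lemma reward_to_go_abstraction_lower:
  assumes \<kappa>: "\<kappa> \<in> measurable S (prob_algebra S)" and r: "bounded_measurable S r" and "0 \<le> \<gamma>"
    and sel: "\<And>f q. q \<in> Q \<Longrightarrow> set_pmf (sel f q) \<subseteq> Q"
    and couple: "\<And>q y. q \<in> Q \<Longrightarrow> y \<in> D q \<Longrightarrow> \<exists>p. F q p \<and> couples S \<kappa> Q D y p"
    and min: "\<And>f q p. q \<in> Q \<Longrightarrow> F q p \<Longrightarrow> measure_pmf.expectation (sel f q) f \<le> measure_pmf.expectation p f"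
    and r': "\<And>q y. q \<in> Q \<Longrightarrow> y \<in> D q \<Longrightarrow> r' q \<le> r y" "\<And>q. q \<in> Q \<Longrightarrow> 0 \<le> r' q"
    and "q \<in> Q" "y \<in> D q"
  defines "E \<equiv> \<lambda>f q. measure_pmf.expectation (sel f q) f"
  shows "reward_to_go crit \<gamma> N r' E n i q \<le> reward_to_go crit \<gamma> N r (\<lambda>f y. \<integral>z. f z \<partial>\<kappa> y) n i y"
  using \<open>q \<in> Q\<close> \<open>y \<in> D q\<close>
proof (induction n arbitrary: i q y)
  case 0
  then show ?case
    using stage_mono[OF \<open>0 \<le> \<gamma>\<close> r'(2)[OF 0(1)] r'(1)[OF 0]]
    by (auto intro!: add_mono mult_right_mono simp: terminal_gain_nonneg)
next
  case (Suc n)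
  let ?U = "reward_to_go crit \<gamma> N r' E n (Suc i)"
  let ?V = "reward_to_go crit \<gamma> N r (\<lambda>f y. \<integral>z. f z \<partial>\<kappa> y) n (Suc i)"
  note rr = \<open>0 \<le> \<gamma>\<close> r'(2)[OF Suc.prems(1)] r'(1)[OF Suc.prems]
  note mono = stage_mono(1,2)[OF rr, of crit N i] stage_mono(3,4)[OF rr, of crit]
  obtain p where p: "F q p" "couples S \<kappa> Q D y p" using couple[OF Suc.prems] by blast
  have "E ?U q \<le> measure_pmf.expectation p ?U"
    unfolding E_def by (rule min[OF Suc.prems(1) p(1)])
  also have "\<dots> \<le> (\<integral>z. ?V z \<partial>\<kappa> y)"
    using p(2) bounded_measurable_reward_to_go[OF \<kappa> r] Suc.IH unfolding couples_def by blast
  finally have step: "E ?U q \<le> (\<integral>z. ?V z \<partial>\<kappa> y)" .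
  have E_nonneg: "0 \<le> E f z" if "\<And>z. z \<in> Q \<Longrightarrow> 0 \<le> f z" "z \<in> Q" for f z
    unfolding E_def using sel[OF that(2)] that(1) by (intro integral_nonneg_AE) (auto simp: AE_measure_pmf_iff)
  have "0 \<le> E ?U q"
    by (rule E_nonneg[OF reward_to_go_nonneg[OF \<open>0 \<le> \<gamma>\<close> r'(2) E_nonneg] Suc.prems(1)])
  moreover have "0 \<le> stage_factor crit (r y)" using mono by linarith
  ultimately show ?case
    using mono step by (auto intro!: add_mono mult_mono)
qed

text \<open>Here the concrete value is the smaller one, so its nonnegativity is required; this is
  why the related points must lie in the state space.\<close>

lemma reward_to_go_abstraction_upper:
  assumes \<kappa>: "\<kappa> \<in> measurable S (prob_algebra S)" and r: "bounded_measurable S r" and "0 \<le> \<gamma>"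
    and couple: "\<And>q y. q \<in> Q \<Longrightarrow> y \<in> D q \<Longrightarrow> \<exists>p. F q p \<and> couples S \<kappa> Q D y p"
    and max: "\<And>f q p. q \<in> Q \<Longrightarrow> F q p \<Longrightarrow> measure_pmf.expectation p f \<le> measure_pmf.expectation (sel f q) f"
    and r': "\<And>q y. q \<in> Q \<Longrightarrow> y \<in> D q \<Longrightarrow> r y \<le> r' q" "\<And>y. y \<in> space S \<Longrightarrow> 0 \<le> r y"
    and D: "\<And>q. q \<in> Q \<Longrightarrow> D q \<subseteq> space S"
    and "q \<in> Q" "y \<in> D q"
  defines "E \<equiv> \<lambda>f q. measure_pmf.expectation (sel f q) f"
  shows "reward_to_go crit \<gamma> N r (\<lambda>f y. \<integral>z. f z \<partial>\<kappa> y) n i y \<le> reward_to_go crit \<gamma> N r' E n i q"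
  using \<open>q \<in> Q\<close> \<open>y \<in> D q\<close>
proof (induction n arbitrary: i q y)
  case 0
  have y: "y \<in> space S" using D 0 by blast
  show ?case
    using stage_mono[OF \<open>0 \<le> \<gamma>\<close> r'(2)[OF y] r'(1)[OF 0]]
    by (auto intro!: add_mono mult_right_mono simp: terminal_gain_nonneg)
next
  case (Suc n)
  let ?U = "reward_to_go crit \<gamma> N r' E n (Suc i)"
  let ?E = "\<lambda>(f :: _ \<Rightarrow> real) y. \<integral>z. f z \<partial>\<kappa> y"
  let ?V = "reward_to_go crit \<gamma> N r ?E n (Suc i)"
  have y: "y \<in> space S" using D Suc.prems by blast
  note rr = \<open>0 \<le> \<gamma>\<close> r'(2)[OF y] r'(1)[OF Suc.prems]
  note mono = stage_mono(1,2)[OF rr, of crit N i] stage_mono(3,4)[OF rr, of crit]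
  obtain p where p: "F q p" "couples S \<kappa> Q D y p" using couple[OF Suc.prems] by blast
  \<comment> \<open>\<open>couples\<close> compares in one direction; the other is its instance for
    the negated functions.\<close>
  have "bounded_measurable S (\<lambda>z. (-1) * ?V z)"
    by (intro bounded_measurable_mult bounded_measurable_const bounded_measurable_reward_to_go[OF \<kappa> r])
  then have neg: "bounded_measurable S (\<lambda>z. - ?V z)" by simp
  have "measure_pmf.expectation p (\<lambda>q. - ?U q) \<le> (\<integral>z. - ?V z \<partial>\<kappa> y)"
    using p(2) neg Suc.IH unfolding couples_def by (metis (no_types, lifting) neg_le_iff_le)
  then have "?E ?V y \<le> measure_pmf.expectation p ?U" by simp
  also have "\<dots> \<le> E ?U q"
    unfolding E_def by (rule max[OF Suc.prems(1) p(1)])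
  finally have step: "?E ?V y \<le> E ?U q" .
  have E_nonneg: "0 \<le> ?E f z" if f: "\<And>z. z \<in> space S \<Longrightarrow> 0 \<le> f z" and "z \<in> space S" for f :: "_ \<Rightarrow> real" and z
  proof -
    have "sets (\<kappa> z) = sets S" using measurable_space[OF \<kappa> that(2)] by (simp add: space_prob_algebra)
    then have "space (\<kappa> z) = space S" by (rule sets_eq_imp_space_eq)
    then show ?thesis by (intro integral_nonneg_AE AE_I2) (simp add: f)
  qed
  have "0 \<le> ?E ?V y"
    by (rule E_nonneg[OF reward_to_go_nonneg[where A = "space S", OF \<open>0 \<le> \<gamma>\<close> r'(2) E_nonneg] y])
  moreover have "0 \<le> stage_factor crit (r' q)" using mono by linarith
  ultimately show ?case
    using mono step by (auto intro!: add_mono mult_mono)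
qed

text \<open>The masses of the blocks form the distribution. The simple function with value
  \<open>U q\<close> on block \<open>q\<close> integrates to the expectation of \<open>U\<close> and
  lies below \<open>V\<close> almost everywhere.\<close>

lemma partition_pmf:
  assumes "prob_space P" and Q: "finite Q" and B: "\<And>q. q \<in> Q \<Longrightarrow> B q \<in> sets P"
    and part: "AE z in P. \<exists>!q. q \<in> Q \<and> z \<in> B q"
  obtains p where "set_pmf p \<subseteq> Q" "\<And>q. q \<in> Q \<Longrightarrow> pmf p q = measure P (B q)"
    "\<And>(U :: _ \<Rightarrow> real) V. integrable P V \<Longrightarrow> (\<And>q. q \<in> Q \<Longrightarrow> AE z in P. z \<in> B q \<longrightarrow> U q \<le> V z) \<Longrightarrow>
       measure_pmf.expectation p U \<le> (\<integral>z. V z \<partial>P)"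
proof -
  interpret prob_space P by fact
  have int: "integrable P (\<lambda>z. \<Sum>q\<in>Q. U q * indicator (B q) z :: real)" for U
    by (intro Bochner_Integration.integrable_sum integrable_mult_right integrable_real_indicator B)
       (auto simp: emeasure_eq_measure)
  have "(\<integral>z. (\<Sum>q\<in>Q. U q * indicator (B q) z) \<partial>P) = (\<Sum>q\<in>Q. \<integral>z. U q * indicator (B q) z \<partial>P)" for U :: "_ \<Rightarrow> real"
    by (intro Bochner_Integration.integral_sum integrable_mult_right integrable_real_indicator B)
       (auto simp: emeasure_eq_measure)
  then have sum: "(\<integral>z. (\<Sum>q\<in>Q. U q * indicator (B q) z) \<partial>P) = (\<Sum>q\<in>Q. U q * measure P (B q))" for U :: "_ \<Rightarrow> real"
    using B sets.sets_into_space by (simp add: Int_absorb2 Int_commute cong: sum.cong)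
  \<comment> \<open>The quantifier over \<open>U\<close> stands inside \<open>AE\<close>, so one
    null set serves the constant 1, which gives total mass 1, as well as the function to be
    compared.\<close>
  have pt: "AE z in P. \<exists>q\<in>Q. z \<in> B q \<and> (\<forall>U. (\<Sum>q\<in>Q. U q * indicator (B q) z) = (U q :: real))"
    using part
  proof eventually_elim
    case (elim z)
    then obtain q where q: "q \<in> Q" "z \<in> B q" and other: "\<And>q'. q' \<in> Q \<Longrightarrow> q' \<noteq> q \<Longrightarrow> z \<notin> B q'" by blast
    have "(\<Sum>q'\<in>Q. U q' * indicator (B q') z) = (\<Sum>q'\<in>Q. if q' = q then U q' else 0)" for U :: "_ \<Rightarrow> real"
      by (rule sum.cong[OF refl]) (use q other in \<open>simp add: indicator_def\<close>)
    then have "(\<Sum>q'\<in>Q. U q' * indicator (B q') z) = U q" for U :: "_ \<Rightarrow> real"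
      using q(1) Q by simp
    then show ?case using q by blast
  qed
  have one: "(\<Sum>q\<in>Q. measure P (B q)) = 1"
  proof -
    have "AE z in P. (\<Sum>q\<in>Q. 1 * indicator (B q) z) = (1::real)"
      using pt
    proof eventually_elim
      case (elim z)
      then obtain q where "\<forall>U. (\<Sum>q\<in>Q. U q * indicator (B q) z) = (U q :: real)" by blast
      from spec[OF this, of "\<lambda>_. 1"] show ?case .
    qed
    then have "(\<integral>z. (\<Sum>q\<in>Q. 1 * indicator (B q) z) \<partial>P) = (\<integral>z. (1::real) \<partial>P)"
      by (intro integral_cong_AE borel_measurable_integrable[OF int]) auto
    then show ?thesis using sum[of "\<lambda>_. 1"] by (simp add: prob_space)
  qed
  define g where "g q = (if q \<in> Q then measure P (B q) else 0)" for q
  have "(\<integral>\<^sup>+ q. ennreal (g q) \<partial>count_space UNIV) = (\<Sum>q\<in>Q. ennreal (g q))"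
    by (intro nn_integral_count_space'[OF Q]) (auto simp: g_def)
  also have "\<dots> = ennreal (\<Sum>q\<in>Q. g q)" by (simp add: g_def)
  also have "(\<Sum>q\<in>Q. g q) = 1" using one by (simp add: g_def)
  finally have pmf: "pmf (embed_pmf g) q = g q" for q
    by (intro pmf_embed_pmf) (auto simp: g_def)
  have supp: "set_pmf (embed_pmf g) \<subseteq> Q"
    by (auto simp: set_pmf_iff pmf g_def split: if_splits)
  show thesis
  proof (rule that[OF supp])
    show "pmf (embed_pmf g) q = measure P (B q)" if "q \<in> Q" for q using that by (simp add: pmf g_def)
    fix U :: "_ \<Rightarrow> real" and V :: "_ \<Rightarrow> real"
    assume V: "integrable P V" and le: "\<And>q. q \<in> Q \<Longrightarrow> AE z in P. z \<in> B q \<longrightarrow> U q \<le> V z"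
    have "measure_pmf.expectation (embed_pmf g) U = (\<Sum>q\<in>Q. U q * g q)"
      using supp by (subst integral_measure_pmf_real[OF Q]) (auto simp: pmf)
    also have "\<dots> = (\<integral>z. (\<Sum>q\<in>Q. U q * indicator (B q) z) \<partial>P)"
      by (simp add: sum g_def)
    also have "\<dots> \<le> (\<integral>z. V z \<partial>P)"
    proof (rule integral_mono_AE[OF int V])
      have "AE z in P. \<forall>q\<in>Q. z \<in> B q \<longrightarrow> U q \<le> V z" using le Q by (simp add: AE_finite_all)
      with pt show "AE z in P. (\<Sum>q\<in>Q. U q * indicator (B q) z) \<le> V z"
        by eventually_elim force
    qed
    finally show "measure_pmf.expectation (embed_pmf g) U \<le> (\<integral>z. V z \<partial>P)" .
  qed
qed

lemma trans_prob_bounds: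
  assumes "prob_space M"
  shows "0 \<le> trans_prob M \<zeta> \<epsilon> kbar x S s" "trans_prob M \<zeta> \<epsilon> kbar x S s \<le> 1"
  using assms by (auto simp: trans_prob_def prob_space.prob_le_1)

text \<open>Probabilities are bounded, so each \<open>INF\<close> and \<open>SUP\<close> encloses
  the value at \<open>x\<close>. For absorption the extremes are taken separately for every
  \<open>s\<close>, so the enclosures add up termwise.\<close>

lemma abstracts_cell:
  assumes "prob_space M" and abs: "abstracts M \<zeta> \<epsilon> kbar X cells Plo Phi"
    and C: "C \<in> cells" "k \<le> kbar" "x \<in> C"
  shows "S \<in> cells \<Longrightarrow> s \<le> kbar \<Longrightarrow>
      Plo (Cell C k) (Cell S s) \<le> trans_prob M \<zeta> \<epsilon> kbar x S s \<and> trans_prob M \<zeta> \<epsilon> kbar x S s \<le> Phi (Cell C k) (Cell S s)"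
    and "Plo (Cell C k) Absorb \<le> (\<Sum>s=0..kbar. trans_prob M \<zeta> \<epsilon> kbar x (- X) s) \<and>
      (\<Sum>s=0..kbar. trans_prob M \<zeta> \<epsilon> kbar x (- X) s) \<le> Phi (Cell C k) Absorb"
proof -
  have below: "bdd_below ((\<lambda>x. trans_prob M \<zeta> \<epsilon> kbar x S s) ` C)" and above: "bdd_above ((\<lambda>x. trans_prob M \<zeta> \<epsilon> kbar x S s) ` C)" for S s
    using trans_prob_bounds[OF assms(1)] by (auto intro!: bdd_belowI2 bdd_aboveI2)
  note inf = cINF_lower[OF below C(3)] and sup = cSUP_upper[OF C(3) above]
  show "S \<in> cells \<Longrightarrow> s \<le> kbar \<Longrightarrow>
      Plo (Cell C k) (Cell S s) \<le> trans_prob M \<zeta> \<epsilon> kbar x S s \<and> trans_prob M \<zeta> \<epsilon> kbar x S s \<le> Phi (Cell C k) (Cell S s)"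
    using abs C(1,2) inf[of S s] sup[of S s] unfolding abstracts_def by (meson atLeastAtMost_iff le0 order_trans)
  have "Plo (Cell C k) Absorb \<le> (\<Sum>s=0..kbar. INF x\<in>C. trans_prob M \<zeta> \<epsilon> kbar x (- X) s)"
    "(\<Sum>s=0..kbar. SUP x\<in>C. trans_prob M \<zeta> \<epsilon> kbar x (- X) s) \<le> Phi (Cell C k) Absorb"
    using abs C(1,2) unfolding abstracts_def by auto
  then show "Plo (Cell C k) Absorb \<le> (\<Sum>s=0..kbar. trans_prob M \<zeta> \<epsilon> kbar x (- X) s) \<and>
      (\<Sum>s=0..kbar. trans_prob M \<zeta> \<epsilon> kbar x (- X) s) \<le> Phi (Cell C k) Absorb"
    using sum_mono[of "{0..kbar}", OF inf] sum_mono[of "{0..kbar}", OF sup] by (meson order_trans)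
qed

lemma denotation_sets:
  assumes "\<forall>S\<in>cells. S \<noteq> {} \<and> compact S" and "compact X" and "q \<in> imc_states cells kbar"
  shows "denotation X kbar q \<in> sets (sample_space kbar :: ((real^'n) \<times> nat) measure)"
  using assms unfolding sample_space_def
  by (cases q) (auto simp: imc_states_def intro!: pair_measureI borel_compact borel_comp)

text \<open>Transferring an almost sure statement to an image measure requires a measurable set.
  Unique existence over the finite state set is the union of the denotations, each without all the
  others.\<close>

lemma unique_denotation_sets:
  assumes "finite cells" and cells: "\<forall>S\<in>cells. S \<noteq> {} \<and> compact S" and X: "compact X"
  shows "{z \<in> space (sample_space kbar). 1 \<le> snd z \<and> (\<exists>!q. q \<in> imc_states cells kbar \<and> z \<in> denotation X kbar q)}
    \<in> sets (sample_space kbar :: ((real^'n) \<times> nat) measure)"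
proof -
  let ?S = "sample_space kbar :: ((real^'n) \<times> nat) measure"
  let ?Q = "imc_states cells kbar" and ?d = "denotation X kbar"
  note d = denotation_sets[OF cells X]
  have "imc_states cells kbar = (\<lambda>(S, s). Cell S s) ` (cells \<times> {0..kbar}) \<union> {Absorb}"
    by (auto simp: imc_states_def)
  then have fin: "finite ?Q" using assms(1) by simp
  have "(UNIV :: (real^'n) set) \<times> {1..kbar} \<in> sets ?S"
    unfolding sample_space_def by (intro pair_measureI) auto
  moreover have "(\<Union>q\<in>?Q. ?d q - (\<Union>q'\<in>?Q - {q}. ?d q')) \<in> sets ?S"
    using fin d by (intro sets.finite_UN sets.Diff) auto
  moreover have "{z \<in> space ?S. 1 \<le> snd z \<and> (\<exists>!q. q \<in> ?Q \<and> z \<in> ?d q)}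
      = (\<Union>q\<in>?Q. ?d q - (\<Union>q'\<in>?Q - {q}. ?d q')) \<inter> (UNIV \<times> {1..kbar})" (is "?L = ?R")
  proof (rule set_eqI)
    fix z :: "(real^'n) \<times> nat"
    have "z \<in> ?L \<longleftrightarrow> (\<exists>!q. q \<in> ?Q \<and> z \<in> ?d q) \<and> z \<in> UNIV \<times> {1..kbar}"
      by (cases z) (auto simp: sample_space_def space_pair_measure)
    also have "(\<exists>!q. q \<in> ?Q \<and> z \<in> ?d q) \<longleftrightarrow> z \<in> (\<Union>q\<in>?Q. ?d q - (\<Union>q'\<in>?Q - {q}. ?d q'))"
      unfolding UN_iff Diff_iff by blast
    finally show "z \<in> ?L \<longleftrightarrow> z \<in> ?R" by (simp only: Int_iff)
  qed
  ultimately show ?thesis by (simp only: sets.Int)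
qed

text \<open>Cells with different times have disjoint denotations, and those with the same time meet
  only in overlaps. Existence holds for every sample; only uniqueness is almost sure.\<close>

lemma sample_kernel_partition:
  fixes A :: "real^'n^'n" and Bw :: "real^'d^'n" and M :: "'w measure"
  assumes ctrl: "controllable A Bw" and W: "wiener_process M W" and sol: "solves_sde M W A B K Bw \<zeta>"
    and "\<epsilon> > 0" "kbar \<ge> 1" and fin: "finite cells" and Xc: "compact X" and X: "X = \<Union>cells"
    and cells: "\<forall>S\<in>cells. S \<noteq> {} \<and> compact S"
    and overlap: "\<forall>S\<in>cells. \<forall>T\<in>cells. S \<noteq> T \<longrightarrow> S \<inter> T \<in> null_sets lborel"
  shows "AE z in sample_kernel M \<zeta> \<epsilon> kbar y. 1 \<le> snd z \<and> (\<exists>!q. q \<in> imc_states cells kbar \<and> z \<in> denotation X kbar q)"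
proof -
  interpret prob_space M using W by (simp add: wiener_process_def)
  have meas: "\<zeta> t x \<in> borel_measurable M" if "t \<ge> 0" for t x
    using sol that by (simp add: solves_sde_def)
  let ?x = "fst y"
  let ?tau = "intersampling_time \<zeta> \<epsilon> kbar ?x"
  \<comment> \<open>The intersampling time is random but has finitely many values, so avoiding the
    overlaps at each fixed positive time is enough.\<close>
  have "AE \<omega> in M. \<forall>S\<in>cells. \<forall>T\<in>cells. \<forall>s\<in>{1..kbar}. S \<noteq> T \<longrightarrow> \<zeta> (real s) ?x \<omega> \<notin> S \<inter> T"
  proof (intro AE_finite_allI fin finite_atLeastAtMost)
    fix S T s assume S: "S \<in> cells" and T: "T \<in> cells" and s: "s \<in> {1..kbar}"
    show "AE \<omega> in M. S \<noteq> T \<longrightarrow> \<zeta> (real s) ?x \<omega> \<notin> S \<inter> T"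
    proof (cases "S = T")
      case False
      have "compact S" using cells S by simp
      then have ST: "S \<inter> T \<in> null_sets lborel" "bounded (S \<inter> T)"
        using overlap S T False bounded_subset[OF compact_imp_bounded Int_lower1] by simp_all
      have z: "\<zeta> (real s) ?x \<in> borel_measurable M" by (rule meas) simp
      have "{\<omega> \<in> space M. \<zeta> (real s) ?x \<omega> \<in> S \<inter> T} \<in> sets M"
        using measurable_sets[OF z, of "S \<inter> T"] ST(1) by (auto simp: vimage_def Int_def conj_commute)
      moreover have "prob {\<omega> \<in> space M. \<zeta> (real s) ?x \<omega> \<in> S \<inter> T} = 0"
        by (rule solves_sde_null_set[OF ctrl W sol _ ST]) (use s in simp)
      ultimately have "AE \<omega> in M. \<zeta> (real s) ?x \<omega> \<notin> S \<inter> T"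
        by (subst AE_iff_measurable[OF _ refl]) (auto simp: emeasure_eq_measure)
      then show ?thesis by simp
    qed simp
  qed
  then have ae: "AE \<omega> in M. 1 \<le> ?tau \<omega> \<and> (\<exists>!q. q \<in> imc_states cells kbar \<and> (\<zeta> (real (?tau \<omega>)) ?x \<omega>, ?tau \<omega>) \<in> denotation X kbar q)"
    using intersampling_time_pos[OF sol \<open>\<epsilon> > 0\<close> \<open>kbar \<ge> 1\<close>, of ?x]
  proof eventually_elim
    case (elim \<omega>)
    have le: "?tau \<omega> \<le> kbar" by (rule intersampling_time_le)
    let ?z = "\<zeta> (real (?tau \<omega>)) ?x \<omega>"
    have "\<exists>!q. q \<in> imc_states cells kbar \<and> (?z, ?tau \<omega>) \<in> denotation X kbar q"
    proof (cases "?z \<in> X")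
      case True
      then obtain S where S: "S \<in> cells" "?z \<in> S" using X by blast
      show ?thesis
      proof (rule ex1I[of _ "Cell S (?tau \<omega>)"])
        show "Cell S (?tau \<omega>) \<in> imc_states cells kbar \<and> (?z, ?tau \<omega>) \<in> denotation X kbar (Cell S (?tau \<omega>))"
          using S le by (auto simp: imc_states_def)
        fix q assume q: "q \<in> imc_states cells kbar \<and> (?z, ?tau \<omega>) \<in> denotation X kbar q"
        show "q = Cell S (?tau \<omega>)"
        proof (cases q)
          case (Cell T s)
          then have T: "T \<in> cells" "?z \<in> T" "s = ?tau \<omega>" using q by (auto simp: imc_states_def)
          have "T = S"
          proof (rule ccontr)
            assume "T \<noteq> S"
            moreover have "?tau \<omega> \<in> {1..kbar}" using elim(2) le by simp
            ultimately have "?z \<notin> T \<inter> S" using elim(1) T(1) S(1) by blast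
            then show False using T(2) S(2) by blast
          qed
          then show ?thesis using Cell T by simp
        qed (use q True in auto)
      qed
    next
      case False
      show ?thesis
      proof (rule ex1I[of _ Absorb])
        show "Absorb \<in> imc_states cells kbar \<and> (?z, ?tau \<omega>) \<in> denotation X kbar Absorb"
          using False le by (auto simp: imc_states_def)
        fix q assume q: "q \<in> imc_states cells kbar \<and> (?z, ?tau \<omega>) \<in> denotation X kbar q"
        then show "q = Absorb" using False X by (cases q) (auto simp: imc_states_def)
      qed
    qed
    then show ?case using elim(2) by simp
  qed
  have "(\<lambda>\<omega>. let s' = ?tau \<omega> in (\<zeta> (real s') ?x \<omega>, s')) \<in> measurable M (sample_space kbar)"
    by (rule measurable_sample) (rule meas)
  then show ?thesis
    unfolding sample_kernel_def AE_distr_iff[OF \<open>_ \<in> measurable M (sample_space kbar)\<close> unique_denotation_sets[OF fin cells Xc]]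
    using ae by (simp add: Let_def)
qed

text \<open>From a cell, the block masses of the kernel form a feasible distribution. From the
  absorbing state, feasibility forces the point mass there, wherever the chain goes; the coupling
  survives because almost every next sample lies in the reward domain of \<open>Absorb\<close>, even
  one inside \<open>X\<close>.\<close>

lemma sample_kernel_coupling:
  fixes A :: "real^'n^'n" and Bw :: "real^'d^'n" and M :: "'w measure"
  assumes ctrl: "controllable A Bw" and W: "wiener_process M W" and sol: "solves_sde M W A B K Bw \<zeta>"
    and "\<epsilon> > 0" "kbar \<ge> 1" and fin: "finite cells" and X: "compact X" "X = \<Union>cells"
    and cells: "\<forall>S\<in>cells. S \<noteq> {} \<and> compact S"
    and overlap: "\<forall>S\<in>cells. \<forall>T\<in>cells. S \<noteq> T \<longrightarrow> S \<inter> T \<in> null_sets lborel"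
    and imc: "is_imc (imc_states cells kbar) Plo Phi" and abs: "abstracts M \<zeta> \<epsilon> kbar X cells Plo Phi"
    and q: "q \<in> imc_states cells kbar" and y: "y \<in> reward_domain kbar q"
  shows "\<exists>p. feasible (imc_states cells kbar) Plo Phi q p \<and>
    couples (sample_space kbar) (sample_kernel M \<zeta> \<epsilon> kbar) (imc_states cells kbar) (reward_domain kbar) y p"
proof -
  let ?Q = "imc_states cells kbar"
  let ?S = "sample_space kbar :: ((real^'n) \<times> nat) measure"
  let ?\<kappa> = "sample_kernel M \<zeta> \<epsilon> kbar"
  interpret prob_space M using W by (simp add: wiener_process_def)
  have meas: "\<zeta> t x \<in> borel_measurable M" if "t \<ge> 0" for t x
    using sol that by (simp add: solves_sde_def)
  have \<kappa>: "?\<kappa> \<in> measurable ?S (prob_algebra ?S)" by (rule sample_kernel_measurable[OF W sol])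
  have "y \<in> space ?S" using q y
    by (cases q) (auto simp: imc_states_def sample_space_def space_pair_measure)
  then have k: "prob_space (?\<kappa> y)" "sets (?\<kappa> y) = sets ?S"
    using measurable_space[OF \<kappa>] by (auto simp: space_prob_algebra)
  interpret k: prob_space "?\<kappa> y" by (rule k)
  have sp: "space (?\<kappa> y) = space ?S" by (rule sets_eq_imp_space_eq[OF k(2)])
  have part: "AE z in ?\<kappa> y. 1 \<le> snd z \<and> (\<exists>!q. q \<in> ?Q \<and> z \<in> denotation X kbar q)"
    by (rule sample_kernel_partition[OF ctrl W sol \<open>\<epsilon> > 0\<close> \<open>kbar \<ge> 1\<close> fin X cells overlap])
  have finQ: "finite ?Q" using imc by (simp add: is_imc_def)
  \<comment> \<open>For cells the two sets coincide; for \<open>Absorb\<close> the time 0 has to be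
    excluded, which holds almost surely.\<close>
  have dom: "AE z in ?\<kappa> y. z \<in> denotation X kbar q' \<longrightarrow> z \<in> reward_domain kbar q'" if "q' \<in> ?Q" for q'
    using part by eventually_elim (use that in \<open>cases q'; auto\<close>)
  show ?thesis
  proof (cases q)
    case Absorb
    have "feasible ?Q Plo Phi q (return_pmf Absorb)"
      using abs Absorb by (auto simp: feasible_def abstracts_def imc_states_def)
    moreover have "couples ?S ?\<kappa> ?Q (reward_domain kbar) y (return_pmf Absorb)"
      unfolding couples_def
    proof (intro allI impI)
      fix U and V :: "(real^'n) \<times> nat \<Rightarrow> real"
      assume V: "bounded_measurable ?S V" and le: "\<forall>q\<in>?Q. \<forall>z\<in>reward_domain kbar q. U q \<le> V z"
      have "(\<integral>z. U Absorb \<partial>?\<kappa> y) \<le> (\<integral>z. V z \<partial>?\<kappa> y)"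
      proof (rule integral_mono_AE[OF _ bounded_measurable_integrable[OF k V]])
        have "AE z in ?\<kappa> y. z \<in> space ?S" using AE_space[of "?\<kappa> y"] by (simp add: sp)
        with part show "AE z in ?\<kappa> y. U Absorb \<le> V z"
        proof eventually_elim
          case (elim z)
          then have "z \<in> reward_domain kbar Absorb"
            by (cases z) (auto simp: sample_space_def space_pair_measure)
          then show ?case using le by (auto simp: imc_states_def)
        qed
      qed simp
      then show "measure_pmf.expectation (return_pmf Absorb) U \<le> (\<integral>z. V z \<partial>?\<kappa> y)"
        by (simp add: k.prob_space)
    qed
    ultimately show ?thesis by blast
  next
    case (Cell C i)
    then have C: "C \<in> cells" "i \<le> kbar" "fst y \<in> C" using q y by (auto simp: imc_states_def)
    have B: "denotation X kbar q' \<in> sets (?\<kappa> y)" if "q' \<in> ?Q" for q'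
      using denotation_sets[OF cells X(1) that] k(2) by simp
    have part': "AE z in ?\<kappa> y. \<exists>!q. q \<in> ?Q \<and> z \<in> denotation X kbar q" using part by eventually_elim simp
    obtain p where p: "set_pmf p \<subseteq> ?Q" "\<And>q. q \<in> ?Q \<Longrightarrow> pmf p q = measure (?\<kappa> y) (denotation X kbar q)"
      "\<And>(U :: _ \<Rightarrow> real) V. integrable (?\<kappa> y) V \<Longrightarrow> (\<And>q. q \<in> ?Q \<Longrightarrow> AE z in ?\<kappa> y. z \<in> denotation X kbar q \<longrightarrow> U q \<le> V z) \<Longrightarrow>
         measure_pmf.expectation p U \<le> (\<integral>z. V z \<partial>?\<kappa> y)"
      using partition_pmf[OF k(1) finQ B part'] by blast
    have Xs: "X \<in> sets borel" using X(1) by (rule borel_compact)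
    have val: "measure (?\<kappa> y) (S \<times> {s}) = trans_prob M \<zeta> \<epsilon> kbar (fst y) S s" if "S \<in> sets borel" "s \<le> kbar" for S s
      using measure_sample_kernel[of \<zeta> "fst y" M S s kbar \<epsilon> "snd y"] meas that by simp
    have valA: "measure (?\<kappa> y) ((- X) \<times> {0..kbar}) = (\<Sum>s=0..kbar. trans_prob M \<zeta> \<epsilon> kbar (fst y) (- X) s)"
    proof -
      have eq: "(- X) \<times> {0..kbar} = (\<Union>s\<in>{0..kbar}. (- X) \<times> {s})" by auto
      have mem: "(- X) \<times> {s} \<in> sets (?\<kappa> y)" if "s \<le> kbar" for s
        unfolding k(2) sample_space_def using that Xs by (intro pair_measureI) auto
      have "measure (?\<kappa> y) ((- X) \<times> {0..kbar}) = (\<Sum>s=0..kbar. measure (?\<kappa> y) ((- X) \<times> {s}))"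
        unfolding eq by (rule k.finite_measure_finite_Union) (auto simp: disjoint_family_on_def intro: mem)
      also have "\<dots> = (\<Sum>s=0..kbar. trans_prob M \<zeta> \<epsilon> kbar (fst y) (- X) s)"
        using Xs by (intro sum.cong refl val) auto
      finally show ?thesis .
    qed
    have "feasible ?Q Plo Phi q p"
      unfolding feasible_def
    proof (intro conjI ballI p(1))
      fix q' assume q': "q' \<in> ?Q"
      note ac = abstracts_cell[OF prob_space_axioms abs C]
      have "Plo q q' \<le> measure (?\<kappa> y) (denotation X kbar q') \<and> measure (?\<kappa> y) (denotation X kbar q') \<le> Phi q q'"
      proof (cases q')
        case (Cell S s)
        then have S: "S \<in> cells" "s \<le> kbar" using q' by (auto simp: imc_states_def)
        then have "S \<in> sets borel" using cells by (auto intro: borel_compact)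
        then show ?thesis using ac(1)[OF S] S(2) by (simp add: Cell \<open>q = Cell C i\<close> val)
      next
        case Absorb
        then show ?thesis using ac(2) by (simp add: \<open>q = Cell C i\<close> valA)
      qed
      then show "Plo q q' \<le> pmf p q'" "pmf p q' \<le> Phi q q'" by (simp_all add: p(2)[OF q'])
    qed
    moreover have "couples ?S ?\<kappa> ?Q (reward_domain kbar) y p"
      unfolding couples_def
    proof (intro allI impI)
      fix U and V :: "(real^'n) \<times> nat \<Rightarrow> real"
      assume V: "bounded_measurable ?S V" and le: "\<forall>q\<in>?Q. \<forall>z\<in>reward_domain kbar q. U q \<le> V z"
      show "measure_pmf.expectation p U \<le> (\<integral>z. V z \<partial>?\<kappa> y)"
      proof (rule p(3)[OF bounded_measurable_integrable[OF k V]])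
        fix q' assume q': "q' \<in> ?Q"
        show "AE z in ?\<kappa> y. z \<in> denotation X kbar q' \<longrightarrow> U q' \<le> V z"
          using dom[OF q'] by eventually_elim (use le q' in blast)
      qed
    qed
    ultimately show ?thesis by blast
  qed
qed

theorem theorem4p1:
  fixes A :: "real^'n^'n" and B :: "real^'p^'n" and K :: "real^'n^'p" and Bw :: "real^'d^'n"
    and M :: "'w measure" and W :: "real \<Rightarrow> 'w \<Rightarrow> real^'d"
    and \<zeta> :: "real \<Rightarrow> real^'n \<Rightarrow> 'w \<Rightarrow> real^'n"
    and \<epsilon> :: real and kbar :: nat
    and R :: "(real^'n) \<times> nat \<Rightarrow> real" and Rmax \<gamma> :: real
    and X :: "(real^'n) set" and cells :: "(real^'n) set set"
    and Plo Phi :: "(real^'n) imc_state \<Rightarrow> (real^'n) imc_state \<Rightarrow> real"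
    and crit :: criterion and N :: nat
    and y0 :: "(real^'n) \<times> nat" and q0 :: "(real^'n) imc_state"
  assumes "controllable A Bw"
    and "wiener_process M W"
    and "solves_sde M W A B K Bw \<zeta>"
    and "\<epsilon> > 0" and "kbar \<ge> 1"
    and "R \<in> borel_measurable (sample_space kbar)"
    and "\<forall>y \<in> UNIV \<times> {0..kbar}. 0 \<le> R y \<and> R y \<le> Rmax"
    and "0 \<le> \<gamma>" and "\<gamma> \<le> 1"
    and "compact X" and "finite cells" and "X = \<Union>cells"
    and "\<forall>S\<in>cells. S \<noteq> {} \<and> compact S"
    and "\<forall>S\<in>cells. \<forall>T\<in>cells. S \<noteq> T \<longrightarrow> S \<inter> T \<in> null_sets lborel"
    and "is_imc (imc_states cells kbar) Plo Phi"
    and "abstracts M \<zeta> \<epsilon> kbar X cells Plo Phi"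
    and "\<forall>q \<in> imc_states cells kbar. attains_min_max R (reward_domain kbar q)"
    and "y0 \<in> X \<times> {0..kbar}"
    and "q0 \<in> imc_states cells kbar" and "y0 \<in> denotation X kbar q0"
  shows "(INF \<pi>\<in>adversaries (imc_states cells kbar) Plo Phi.
            imc_expectation \<pi> q0 N (path_reward crit \<gamma> N (lower_reward kbar R)))
         \<le> (\<integral>\<omega>. path_reward crit \<gamma> N R \<omega>
              \<partial>(markov_path_law (sample_space kbar) (sample_kernel M \<zeta> \<epsilon> kbar) y0 N))
       \<and> (\<integral>\<omega>. path_reward crit \<gamma> N R \<omega>
              \<partial>(markov_path_law (sample_space kbar) (sample_kernel M \<zeta> \<epsilon> kbar) y0 N))
         \<le> (SUP \<pi>\<in>adversaries (imc_states cells kbar) Plo Phi.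
            imc_expectation \<pi> q0 N (path_reward crit \<gamma> N (upper_reward kbar R)))"
proof -
  let ?Q = "imc_states cells kbar"
  let ?S = "sample_space kbar :: ((real^'n) \<times> nat) measure"
  let ?\<kappa> = "sample_kernel M \<zeta> \<epsilon> kbar"
  let ?D = "reward_domain kbar"
  let ?F = "feasible ?Q Plo Phi"
  have spS: "space ?S = UNIV \<times> {0..kbar}" by (auto simp: sample_space_def space_pair_measure)
  have \<kappa>: "?\<kappa> \<in> measurable ?S (prob_algebra ?S)" by (rule sample_kernel_measurable[OF assms(2,3)])
  have R: "bounded_measurable ?S R"
    unfolding bounded_measurable_def spS
    using assms(6,7) by (intro conjI exI[of _ Rmax]) auto
  have R0: "0 \<le> R y" if "y \<in> space ?S" for y using that assms(7) unfolding spS by blast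
  have D: "?D q \<subseteq> space ?S" if "q \<in> ?Q" for q
    using that unfolding spS by (cases q) (auto simp: imc_states_def)
  have couple: "\<exists>p. ?F q p \<and> couples ?S ?\<kappa> ?Q ?D y p" if "q \<in> ?Q" "y \<in> ?D q" for q y
    by (rule sample_kernel_coupling[OF assms(1-5,11,10,12-16) that])
  have finQ: "finite ?Q" and lo: "\<And>q q'. q \<in> ?Q \<Longrightarrow> q' \<in> ?Q \<Longrightarrow> 0 \<le> Plo q q'"
    using assms(15) by (auto simp: is_imc_def)
  have ne: "\<exists>y. y \<in> ?D q" if "q \<in> ?Q" for q
    using assms(17) that unfolding attains_min_max_def by blast
  have bdd: "bdd_below (R ` ?D q)" "bdd_above (R ` ?D q)" if "q \<in> ?Q" for q
    using assms(7) D[OF that] unfolding spS by (auto intro!: bdd_belowI2[of _ 0] bdd_aboveI2[of _ _ Rmax])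
  have low: "lower_reward kbar R q \<le> R y" if "q \<in> ?Q" "y \<in> ?D q" for q y
    unfolding lower_reward_def by (rule cINF_lower[OF bdd(1) that(2)]) (rule that)
  have low0: "0 \<le> lower_reward kbar R q" if "q \<in> ?Q" for q
    unfolding lower_reward_def using ne[OF that] D[OF that] R0 by (intro cINF_greatest) auto
  have up: "R y \<le> upper_reward kbar R q" if "q \<in> ?Q" "y \<in> ?D q" for q y
    unfolding upper_reward_def by (rule cSUP_upper[OF that(2) bdd(2)]) (rule that)
  \<comment> \<open>The chain itself supplies a feasible distribution: the one coupled to the kernel
    at any point of the reward domain, which is nonempty because extrema are attained.\<close>
  have min: "\<exists>p. ?F q p \<and> (\<forall>p'. ?F q p' \<longrightarrow> measure_pmf.expectation p f \<le> measure_pmf.expectation p' f)" if q: "q \<in> ?Q" for q and f :: "_ \<Rightarrow> real"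
  proof -
    obtain y where "y \<in> ?D q" using ne[OF q] by blast
    then obtain p0 where "?F q p0" using couple[OF q] by blast
    then show ?thesis
      using feasible_minimiser[OF finQ, where q = q and ?p0.0 = p0] lo[OF q] by simp
  qed
  define selmin where "selmin f q = (SOME p. ?F q p \<and> (\<forall>p'. ?F q p' \<longrightarrow>
      measure_pmf.expectation p f \<le> measure_pmf.expectation p' f))" for f :: "_ \<Rightarrow> real" and q
  have sel: "?F q (selmin f q) \<and> (\<forall>p'. ?F q p' \<longrightarrow>
      measure_pmf.expectation (selmin f q) f \<le> measure_pmf.expectation p' f)" if "q \<in> ?Q" for q and f :: "_ \<Rightarrow> real"
    unfolding selmin_def by (rule someI_ex[OF min[OF that]])
  have selmin: "?F q (selmin f q)"
      "?F q p \<Longrightarrow> measure_pmf.expectation (selmin f q) f \<le> measure_pmf.expectation p f" if "q \<in> ?Q" for q p and f :: "_ \<Rightarrow> real"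
    using sel[OF that] by simp_all
  define selmax where "selmax f = selmin (\<lambda>q. - f q)" for f :: "_ \<Rightarrow> real"
  have selmax: "?F q (selmax f q)" "?F q p \<Longrightarrow> measure_pmf.expectation p f \<le> measure_pmf.expectation (selmax f q) f"
    if "q \<in> ?Q" for q p and f :: "_ \<Rightarrow> real"
    using selmin(1)[OF that] selmin(2)[OF that, of p "\<lambda>q. - f q"] by (auto simp: selmax_def)
  \<comment> \<open>The chain starts in \<open>X\<close>, so \<open>q0\<close> is a cell, and for
    cells denotation and reward domain agree.\<close>
  have y0: "y0 \<in> space ?S" "y0 \<in> ?D q0"
    using assms(18,20) unfolding spS by (cases q0; auto)+
  have total: "(\<integral>\<omega>. path_reward crit \<gamma> N R \<omega> \<partial>(markov_path_law ?S ?\<kappa> y0 N))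
      = reward_to_go crit \<gamma> N R (\<lambda>f y. \<integral>z. f z \<partial>?\<kappa> y) N 0 y0"
    by (rule markov_path_reward[OF \<kappa> y0(1) R])
  obtain \<pi> where \<pi>: "\<pi> \<in> adversaries ?Q Plo Phi"
    "imc_expectation \<pi> q0 N (path_reward crit \<gamma> N (lower_reward kbar R))
      = reward_to_go crit \<gamma> N (lower_reward kbar R) (\<lambda>f q. measure_pmf.expectation (selmin f q) f) N 0 q0"
    using imc_path_reward[OF finQ assms(19), of Plo Phi selmin] selmin(1) by blast
  have "(INF \<pi>\<in>adversaries ?Q Plo Phi. imc_expectation \<pi> q0 N (path_reward crit \<gamma> N (lower_reward kbar R)))
      \<le> imc_expectation \<pi> q0 N (path_reward crit \<gamma> N (lower_reward kbar R))"
    by (rule cINF_lower[OF imc_expectations_bounded(1)[OF finQ assms(19)] \<pi>(1)])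
  also have "\<dots> \<le> reward_to_go crit \<gamma> N R (\<lambda>f y. \<integral>z. f z \<partial>?\<kappa> y) N 0 y0"
    unfolding \<pi>(2)
    by (rule reward_to_go_abstraction_lower[where D = ?D and F = ?F, OF \<kappa> R assms(8) _ couple selmin(2) low low0 assms(19) y0(2)])
       (use selmin(1) in \<open>auto simp: feasible_def\<close>)
  finally have lower: "(INF \<pi>\<in>adversaries ?Q Plo Phi. imc_expectation \<pi> q0 N (path_reward crit \<gamma> N (lower_reward kbar R)))
      \<le> reward_to_go crit \<gamma> N R (\<lambda>f y. \<integral>z. f z \<partial>?\<kappa> y) N 0 y0" .
  obtain \<pi>' where \<pi>': "\<pi>' \<in> adversaries ?Q Plo Phi"
    "imc_expectation \<pi>' q0 N (path_reward crit \<gamma> N (upper_reward kbar R))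
      = reward_to_go crit \<gamma> N (upper_reward kbar R) (\<lambda>f q. measure_pmf.expectation (selmax f q) f) N 0 q0"
    using imc_path_reward[OF finQ assms(19), of Plo Phi selmax] selmax(1) by blast
  have "reward_to_go crit \<gamma> N R (\<lambda>f y. \<integral>z. f z \<partial>?\<kappa> y) N 0 y0
      \<le> imc_expectation \<pi>' q0 N (path_reward crit \<gamma> N (upper_reward kbar R))"
    unfolding \<pi>'(2)
    by (rule reward_to_go_abstraction_upper[where D = ?D and F = ?F, OF \<kappa> R assms(8) couple selmax(2) up R0 D assms(19) y0(2)])
  also have "\<dots> \<le> (SUP \<pi>\<in>adversaries ?Q Plo Phi. imc_expectation \<pi> q0 N (path_reward crit \<gamma> N (upper_reward kbar R)))"
    by (rule cSUP_upper[OF \<pi>'(1) imc_expectations_bounded(2)[OF finQ assms(19)]])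
  finally have upper: "reward_to_go crit \<gamma> N R (\<lambda>f y. \<integral>z. f z \<partial>?\<kappa> y) N 0 y0
      \<le> (SUP \<pi>\<in>adversaries ?Q Plo Phi. imc_expectation \<pi> q0 N (path_reward crit \<gamma> N (upper_reward kbar R)))" .
  from lower upper show ?thesis unfolding total by blast
qed

end
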